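(* Let $X_1,X_2,\dots$ be i.i.d. random variables whose distribution function is Pareto, $F(x)=1-x^{-\lambda}$ for $x\ge 1$, for some $\lambda>0$ (the null hypothesis $H_0$). Then for $a>0$ $$\lim_{n\to\infty} n^{-1}\ln P\bigl(I_n^{(3)}>a\bigr)=-f_I^{(3)}(a),$$ where the function $f_I^{(3)}$ is continuous for sufficiently small $a>0$, and $$f_I^{(3)}(a)\sim\frac{a^2}{32\,\Delta_3^2}\approx 5.455\,a^2\qquad\text{as } a\to 0,$$ where $\Delta_3^2=\frac{11}{1920}$.
   Context: For $n\ge 3$ and $t\ge 1$, let $$H_n(t)=\binom{n}{3}^{-1}\sum_{1\le i_1<i_2<i_3\le n}\mathbf 1\{X_{(3,\{i_1,i_2,i_3\})}/X_{(2,\{i_1,i_2,i_3\})}<t\},$$ where $X_{(s,\{i_1,i_2,i_3\})}$ is the $s$-th order statistic (in increasing order) of the subsample $X_{i_1},X_{i_2},X_{i_3}$. Let $F_n(t)=n^{-1}\sum_{i=1}^n\mathbf 1(X_i<t)$ be the empirical distribution function. The statistic is $$I_n^{(3)}=\int_1^\infty (H_n(t)-F_n(t))\,dF_n(t)=\frac1n\sum_{i=1}^n\bigl(H_n(X_i)-F_n(X_i)\bigr).$$ The number $\Delta_3^2$ is $\int_1^\infty\psi_3^2(s)s^{-2}\,ds=\frac{11}{1920}$, where $\psi_3(s)=\frac{9}{8s^2}+\frac{3\ln s}{2s}-\frac1s-\frac14$. The notation $f(a)\sim g(a)$ means $f(a)/g(a)\to 1$; the decimal $5.455$ is a rounded value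 of $1/(32\Delta_3^2)$. *)

theory Defs
  imports "HOL-Probability.Probability" "HOL-Library.Landau_Symbols"
begin

(* The sample X_1, ..., X_n is indexed from 0: it is x 0, ..., x (n - 1). *)

definition order_stat :: "(nat \<Rightarrow> real) \<Rightarrow> nat \<Rightarrow> nat set \<Rightarrow> real" where
  "order_stat x s J = sort (map x (sorted_list_of_set J)) ! (s - 1)"

definition H_emp :: "(nat \<Rightarrow> real) \<Rightarrow> nat \<Rightarrow> real \<Rightarrow> real" where
  "H_emp x n t =
     (\<Sum>J | J \<subseteq> {..<n} \<and> card J = 3. of_bool (order_stat x 3 J / order_stat x 2 J < t))
       / real (n choose 3)"

(* Strict inequality: the left-continuous version of the empirical distribution function. *)
definition F_emp :: "(nat \<Rightarrow> real) \<Rightarrow> nat \<Rightarrow> real \<Rightarrow> real" where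
  "F_emp x n t = (\<Sum>i<n. of_bool (x i < t)) / real n"

(* The integral of H_emp - F_emp over [1, \<infinity>) against the empirical distribution, written as the
   average over the sample (all Pareto observations are almost surely at least 1). *)
definition I_stat :: "(nat \<Rightarrow> real) \<Rightarrow> nat \<Rightarrow> real" where
  "I_stat x n = (\<Sum>i<n. H_emp x n (x i) - F_emp x n (x i)) / real n"

definition pareto_cdf :: "real \<Rightarrow> real \<Rightarrow> real" where
  "pareto_cdf l x = (if x \<ge> 1 then 1 - x powr (- l) else 0)"

definition psi3 :: "real \<Rightarrow> real" where
  "psi3 s = 9 / (8 * s\<^sup>2) + 3 * ln s / (2 * s) - 1 / s - 1 / 4"

definition Delta3_sq :: real where
  "Delta3_sq = (LBINT s:{1..}. (psi3 s)\<^sup>2 / s\<^sup>2)"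

(* The logarithm of a probability with ln 0 = -\<infinity>; on the reals, ln 0 = 0 by convention, which would
   give a wrong limit for large a, where the event {I_n > a} is null. *)
definition ln_prob :: "real \<Rightarrow> ereal" where
  "ln_prob p = (if p = 0 then - \<infinity> else ereal (ln p))"

end

theory Submission
  imports Defs "HOL-Real_Asymp.Real_Asymp"
begin

text \<open>Put U_i = X_i powr (- l). Under the null hypothesis the U_i are independent and uniform on (0, 1), and an inequality
such as X_i \<ge> max X_j X_k * X_m becomes U_i \<le> min U_j U_k * U_m. Such a quadruple is called bad. Up to O(1/n) the
statistic equals 1/2 - b, where b is three times the proportion of bad quadruples: a triple has its ratio at or above
X_m exactly if one of its three members is far ahead of the other two, and the average of F_n over the sample is about
1/2. So the statistic is a polynomial of degree four in the empirical measure, and the theorem is a large deviation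
result for it. The proof is a version of Sanov's theorem in finite terms.

Cut (0, 1) into N equal cells and record only the vector q of cell frequencies. A quadruple of cells decides badness
except for at most three values of its first member, so the statistic is T(q) = 1/2 - b(q) up to a multiple of the
largest frequency (lemma I_stat_approx). Counting words by their frequencies bounds the probability of a set of
frequency vectors by a polynomial times exp (- n * inf KL), where KL is the entropy relative to the uniform vector
(tail_le); changing the measure gives the matching lower bound exp (- n * KL q) for any q with T(q) safely above a
(tail_ge). Vectors with a large entry cost nothing in these bounds, since their entropy tends to infinity with N.

Between the two bounds there remains the gap between T \<ge> a and T > a. The limit exists for every a only because the
optimal cost does not jump, and this is the main point of the proof (cheap_improvement): every q with bounded entropy
and b(q) bounded below can be changed, at an arbitrarily small entropy cost, so that T increases by a fixed amount,
uniformly in N. Let r be q conditioned on a narrow window with little mass below it, and mix q and r with weights 1 - h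
and h. The terms with two arguments in the window are negligible, so if \<beta> is the first order coefficient,
b((1-h) q + h r) is about (1-h)^4 b + (1-h)^3 h \<beta>. If \<beta> \<le> 4 b this is at most b (1-h)^3 (1+3h), which is b (1 - 6 h^2 + ...);
if \<beta> > 4 b the same bound holds with -h in place of h. In both cases b decreases by an amount of order h^2 b. This
yields the existence of the limit for a < 1/2 (decay_convergent) and the continuity of the rate (continuous_rate).
At a = 1/2, the supremum of T, the limit is - ln 4: a vector with b close to 0 has almost all its mass in
a window [t^2, t], whose length is at most 1/4. For a > 1/2 the tail decays faster than any exponential.

For small a the linear part of T around the uniform vector dominates. It is 4 times the integral of \<psi>(u) = psi3 (1/u)
against q, with an error of the order of the squared total variation distance, hence of KL. Duality with the tilt
exp (\<theta> \<psi>), \<theta> = a / (4 \<Delta>^2), gives KL \<ge> (1 - o(1)) a^2 / (32 \<Delta>^2) (KL_ge_quadratic), and the vectors proportional to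
1 + h \<psi>, with h close to a / (4 \<Delta>^2), attain it (ex_cheap_prob_vec). Here \<Delta>^2, the integral of \<psi>^2 over (0, 1),
is computed from an explicit antiderivative.\<close>

section \<open>Relative entropy of probability vectors\<close>

text \<open>Probability vectors are functions on the naturals of which only the first N values count, so that vectors of
different lengths have the same type.\<close>

definition prob_vecs :: "nat \<Rightarrow> (nat \<Rightarrow> real) set" where
  "prob_vecs N = {q. (\<forall>j<N. 0 \<le> q j) \<and> (\<Sum>j<N. q j) = 1}"

text \<open>The relative entropy with respect to the uniform vector of length N.\<close>

definition KL :: "nat \<Rightarrow> (nat \<Rightarrow> real) \<Rightarrow> real" where
  "KL N q = (\<Sum>j<N. q j * ln (real N * q j))"

lemma prob_vecs_nonneg: "q \<in> prob_vecs N \<Longrightarrow> j < N \<Longrightarrow> 0 \<le> q j"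
  by (auto simp: prob_vecs_def)

lemma prob_vecs_sum: "q \<in> prob_vecs N \<Longrightarrow> (\<Sum>j<N. q j) = 1"
  by (auto simp: prob_vecs_def)

lemma prob_vecs_pos: "q \<in> prob_vecs N \<Longrightarrow> 0 < N"
  by (cases N) (auto simp: prob_vecs_def)

lemma prob_vecs_subset_le_1:
  assumes "q \<in> prob_vecs N" "S \<subseteq> {..<N}"
  shows "sum q S \<le> 1" "0 \<le> sum q S"
proof -
  have "sum q S \<le> sum q {..<N}"
    by (rule sum_mono2) (use assms in \<open>auto simp: prob_vecs_def\<close>)
  then show "sum q S \<le> 1" using assms by (simp add: prob_vecs_def)
  show "0 \<le> sum q S" by (rule sum_nonneg) (use assms in \<open>auto simp: prob_vecs_def\<close>)
qed

lemma prob_vecs_le_1: "q \<in> prob_vecs N \<Longrightarrow> j < N \<Longrightarrow> q j \<le> 1"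
  using prob_vecs_subset_le_1(1)[of q N "{j}"] by simp

text \<open>The variational lower bound of Donsker and Varadhan. It follows from ln y \<le> y - 1 applied to the ratio of the
tilted uniform vector to q, and it is the source of all lower bounds on the entropy below.\<close>

lemma KL_ge_exp_mean:
  assumes q: "q \<in> prob_vecs N"
  shows "(\<Sum>j<N. q j * g j) - ln ((\<Sum>j<N. exp (g j)) / N) \<le> KL N q"
proof -
  have N: "0 < N" using q by (rule prob_vecs_pos)
  define Z where "Z = (\<Sum>j<N. exp (g j)) / N"
  have Z: "0 < Z" unfolding Z_def
    by (intro divide_pos_pos sum_pos) (use N in auto)
  have pt: "q j * (g j - ln Z - ln (N * q j)) \<le> exp (g j) / (Z * N) - q j" if j: "j < N" for j
  proof (cases "q j = 0")
    case True
    then show ?thesis using Z N by simp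
  next
    case False
    then have p: "0 < q j" using prob_vecs_nonneg[OF q j] by simp
    have "g j - ln Z - ln (N * q j) = ln (exp (g j) / (Z * (N * q j)))"
      using p N Z by (simp add: ln_div ln_mult)
    also have "\<dots> \<le> exp (g j) / (Z * (N * q j)) - 1"
      by (rule ln_le_minus_one) (use p N Z in simp)
    finally have "q j * (g j - ln Z - ln (N * q j)) \<le> q j * (exp (g j) / (Z * (N * q j)) - 1)"
      using p by simp
    also have "\<dots> = exp (g j) / (Z * N) - q j" using p N Z by (simp add: field_simps)
    finally show ?thesis .
  qed
  have "(\<Sum>j<N. q j * (g j - ln Z - ln (N * q j))) \<le> (\<Sum>j<N. exp (g j) / (Z * N) - q j)"
    by (rule sum_mono) (use pt in auto)
  also have "\<dots> = (\<Sum>j<N. exp (g j)) / (Z * N) - 1"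
    by (simp add: sum_subtractf prob_vecs_sum[OF q] sum_divide_distrib)
  also have "\<dots> = 0" using Z N unfolding Z_def by (simp add: field_simps)
  finally have "(\<Sum>j<N. q j * g j) - ln Z * (\<Sum>j<N. q j) - KL N q \<le> 0"
    by (simp add: KL_def algebra_simps sum_subtractf sum.distrib sum_distrib_left)
  then show ?thesis by (simp add: prob_vecs_sum[OF q] Z_def)
qed

text \<open>The variational bound for the function that is t on S and 0 elsewhere.\<close>

lemma KL_ge_mass:
  fixes s t :: real
  assumes q: "q \<in> prob_vecs N" and S: "S \<subseteq> {..<N}" and c: "real (card S) \<le> s * N" and t: "0 \<le> t"
  shows "t * sum q S - ln (1 + exp t * s) \<le> KL N q"
proof -
  have N: "0 < N" using q by (rule prob_vecs_pos)
  have fS: "finite S" using S finite_subset by blast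
  define g where "g j = (if j \<in> S then t else 0)" for j
  have "0 \<le> s * N" using c of_nat_0_le_iff order_trans by blast
  then have s0: "0 \<le> s" using N by (simp add: zero_le_mult_iff)
  have 1: "(\<Sum>j<N. q j * g j) = t * sum q S"
  proof -
    have "(\<Sum>j<N. q j * g j) = (\<Sum>j\<in>S. q j * t)"
      unfolding g_def by (rule sum.mono_neutral_cong_right) (use S in auto)
    then show ?thesis by (simp add: sum_distrib_left mult.commute)
  qed
  have "(\<Sum>j<N. exp (g j)) \<le> (\<Sum>j<N. 1 + (if j \<in> S then exp t else 0))"
    by (rule sum_mono) (auto simp: g_def)
  also have "\<dots> = N + card S * exp t"
  proof -
    have "(\<Sum>j<N. (if j \<in> S then exp t else 0)) = (\<Sum>j\<in>S. exp t)"
      by (rule sum.mono_neutral_cong_right) (use S in auto)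
    then show ?thesis by (simp add: sum.distrib)
  qed
  also have "\<dots> \<le> N + s * N * exp t" using c by simp
  finally have "(\<Sum>j<N. exp (g j)) / N \<le> 1 + exp t * s" using N by (simp add: field_simps)
  moreover have "0 < (\<Sum>j<N. exp (g j)) / N"
    by (intro divide_pos_pos sum_pos) (use N in auto)
  ultimately have "ln ((\<Sum>j<N. exp (g j)) / N) \<le> ln (1 + exp t * s)"
    by (subst ln_le_cancel_iff) (auto intro: less_le_trans)
  then show ?thesis using KL_ge_exp_mean[OF q, of g] 1 by simp
qed

text \<open>Bounded entropy forces small mass on small sets: this replaces compactness of the entropy level sets. It is the
previous bound with exp t = 1 / s.\<close>

lemma KL_small_set:
  fixes s :: real
  assumes q: "q \<in> prob_vecs N" and S: "S \<subseteq> {..<N}" and c: "real (card S) \<le> s * N"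
    and s: "0 < s" "s \<le> 1"
  shows "ln (1 / s) * sum q S \<le> KL N q + ln 2"
  using KL_ge_mass[OF q S c, of "ln (1/s)"] s by simp

lemma KL_nonneg: "q \<in> prob_vecs N \<Longrightarrow> 0 \<le> KL N q"
  using KL_ge_exp_mean[of q N "\<lambda>_. 0"] prob_vecs_pos[of q N] by simp

text \<open>With s = sqrt x the difference of both sides is 2 s (s ln s - s + 1).\<close>

lemma entropy_ge_hellinger:
  assumes "0 \<le> (x::real)"
  shows "(sqrt x - 1)\<^sup>2 \<le> x * ln x - x + 1"
proof (cases "x = 0")
  case False
  define s where "s = sqrt x"
  have s: "0 < s" "x = s\<^sup>2" using assms False by (auto simp: s_def)
  have "ln (1 / s) \<le> 1 / s - 1" by (rule ln_le_minus_one) (use s in simp)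
  then have "1 - 1 / s \<le> ln s" using s by (simp add: ln_div)
  then have "2 * s\<^sup>2 * (1 - 1 / s) \<le> 2 * s\<^sup>2 * ln s" using s by (intro mult_left_mono) auto
  moreover have "2 * s\<^sup>2 * (1 - 1 / s) = 2 * s\<^sup>2 - 2 * s" using s by (simp add: field_simps power2_eq_square)
  moreover have "x * ln x = 2 * s\<^sup>2 * ln s" using s(1) unfolding s(2) by (subst ln_realpow) auto
  moreover have "sqrt x = s" by (simp add: s_def)
  ultimately have "(s - 1)\<^sup>2 \<le> x * ln x - s\<^sup>2 + 1" by (simp add: power2_diff)
  then show ?thesis using s(2) \<open>sqrt x = s\<close> by simp
qed auto

text \<open>Pinsker's inequality with constant 4 instead of 2, obtained by way of the Hellinger distance and the
Cauchy-Schwarz inequality.\<close>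

lemma total_variation_sq_le_KL:
  assumes q: "q \<in> prob_vecs N"
  shows "(\<Sum>j<N. \<bar>q j - 1 / N\<bar>)\<^sup>2 \<le> 4 * KL N q"
proof -
  have N: "0 < N" using q by (rule prob_vecs_pos)
  define x where "x j = N * q j" for j
  have x0: "0 \<le> x j" if "j < N" for j using prob_vecs_nonneg[OF q that] by (simp add: x_def)
  have sx: "(\<Sum>j<N. x j) = N" unfolding x_def sum_distrib_left[symmetric] prob_vecs_sum[OF q] by simp
  have 1: "(\<Sum>j<N. \<bar>q j - 1 / N\<bar>) = (\<Sum>j<N. \<bar>sqrt (x j) - 1\<bar> * (sqrt (x j) + 1)) / N"
    unfolding sum_divide_distrib
  proof (rule sum.cong[OF refl])
    fix j assume "j \<in> {..<N}"
    then have j: "j < N" by simp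
    have "\<bar>sqrt (x j) - 1\<bar> * (sqrt (x j) + 1) = \<bar>(sqrt (x j) - 1) * (sqrt (x j) + 1)\<bar>"
      using x0[OF j] by (simp add: abs_mult)
    also have "(sqrt (x j) - 1) * (sqrt (x j) + 1) = x j - 1" using x0[OF j] by (simp add: algebra_simps)
    also have "\<bar>x j - 1\<bar> = \<bar>N * (q j - 1 / N)\<bar>" using N by (simp add: x_def right_diff_distrib)
    also have "\<dots> = N * \<bar>q j - 1 / N\<bar>" by (simp add: abs_mult)
    finally show "\<bar>q j - 1 / N\<bar> = \<bar>sqrt (x j) - 1\<bar> * (sqrt (x j) + 1) / N"
      using N by (simp add: nonzero_eq_divide_eq mult.commute)
  qed
  have A: "(\<Sum>j<N. \<bar>sqrt (x j) - 1\<bar>\<^sup>2) \<le> N * KL N q"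
  proof -
    have "(\<Sum>j<N. \<bar>sqrt (x j) - 1\<bar>\<^sup>2) \<le> (\<Sum>j<N. x j * ln (x j) - x j + 1)"
      by (rule sum_mono) (use entropy_ge_hellinger x0 in auto)
    also have "\<dots> = (\<Sum>j<N. x j * ln (x j))" by (simp add: sum.distrib sum_subtractf sx)
    also have "\<dots> = N * KL N q" by (simp add: KL_def x_def sum_distrib_left mult.assoc)
    finally show ?thesis .
  qed
  have B: "(\<Sum>j<N. (sqrt (x j) + 1)\<^sup>2) \<le> 4 * N"
  proof -
    have "(\<Sum>j<N. (sqrt (x j) + 1)\<^sup>2) \<le> (\<Sum>j<N. 2 * x j + 2)"
    proof (rule sum_mono)
      fix j assume "j \<in> {..<N}"
      then have j: "j < N" by simp
      have "0 \<le> (sqrt (x j) - 1)\<^sup>2" by simp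
      then show "(sqrt (x j) + 1)\<^sup>2 \<le> 2 * x j + 2" using x0[OF j]
        by (simp add: power2_eq_square algebra_simps)
    qed
    also have "\<dots> = 4 * N" by (simp add: sum.distrib sum_distrib_left[symmetric] sx)
    finally show ?thesis by simp
  qed
  have "(\<Sum>j<N. \<bar>sqrt (x j) - 1\<bar> * (sqrt (x j) + 1))\<^sup>2
      \<le> (\<Sum>j<N. \<bar>sqrt (x j) - 1\<bar>\<^sup>2) * (\<Sum>j<N. (sqrt (x j) + 1)\<^sup>2)"
    by (rule Cauchy_Schwarz_ineq_sum)
  also have "\<dots> \<le> (N * KL N q) * (4 * N)"
    by (rule mult_mono[OF A B]) (auto intro: sum_nonneg simp: KL_nonneg[OF q])
  finally show ?thesis unfolding 1 using N
    by (simp add: power_divide field_simps power2_eq_square)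
qed

text \<open>The negative part of the integrand is bounded by 1 / N in each cell, because - x ln x \<le> 1.\<close>

lemma sum_abs_log_le_KL:
  assumes q: "q \<in> prob_vecs N"
  shows "(\<Sum>j<N. q j * \<bar>ln (N * q j)\<bar>) \<le> KL N q + 2"
proof -
  have N: "0 < N" using q by (rule prob_vecs_pos)
  have "(\<Sum>j<N. q j * \<bar>ln (N * q j)\<bar>) \<le> (\<Sum>j<N. q j * ln (N * q j) + 2 / N)"
  proof (rule sum_mono)
    fix j assume "j \<in> {..<N}"
    then have q0: "0 \<le> q j" using prob_vecs_nonneg[OF q] by simp
    show "q j * \<bar>ln (N * q j)\<bar> \<le> q j * ln (N * q j) + 2 / N"
    proof (cases "q j > 0 \<and> ln (N * q j) < 0")
      case False
      then show ?thesis using q0 by (cases "q j = 0") (auto simp: not_less)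
    next
      case True
      then have p: "0 < q j" by simp
      have "ln (1 / (N * q j)) \<le> 1 / (N * q j) - 1" by (rule ln_le_minus_one) (use p N in simp)
      then have "- ln (N * q j) \<le> 1 / (N * q j)" using p N by (simp add: ln_div)
      then have "q j * (- ln (N * q j)) \<le> q j * (1 / (N * q j))" using p by (intro mult_left_mono) auto
      also have "\<dots> = 1 / N" using p by simp
      finally show ?thesis using True by (simp add: abs_if)
    qed
  qed
  also have "\<dots> = KL N q + 2" using N by (simp add: KL_def sum.distrib)
  finally show ?thesis .
qed

section \<open>The discretised kernel\<close>

text \<open>The condition U_a < min U_b U_c * U_d evaluated at the left end points a/N, b/N, c/N, d/N of the cells and
multiplied by N^2, so that it is a condition on integers.\<close>

definition cell_kernel :: "nat \<Rightarrow> nat \<Rightarrow> nat \<Rightarrow> nat \<Rightarrow> nat \<Rightarrow> real" where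
  "cell_kernel N a b c d = of_bool (a * N < min b c * d)"

text \<open>The four arguments are kept separate so that mixtures and perturbations of probability vectors can be expanded by
multilinearity.\<close>

definition quad :: "nat \<Rightarrow> (nat \<Rightarrow> real) \<Rightarrow> (nat \<Rightarrow> real) \<Rightarrow> (nat \<Rightarrow> real) \<Rightarrow> (nat \<Rightarrow> real) \<Rightarrow> real" where
  "quad N f g h k = (\<Sum>a<N. \<Sum>b<N. \<Sum>c<N. \<Sum>d<N. f a * g b * h c * k d * cell_kernel N a b c d)"

text \<open>The factor 3 counts the choices of the observation that is far ahead of the other two in a triple.\<close>

definition bad_mass :: "nat \<Rightarrow> (nat \<Rightarrow> real) \<Rightarrow> real" where
  "bad_mass N q = 3 * quad N q q q q"

lemma cell_kernel_bounds: "0 \<le> cell_kernel N a b c d" "cell_kernel N a b c d \<le> 1"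
  by (auto simp: cell_kernel_def)

lemma quad_linear:
  "quad N (\<lambda>j. s * f j + t * f' j) g h k = s * quad N f g h k + t * quad N f' g h k"
  "quad N f (\<lambda>j. s * g j + t * g' j) h k = s * quad N f g h k + t * quad N f g' h k"
  "quad N f g (\<lambda>j. s * h j + t * h' j) k = s * quad N f g h k + t * quad N f g h' k"
  "quad N f g h (\<lambda>j. s * k j + t * k' j) = s * quad N f g h k + t * quad N f g h k'"
  unfolding quad_def by (simp_all add: sum_distrib_left algebra_simps sum.distrib)

lemma sum4_factor:
  "(\<Sum>a<N. \<Sum>b<N. \<Sum>c<N. \<Sum>d<N. (f a * g b * h c * k d :: real)) = sum f {..<N} * sum g {..<N} * sum h {..<N} * sum k {..<N::nat}"
  by (simp add: sum_distrib_left[symmetric] sum_distrib_right[symmetric] mult.assoc)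

lemma abs_quad_le:
  "\<bar>quad N f g h k\<bar> \<le> (\<Sum>j<N. \<bar>f j\<bar>) * (\<Sum>j<N. \<bar>g j\<bar>) * (\<Sum>j<N. \<bar>h j\<bar>) * (\<Sum>j<N. \<bar>k j\<bar>)"
proof -
  have "\<bar>quad N f g h k\<bar> \<le> (\<Sum>a<N. \<Sum>b<N. \<Sum>c<N. \<Sum>d<N. \<bar>f a * g b * h c * k d * cell_kernel N a b c d\<bar>)"
    unfolding quad_def
    by (intro order_trans[OF sum_abs] sum_mono order_refl)
  also have "\<dots> \<le> (\<Sum>a<N. \<Sum>b<N. \<Sum>c<N. \<Sum>d<N. \<bar>f a\<bar> * \<bar>g b\<bar> * \<bar>h c\<bar> * \<bar>k d\<bar>)"
    by (intro sum_mono) (auto simp: abs_mult cell_kernel_def)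
  finally show ?thesis by (simp add: sum4_factor)
qed

lemma quad_nonneg:
  assumes "\<And>j. j < N \<Longrightarrow> 0 \<le> f j" "\<And>j. j < N \<Longrightarrow> 0 \<le> g j" "\<And>j. j < N \<Longrightarrow> 0 \<le> h j" "\<And>j. j < N \<Longrightarrow> 0 \<le> k j"
  shows "0 \<le> quad N f g h k"
  unfolding quad_def by (intro sum_nonneg mult_nonneg_nonneg) (use assms cell_kernel_bounds in auto)

lemma bad_mass_nonneg: "q \<in> prob_vecs N \<Longrightarrow> 0 \<le> bad_mass N q"
  unfolding bad_mass_def using quad_nonneg[of N q q q q] prob_vecs_nonneg by auto


definition freq :: "nat \<Rightarrow> (nat \<Rightarrow> nat) \<Rightarrow> nat \<Rightarrow> real" where
  "freq n c j = card {i. i < n \<and> c i = j} / n"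

lemma sum_over_cells:
  fixes g :: "nat \<Rightarrow> real"
  assumes "\<And>i. i < n \<Longrightarrow> c i < N"
  shows "(\<Sum>i<n. g (c i)) = n * (\<Sum>j<N. freq n c j * g j)"
proof (cases "n = 0")
  case False
  have "(\<Sum>i<n. g (c i)) = (\<Sum>j<N. \<Sum>i\<in>{i\<in>{..<n}. c i = j}. g (c i))"
    by (rule sum.group[symmetric]) (use assms in auto)
  also have "\<dots> = (\<Sum>j<N. n * (freq n c j * g j))"
    by (rule sum.cong) (use False in \<open>auto simp: freq_def\<close>)
  finally show ?thesis by (simp add: sum_distrib_left)
qed auto

lemma freq_prob_vecs:
  assumes "\<And>i. i < n \<Longrightarrow> c i < N" "0 < n"
  shows "freq n c \<in> prob_vecs N"
proof -
  have "(\<Sum>i<n. 1::real) = n * (\<Sum>j<N. freq n c j * 1)"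
    by (rule sum_over_cells) (use assms in auto)
  then have "(\<Sum>j<N. freq n c j) = 1" using assms(2) by simp
  then show ?thesis by (auto simp: prob_vecs_def freq_def)
qed

lemma sum4_over_cells:
  fixes K :: "nat \<Rightarrow> nat \<Rightarrow> nat \<Rightarrow> nat \<Rightarrow> real"
  assumes c: "\<And>i. i < n \<Longrightarrow> c i < N"
  shows "(\<Sum>x<n. \<Sum>y<n. \<Sum>z<n. \<Sum>w<n. cell_kernel N (c x) (c y) (c z) (c w)) =
     real n ^ 4 * quad N (freq n c) (freq n c) (freq n c) (freq n c)"
proof -
  note s = sum_over_cells[of n c N, OF c]
  have "(\<Sum>x<n. \<Sum>y<n. \<Sum>z<n. \<Sum>w<n. cell_kernel N (c x) (c y) (c z) (c w)) =
    n * (\<Sum>a<N. freq n c a * (n * (\<Sum>b'<N. freq n c b' * (n * (\<Sum>c'<N. freq n c c' * (n * (\<Sum>d<N. freq n c d * cell_kernel N a b' c' d)))))))"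
    apply (subst s[where g="\<lambda>a. \<Sum>y<n. \<Sum>z<n. \<Sum>w<n. cell_kernel N a (c y) (c z) (c w)"], assumption)
    apply (subst s[where g="\<lambda>b. \<Sum>z<n. \<Sum>w<n. cell_kernel N _ b (c z) (c w)"], assumption)
    apply (subst s[where g="\<lambda>b. \<Sum>w<n. cell_kernel N _ _ b (c w)"], assumption)
    apply (subst s[where g="\<lambda>b. cell_kernel N _ _ _ b"], assumption)
    by simp
  then show ?thesis
    by (simp add: quad_def sum_distrib_left mult_ac power4_eq_xxxx)
qed

section \<open>The statistic as a function of cell frequencies\<close>

text \<open>Only the increasing order is treated; the other five orders reduce to it by renaming the indices.\<close>

lemma order_stat_three:
  fixes x :: "nat \<Rightarrow> real"
  assumes d: "i \<noteq> j" "i \<noteq> k" "j \<noteq> k" and le: "x i \<le> x j" "x j \<le> x k"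
  shows "order_stat x 2 {i,j,k} = x j" "order_stat x 3 {i,j,k} = x k"
proof -
  have m: "mset (map x (sorted_list_of_set {i,j,k})) = mset [x i, x j, x k]"
    using d by (simp del: sorted_list_of_set_insert_remove)
  have "sort (map x (sorted_list_of_set {i,j,k})) = [x i, x j, x k]"
    by (rule properties_for_sort) (use m le in auto)
  then show "order_stat x 2 {i,j,k} = x j" "order_stat x 3 {i,j,k} = x k"
    by (simp_all add: order_stat_def)
qed

text \<open>For t > 1 the ratio of the two largest elements of a triple is at least t exactly if one element is far ahead of
both others, and then it is unique. So an inequality between order statistics becomes a sum of three indicators.\<close>

definition far_ahead :: "(nat \<Rightarrow> real) \<Rightarrow> real \<Rightarrow> nat \<Rightarrow> nat \<Rightarrow> nat \<Rightarrow> real" where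
  "far_ahead x t i j k = of_bool (max (x j) (x k) * t \<le> x i)"

lemma top_ratio_indicator:
  fixes x :: "nat \<Rightarrow> real"
  assumes d: "i \<noteq> j" "i \<noteq> k" "j \<noteq> k" and p: "0 < x i" "0 < x j" "0 < x k" and t: "1 < t"
  shows "of_bool (order_stat x 3 {i,j,k} / order_stat x 2 {i,j,k} < t) =
    1 - far_ahead x t i j k - far_ahead x t j i k - far_ahead x t k i j"
proof -
  have key: "of_bool (order_stat x 3 {a,b,c} / order_stat x 2 {a,b,c} < t) =
      1 - far_ahead x t a b c - far_ahead x t b a c - far_ahead x t c a b"
    if h: "a \<noteq> b" "a \<noteq> c" "b \<noteq> c" "0 < x a" "0 < x b" "0 < x c" "x a \<le> x b" "x b \<le> x c" for a b c
  proof -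
    have lt: "y < y * t" if "0 < y" for y using that t by simp
    have "\<not> x c * t \<le> x a" using lt[of "x c"] h by linarith
    moreover have "\<not> x c * t \<le> x b" using lt[of "x c"] h by linarith
    moreover have "(x c / x b < t) = (\<not> x b * t \<le> x c)" using h by (simp add: field_simps not_le)
    ultimately show ?thesis using h
      by (simp add: order_stat_three far_ahead_def max_def)
  qed
  have sw: "far_ahead x t a b c = far_ahead x t a c b" for a b c
    by (simp add: far_ahead_def max.commute)
  consider "x i \<le> x j" "x j \<le> x k" | "x i \<le> x k" "x k \<le> x j" | "x j \<le> x i" "x i \<le> x k"
    | "x j \<le> x k" "x k \<le> x i" | "x k \<le> x i" "x i \<le> x j" | "x k \<le> x j" "x j \<le> x i" by linarith
  then show ?thesis
  proof cases
    case 1 then show ?thesis using key[of i j k] d p by simp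
  next
    case 2 then show ?thesis using key[of i k j] d p by (simp add: insert_commute sw)
  next
    case 3
    have e: "{i,j,k} = {j,i,k}" by auto
    show ?thesis unfolding e using 3 key[of j i k] d p by (simp add: sw)
  next
    case 4
    have e: "{i,j,k} = {j,k,i}" by auto
    show ?thesis unfolding e using 4 key[of j k i] d p by (simp add: sw)
  next
    case 5
    have e: "{i,j,k} = {k,i,j}" by auto
    show ?thesis unfolding e using 5 key[of k i j] d p by (simp add: sw)
  next
    case 6
    have e: "{i,j,k} = {k,j,i}" by auto
    show ?thesis unfolding e using 6 key[of k j i] d p by (simp add: sw)
  qed
qed

definition triples :: "nat \<Rightarrow> (nat \<times> nat \<times> nat) set" where
  "triples n = {(i,j,k). i < n \<and> j < n \<and> k < n \<and> i \<noteq> j \<and> i \<noteq> k \<and> j \<noteq> k}"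

lemma triples_subset: "triples n \<subseteq> {..<n} \<times> {..<n} \<times> {..<n}"
  by (auto simp: triples_def)

lemma finite_triples: "finite (triples n)"
  by (rule finite_subset[OF triples_subset]) auto

text \<open>Each three-element set is the set of entries of six ordered triples.\<close>

lemma sum_triples_eq_subsets:
  fixes G :: "nat set \<Rightarrow> real"
  shows "(\<Sum>(i,j,k)\<in>triples n. G {i,j,k}) = 6 * (\<Sum>J | J \<subseteq> {..<n} \<and> card J = 3. G J)"
proof -
  let ?S = "{J. J \<subseteq> {..<n} \<and> card J = 3}"
  have fS: "finite ?S" by simp
  define s :: "nat \<times> nat \<times> nat \<Rightarrow> nat set" where "s = (\<lambda>(i,j,k). {i,j,k})"
  have im: "s ` triples n \<subseteq> ?S" by (auto simp: s_def triples_def)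
  have "(\<Sum>(i,j,k)\<in>triples n. G {i,j,k}) = (\<Sum>t\<in>triples n. G (s t))"
    by (rule sum.cong) (auto simp: s_def)
  also have "\<dots> = (\<Sum>J\<in>?S. \<Sum>t\<in>{t\<in>triples n. s t = J}. G (s t))"
    by (rule sum.group[symmetric, OF finite_triples fS im])
  also have "\<dots> = (\<Sum>J\<in>?S. 6 * G J)"
  proof (rule sum.cong[OF refl])
    fix J assume "J \<in> ?S"
    then obtain a b c where J: "J = {a,b,c}" and d: "a \<noteq> b" "a \<noteq> c" "b \<noteq> c" and lt: "a < n" "b < n" "c < n"
      by (auto simp: card_3_iff)
    have "{t\<in>triples n. s t = J} = {(a,b,c),(a,c,b),(b,a,c),(b,c,a),(c,a,b),(c,b,a)}" (is "?L = ?R")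
    proof
      show "?R \<subseteq> ?L" using d lt by (auto simp: triples_def s_def J)
      show "?L \<subseteq> ?R"
      proof
        fix t assume t: "t \<in> ?L"
        obtain i j k where ijk: "t = (i,j,k)" by (cases t)
        have e: "{i,j,k} = {a,b,c}" and d': "i \<noteq> j" "i \<noteq> k" "j \<noteq> k"
          using t by (auto simp: ijk s_def J triples_def)
        have "i \<in> {a,b,c}" "j \<in> {a,b,c}" "k \<in> {a,b,c}" using e by blast+
        then show "t \<in> ?R" using d' unfolding ijk by auto
      qed
    qed
    then have "card {t\<in>triples n. s t = J} = 6" using d by simp
    then show "(\<Sum>t\<in>{t\<in>triples n. s t = J}. G (s t)) = 6 * G J" by simp
  qed
  finally show ?thesis by (simp add: sum_distrib_left)
qed

lemma six_choose_three: "6 * real (n choose 3) = real n * (real n - 1) * (real n - 2)"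
  by (simp add: binomial_gbinomial gbinomial_prod_rev numeral_3_eq_3 fact_numeral field_simps)

lemma card_triples: "real (card (triples n)) = 6 * real (n choose 3)"
proof -
  have "real (card (triples n)) = (\<Sum>(i,j,k)\<in>triples n. (\<lambda>_. 1) {i,j,k})" by simp
  also have "\<dots> = 6 * (\<Sum>J | J \<subseteq> {..<n} \<and> card J = 3. 1)"
    by (rule sum_triples_eq_subsets)
  also have "\<dots> = 6 * real (n choose 3)" using n_subsets[of "{..<n}" 3] by simp
  finally show ?thesis .
qed

text \<open>By symmetry the three positions of the leading observation contribute equally, which gives the factor 3.\<close>

lemma H_emp_eq:
  assumes p: "\<And>i. i < n \<Longrightarrow> 0 < x i" and t: "1 < t" and n: "3 \<le> n"
  shows "H_emp x n t = 1 - 3 * (\<Sum>(i,j,k)\<in>triples n. far_ahead x t i j k) / (6 * real (n choose 3))"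
proof -
  let ?C = "\<lambda>J. of_bool (order_stat x 3 J / order_stat x 2 J < t) :: real"
  let ?B = "\<Sum>(i,j,k)\<in>triples n. far_ahead x t i j k"
  have "6 * (\<Sum>J | J \<subseteq> {..<n} \<and> card J = 3. ?C J) = (\<Sum>(i,j,k)\<in>triples n. ?C {i,j,k})"
    by (rule sum_triples_eq_subsets[symmetric])
  also have "\<dots> = (\<Sum>(i,j,k)\<in>triples n. 1 - far_ahead x t i j k - far_ahead x t j i k - far_ahead x t k i j)"
  proof (rule sum.cong[OF refl])
    fix z assume z: "z \<in> triples n"
    show "(case z of (i,j,k) \<Rightarrow> ?C {i,j,k}) =
      (case z of (i,j,k) \<Rightarrow> 1 - far_ahead x t i j k - far_ahead x t j i k - far_ahead x t k i j)"
    proof (cases z)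
      case (fields i j k)
      show ?thesis unfolding fields prod.case
        by (rule top_ratio_indicator) (use z fields p t in \<open>auto simp: triples_def\<close>)
    qed
  qed
  also have "\<dots> = real (card (triples n)) - ?B - (\<Sum>(i,j,k)\<in>triples n. far_ahead x t j i k)
       - (\<Sum>(i,j,k)\<in>triples n. far_ahead x t k i j)"
    by (simp add: case_prod_beta sum_subtractf)
  also have "(\<Sum>(i,j,k)\<in>triples n. far_ahead x t j i k) = ?B"
    by (rule sum.reindex_bij_witness[where i="\<lambda>(i,j,k). (j,i,k)" and j="\<lambda>(i,j,k). (j,i,k)"])
      (auto simp: triples_def)
  also have "(\<Sum>(i,j,k)\<in>triples n. far_ahead x t k i j) = ?B"
    by (rule sum.reindex_bij_witness[where i="\<lambda>(k,i,j). (i,j,k)" and j="\<lambda>(i,j,k). (k,i,j)"])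
      (auto simp: triples_def)
  finally have "6 * (\<Sum>J | J \<subseteq> {..<n} \<and> card J = 3. ?C J) = 6 * real (n choose 3) - 3 * ?B"
    by (simp add: card_triples)
  moreover have "0 < n choose 3" using n by simp
  ultimately show ?thesis unfolding H_emp_def by (simp add: field_simps)
qed

text \<open>At most 3 n^2 of the n^3 triples have coinciding entries, so admitting them changes the average by O(1/n).\<close>

lemma sum_far_ahead_triples:
  fixes x :: "nat \<Rightarrow> real"
  assumes n: "3 \<le> n"
  defines "B \<equiv> \<lambda>t. \<Sum>(i,j,k)\<in>triples n. far_ahead x t i j k"
    and "A \<equiv> \<lambda>t. \<Sum>i<n. \<Sum>j<n. \<Sum>k<n. far_ahead x t i j k"
  shows "0 \<le> B t" "B t \<le> real n * (real n - 1) * (real n - 2)" "B t \<le> A t" "A t \<le> B t + 3 * real n ^ 2"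
proof -
  let ?U = "{..<n} \<times> {..<n} \<times> {..<n}"
  have f01: "0 \<le> far_ahead x t i j k" "far_ahead x t i j k \<le> 1" for i j k by (auto simp: far_ahead_def)
  show "0 \<le> B t" unfolding B_def by (rule sum_nonneg) (auto simp: f01 far_ahead_def)
  have "B t \<le> (\<Sum>z\<in>triples n. 1)" unfolding B_def by (rule sum_mono) (auto simp: f01 far_ahead_def)
  then show "B t \<le> real n * (real n - 1) * (real n - 2)"
    by (simp add: card_triples six_choose_three)
  have A: "A t = (\<Sum>(i,j,k)\<in>?U. far_ahead x t i j k)"
    unfolding A_def by (simp add: sum.cartesian_product)
  show "B t \<le> A t" unfolding A B_def
    by (rule sum_mono2[OF _ triples_subset]) (auto simp: far_ahead_def)
  have "A t = B t + (\<Sum>(i,j,k)\<in>?U - triples n. far_ahead x t i j k)"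
    unfolding A B_def by (subst sum.subset_diff[OF triples_subset]) auto
  also have "(\<Sum>(i,j,k)\<in>?U - triples n. far_ahead x t i j k) \<le> (\<Sum>z\<in>?U - triples n. 1)"
    by (rule sum_mono) (auto simp: far_ahead_def)
  also have "\<dots> = real (card (?U - triples n))" by simp
  also have "real (card (?U - triples n)) = real n ^ 3 - real n * (real n - 1) * (real n - 2)"
  proof -
    have "card (?U - triples n) = card ?U - card (triples n)"
      by (rule card_Diff_subset[OF finite_triples triples_subset])
    moreover have "card (triples n) \<le> card ?U" by (rule card_mono[OF _ triples_subset]) auto
    ultimately have "real (card (?U - triples n)) = real (card ?U) - real (card (triples n))" by simp
    then show ?thesis by (simp add: card_triples six_choose_three card_cartesian_product power3_eq_cube)
  qed
  also have "\<dots> = 3 * real n ^ 2 - 2 * real n" by (simp add: power2_eq_square power3_eq_cube algebra_simps)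
  finally show "A t \<le> B t + 3 * real n ^ 2" by simp
qed

text \<open>Discretisation error: if the cells do not decide whether U_i \<le> min U_j U_k * U_w, then, given the other three cells, the
cell of i is one of three consecutive ones. For t and d the cells of the minimum and of w, the product lies between
t d / N^2 and (t + 1) (d + 1) / N^2, and these differ by less than 2 / N.\<close>

lemma far_ahead_cells:
  assumes N: "0 < N" and l: "0 < (l::real)"
    and x: "\<And>i. i < n \<Longrightarrow> 1 < x i"
    and c: "\<And>i. i < n \<Longrightarrow> real (c i) / N \<le> x i powr (- l)" "\<And>i. i < n \<Longrightarrow> x i powr (- l) < real (c i + 1) / N"
      "\<And>i. i < n \<Longrightarrow> c i < N"
    and ijkw: "i < n" "j < n" "k < n" "w < n"
    and ne: "far_ahead x (x w) i j k \<noteq> cell_kernel N (c i) (c j) (c k) (c w)"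
  shows "c i \<in> {min (c j) (c k) * c w div N ..< min (c j) (c k) * c w div N + 3}"
proof -
  define u where "u i = x i powr (- l)" for i
  define t where "t = min (c j) (c k)"
  define d where "d = c w"
  define a where "a = c i"
  have upos: "0 < u v" if "v < n" for v using x[OF that] by (simp add: u_def)
  have le_iff: "(y \<le> z) = (z powr (-l) \<le> y powr (-l))" if "0 < y" "0 < z" for y z :: real
    using that l powr_mono2'[of "-l" y z] powr_less_mono2_neg[of "-l" z y] by (cases "y \<le> z") auto
  have mx: "max (x j) (x k) powr (-l) = min (u j) (u k)"
    using x[of j] x[of k] ijkw le_iff[of "x j" "x k"] unfolding u_def max_def min_def by auto
  have fa: "far_ahead x (x w) i j k = of_bool (u i \<le> min (u j) (u k) * u w)"
  proof -
    have "(max (x j) (x k) * x w \<le> x i) = (x i powr (-l) \<le> (max (x j) (x k) * x w) powr (-l))"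
      by (rule le_iff) (use x[of i] x[of j] x[of k] x[of w] ijkw in \<open>auto simp: less_max_iff_disj\<close>)
    also have "(max (x j) (x k) * x w) powr (-l) = min (u j) (u k) * u w"
      unfolding u_def mx[symmetric, unfolded u_def]
      by (rule powr_mult)
    finally show ?thesis by (simp add: far_ahead_def u_def)
  qed
  have lo: "real t / N \<le> min (u j) (u k)" "real d / N \<le> u w" "real a / N \<le> u i"
  proof -
    have "real t / N \<le> real (c j) / N" "real t / N \<le> real (c k) / N"
      by (auto simp: t_def intro!: divide_right_mono)
    then show "real t / N \<le> min (u j) (u k)" using c(1)[of j] c(1)[of k] ijkw by (simp add: u_def)
  qed (use c(1) ijkw in \<open>auto simp: d_def a_def u_def\<close>)
  have hi: "min (u j) (u k) < real (t + 1) / N" "u w < real (d + 1) / N" "u i < real (a + 1) / N"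
    using c(2)[of j] c(2)[of k] c(2)[of w] c(2)[of i] ijkw unfolding t_def d_def a_def u_def min_def
    by (auto split: if_splits)
  have tN: "t < N" "d < N" using c(3) ijkw by (auto simp: t_def d_def min_def)
  \<comment> \<open>the first of the three undecided cells\<close>
  define r where "r = t * d div N"
  have r: "r * N \<le> t * d" "t * d < (r + 1) * N"
    unfolding r_def using N by (auto simp: div_times_less_eq_dividend dividend_less_div_times)
      (metis add.commute dividend_less_div_times mult.commute mult_Suc_right plus_1_eq_Suc)?
  show ?thesis
  proof (rule ccontr)
    assume "\<not> ?thesis"
    then consider "a < r" | "r + 3 \<le> a" unfolding a_def r_def t_def d_def by force
    then show False
    proof cases
      case 1
      have "(a + 1) * N \<le> r * N" using 1 by (intro mult_right_mono) auto
      then have h: "(a + 1) * N \<le> t * d" using r by linarith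
      then have "a * N < t * d" using N by simp
      then have k: "cell_kernel N (c i) (c j) (c k) (c w) = 1"
        by (simp add: cell_kernel_def a_def t_def d_def)
      have "real ((a + 1) * N) \<le> real (t * d)" using h of_nat_mono by blast
      then have "real ((a + 1) * N) / (real N * real N) \<le> real (t * d) / (real N * real N)"
        by (rule divide_right_mono) simp
      then have "real (a + 1) / N \<le> (real t / N) * (real d / N)" unfolding of_nat_mult using N by simp
      also have "\<dots> \<le> min (u j) (u k) * u w" by (intro mult_mono lo) (use upos ijkw in \<open>auto simp: less_imp_le\<close>)
      finally have "far_ahead x (x w) i j k = 1" unfolding fa using hi(3) by simp
      then show False using ne k by simp
    next
      case 2
      have "(t + 1) * (d + 1) = t * d + t + d + 1" by simp
      also have "\<dots> \<le> (r + 1) * N + 2 * N" using r tN by linarith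
      also have "\<dots> = (r + 3) * N" by (simp add: algebra_simps)
      also have "\<dots> \<le> a * N" using 2 by (intro mult_right_mono) auto
      finally have h: "(t + 1) * (d + 1) \<le> a * N" .
      then have "t * d \<le> a * N" by (simp add: algebra_simps)
      then have k: "cell_kernel N (c i) (c j) (c k) (c w) = 0"
        by (simp add: cell_kernel_def a_def t_def d_def)
      have "real ((t + 1) * (d + 1)) \<le> real (a * N)" using h of_nat_mono by blast
      then have "real ((t + 1) * (d + 1)) / (real N * real N) \<le> real (a * N) / (real N * real N)"
        by (rule divide_right_mono) simp
      then have "(real (t + 1) / N) * (real (d + 1) / N) \<le> real a / N" unfolding of_nat_mult using N by simp
      moreover have "min (u j) (u k) * u w < (real (t + 1) / N) * (real (d + 1) / N)"
        by (intro mult_strict_mono hi) (use upos ijkw N in \<open>auto simp: less_imp_le\<close>)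
      ultimately have "far_ahead x (x w) i j k = 0" unfolding fa using lo(3) by simp
      then show False using ne k by simp
    qed
  qed
qed

lemma card_cell:
  assumes "\<And>j. j < N \<Longrightarrow> freq n c j \<le> m" "\<And>i. i < n \<Longrightarrow> c i < N" "0 \<le> m" "0 < n"
  shows "real (card {i. i < n \<and> c i = j}) \<le> n * m"
proof (cases "j < N")
  case True
  then show ?thesis using assms(1)[of j] assms(4) by (simp add: freq_def field_simps)
next
  case False
  then have e: "{i. i < n \<and> c i = j} = {}" using assms(2) by auto
  show ?thesis unfolding e using assms(3) by simp
qed

lemma sum_abs_far_ahead_minus_cell_kernel:
  assumes N: "0 < N" and l: "0 < (l::real)" and n: "0 < n" and m: "0 \<le> m"
    and x: "\<And>i. i < n \<Longrightarrow> 1 < x i"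
    and c: "\<And>i. i < n \<Longrightarrow> real (c i) / N \<le> x i powr (- l)" "\<And>i. i < n \<Longrightarrow> x i powr (- l) < real (c i + 1) / N"
      "\<And>i. i < n \<Longrightarrow> c i < N"
    and q: "\<And>j. j < N \<Longrightarrow> freq n c j \<le> m"
    and jkw: "j < n" "k < n" "w < n"
  shows "(\<Sum>i<n. \<bar>far_ahead x (x w) i j k - cell_kernel N (c i) (c j) (c k) (c w)\<bar>) \<le> 3 * real n * m"
proof -
  define r where "r = min (c j) (c k) * c w div N"
  let ?A = "\<lambda>v. {i. i < n \<and> c i = v}"
  let ?S = "?A r \<union> ?A (r+1) \<union> ?A (r+2)"
  have "(\<Sum>i<n. \<bar>far_ahead x (x w) i j k - cell_kernel N (c i) (c j) (c k) (c w)\<bar>) \<le> (\<Sum>i<n. of_bool (i \<in> ?S))"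
  proof (rule sum_mono)
    fix i assume "i \<in> {..<n}"
    then have i: "i < n" by simp
    show "\<bar>far_ahead x (x w) i j k - cell_kernel N (c i) (c j) (c k) (c w)\<bar> \<le> of_bool (i \<in> ?S)"
    proof (cases "far_ahead x (x w) i j k = cell_kernel N (c i) (c j) (c k) (c w)")
      case False
      have "c i \<in> {r ..< r + 3}"
        unfolding r_def by (rule far_ahead_cells[OF N l x c i jkw False])
      then have "i \<in> ?S" using i by auto
      then show ?thesis by (auto simp: far_ahead_def cell_kernel_def)
    qed auto
  qed
  also have "\<dots> = real (card ({..<n} \<inter> ?S))" unfolding of_bool_def by (subst sum.If_cases) (auto intro!: arg_cong[where f = card])
  also have "\<dots> \<le> real (card (?A r) + card (?A (r+1)) + card (?A (r+2)))"
  proof -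
    have "card ({..<n} \<inter> ?S) \<le> card ?S" by (intro card_mono) auto
    also have "\<dots> \<le> card (?A r) + card (?A (r+1)) + card (?A (r+2))"
      by (rule order_trans[OF card_Un_le]) (simp add: card_Un_le)
    finally show ?thesis by simp
  qed
  also have "\<dots> \<le> 3 * real n * m"
    using card_cell[OF q c(3) m n, of r] card_cell[OF q c(3) m n, of "r+1"] card_cell[OF q c(3) m n, of "r+2"]
    by simp
  finally show ?thesis .
qed

text \<open>The pairs with X_j < X_i and those with X_j > X_i are equally many, so the average is 1/2 minus half the proportion
of tied pairs. That proportion is positive, as each observation is tied with itself, and ties lie in the same cell.\<close>

lemma F_emp_average:
  assumes n: "0 < n" and m: "0 \<le> m" and c: "\<And>i. i < n \<Longrightarrow> c i < N"
    and cong: "\<And>i j. i < n \<Longrightarrow> j < n \<Longrightarrow> x i = x j \<Longrightarrow> c i = c j"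
    and q: "\<And>j. j < N \<Longrightarrow> freq n c j \<le> m"
  shows "\<bar>(\<Sum>i<n. F_emp x n (x i)) / n - 1 / 2\<bar> \<le> m / 2"
    and "(\<Sum>i<n. F_emp x n (x i)) / n < 1 / 2"
proof -
  let ?L = "\<Sum>i<n. \<Sum>j<n. of_bool (x j < x i) :: real"
  let ?G = "\<Sum>i<n. \<Sum>j<n. of_bool (x i < x j) :: real"
  let ?E = "\<Sum>i<n. \<Sum>j<n. of_bool (x i = x j) :: real"
  have "?L = ?G" by (rule sum.swap)
  moreover have "?L + ?G + ?E = (\<Sum>i<n. \<Sum>j<n. of_bool (x j < x i) + of_bool (x i < x j) + of_bool (x i = x j))"
    by (simp add: sum.distrib)
  moreover have "\<dots> = (\<Sum>i<n. \<Sum>j<n. (1::real))"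
    by (intro sum.cong refl) (auto simp: of_bool_def)
  ultimately have LE: "2 * ?L + ?E = real n ^ 2" by (simp add: power2_eq_square)
  have "?E \<le> (\<Sum>i<n. real n * m)"
  proof (rule sum_mono)
    fix i assume "i \<in> {..<n}"
    then have i: "i < n" by simp
    have "(\<Sum>j<n. of_bool (x i = x j)) \<le> (\<Sum>j<n. of_bool (c j = c i) :: real)"
      by (rule sum_mono) (use cong[OF i] in \<open>auto simp: of_bool_def\<close>)
    also have "\<dots> = real (card {j. j < n \<and> c j = c i})"
      by (simp add: of_bool_def sum.If_cases Int_def)
    also have "\<dots> \<le> n * m" by (rule card_cell[OF q c m n])
    finally show "(\<Sum>j<n. of_bool (x i = x j)) \<le> n * m" .
  qed
  then have E1: "?E \<le> real n ^ 2 * m" by (simp add: power2_eq_square)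
  have "(\<Sum>i<n. 1) \<le> ?E"
  proof (rule sum_mono)
    fix i assume "i \<in> {..<n}"
    then show "1 \<le> (\<Sum>j<n. of_bool (x i = x j) :: real)"
      using member_le_sum[of i "{..<n}" "\<lambda>j. of_bool (x i = x j) :: real"] by simp
  qed
  then have E0: "real n \<le> ?E" by simp
  have S: "(\<Sum>i<n. F_emp x n (x i)) / n = ?L / real n ^ 2"
    by (simp add: F_emp_def sum_divide_distrib[symmetric] power2_eq_square)
  have L: "?L = (real n ^ 2 - ?E) / 2" using LE by simp
  have n2: "0 < real n ^ 2" using n by simp
  have "?L / real n ^ 2 - 1 / 2 = - (?E / (2 * real n ^ 2))"
    unfolding L using n2 by (simp add: field_simps)
  moreover have "0 \<le> ?E" using E0 by linarith
  moreover have "?E / (2 * real n ^ 2) \<le> m / 2" using E1 n2 by (simp add: field_simps)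
  ultimately show "\<bar>(\<Sum>i<n. F_emp x n (x i)) / n - 1 / 2\<bar> \<le> m / 2" unfolding S by simp
  show "(\<Sum>i<n. F_emp x n (x i)) / n < 1 / 2" unfolding S L using E0 n n2 by (simp add: field_simps)
qed

text \<open>The statistic is determined by the cell frequencies up to a multiple of the largest frequency m. The three
sources of error are the normalisation by n (n-1) (n-2), the triples with coinciding entries, and the quadruples that
the cells do not decide; the first two are O(1/n), and 1/n \<le> m since some cell is occupied.\<close>

lemma I_stat_approx:
  assumes N: "0 < N" and l: "0 < (l::real)" and n: "3 \<le> n"
    and x: "\<And>i. i < n \<Longrightarrow> 1 < x i"
    and c: "\<And>i. i < n \<Longrightarrow> real (c i) / N \<le> x i powr (- l)" "\<And>i. i < n \<Longrightarrow> x i powr (- l) < real (c i + 1) / N"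
      "\<And>i. i < n \<Longrightarrow> c i < N"
    and q: "\<And>j. j < N \<Longrightarrow> freq n c j \<le> m"
  shows "\<bar>I_stat x n - (1 / 2 - bad_mass N (freq n c))\<bar> \<le> 30 * m"
proof -
  have n0: "0 < n" using n by simp
  \<comment> \<open>some cell is occupied, so the largest frequency is at least 1/n\<close>
  have m1: "1 / n \<le> m"
  proof -
    have "card {i. i < n \<and> c i = c 0} \<noteq> 0" using n0 by auto
    then have "1 \<le> real (card {i. i < n \<and> c i = c 0})" by linarith
    then have "1 / n \<le> freq n c (c 0)" unfolding freq_def by (rule divide_right_mono) simp
    then show ?thesis using q[OF c(3)[OF n0]] by simp
  qed
  then have m0: "0 \<le> m" by (smt (verit) divide_nonneg_nonneg of_nat_0_le_iff)
  define SA where "SA = (\<Sum>w<n. \<Sum>i<n. \<Sum>j<n. \<Sum>k<n. far_ahead x (x w) i j k)"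
  define SB where "SB = (\<Sum>w<n. \<Sum>(i,j,k)\<in>triples n. far_ahead x (x w) i j k)"
  define Q where "Q = quad N (freq n c) (freq n c) (freq n c) (freq n c)"
  have SK: "(\<Sum>w<n. \<Sum>i<n. \<Sum>j<n. \<Sum>k<n. cell_kernel N (c i) (c j) (c k) (c w)) = real n ^ 4 * Q"
  proof -
    have "(\<Sum>w<n. \<Sum>i<n. \<Sum>j<n. \<Sum>k<n. cell_kernel N (c i) (c j) (c k) (c w))
        = (\<Sum>i<n. \<Sum>w<n. \<Sum>j<n. \<Sum>k<n. cell_kernel N (c i) (c j) (c k) (c w))" by (rule sum.swap)
    also have "\<dots> = (\<Sum>i<n. \<Sum>j<n. \<Sum>w<n. \<Sum>k<n. cell_kernel N (c i) (c j) (c k) (c w))"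
      by (rule sum.cong[OF refl]) (rule sum.swap)
    also have "\<dots> = (\<Sum>i<n. \<Sum>j<n. \<Sum>k<n. \<Sum>w<n. cell_kernel N (c i) (c j) (c k) (c w))"
      by (rule sum.cong[OF refl], rule sum.cong[OF refl], rule sum.swap)
    also have "\<dots> = real n ^ 4 * Q" unfolding Q_def by (rule sum4_over_cells[OF c(3)])
    finally show ?thesis .
  qed
  have AK: "\<bar>SA - real n ^ 4 * Q\<bar> \<le> 3 * real n ^ 4 * m"
  proof -
    have "\<bar>SA - real n ^ 4 * Q\<bar> = \<bar>\<Sum>w<n. \<Sum>i<n. \<Sum>j<n. \<Sum>k<n. far_ahead x (x w) i j k - cell_kernel N (c i) (c j) (c k) (c w)\<bar>"
      unfolding SK[symmetric] SA_def by (simp add: sum_subtractf)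
    also have "\<dots> \<le> (\<Sum>w<n. \<Sum>i<n. \<Sum>j<n. \<Sum>k<n. \<bar>far_ahead x (x w) i j k - cell_kernel N (c i) (c j) (c k) (c w)\<bar>)"
      by (intro order_trans[OF sum_abs] sum_mono order_refl)
    also have "\<dots> = (\<Sum>w<n. \<Sum>j<n. \<Sum>k<n. \<Sum>i<n. \<bar>far_ahead x (x w) i j k - cell_kernel N (c i) (c j) (c k) (c w)\<bar>)"
      by (rule sum.cong[OF refl], subst sum.swap, rule sum.cong[OF refl], rule sum.swap)
    also have "\<dots> \<le> (\<Sum>w<n. \<Sum>j<n. \<Sum>k<n. 3 * real n * m)"
      by (intro sum_mono) (rule sum_abs_far_ahead_minus_cell_kernel[OF N l n0 m0 x c q], auto)
    also have "\<dots> = 3 * real n ^ 4 * m" by (simp add: power4_eq_xxxx)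
    finally show ?thesis .
  qed
  note B = sum_far_ahead_triples[OF n, of x]
  have SB0: "0 \<le> SB" unfolding SB_def by (intro sum_nonneg B(1))
  have SB1: "SB \<le> real n ^ 2 * (real n - 1) * (real n - 2)"
  proof -
    have "SB \<le> (\<Sum>w<n. real n * (real n - 1) * (real n - 2))" unfolding SB_def by (intro sum_mono B(2))
    then show ?thesis by (simp add: power2_eq_square mult_ac)
  qed
  have BA: "SB \<le> SA" unfolding SB_def SA_def by (intro sum_mono B(3))
  have AB: "SA \<le> SB + 3 * real n ^ 3"
  proof -
    have "SA \<le> (\<Sum>w<n. (\<Sum>(i,j,k)\<in>triples n. far_ahead x (x w) i j k) + 3 * real n ^ 2)"
      unfolding SA_def by (intro sum_mono B(4))
    then show ?thesis by (simp add: SB_def sum.distrib power2_eq_square power3_eq_cube)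
  qed
  have pos: "0 < real n" "0 < real n - 1" "0 < real n - 2" using n by auto
  define D where "D = real n ^ 2 * (real n - 1) * (real n - 2)"
  have D: "0 < D" unfolding D_def using pos by simp
  have H: "(\<Sum>i<n. H_emp x n (x i)) / n = 1 - 3 * (SB / D)"
  proof -
    have "(\<Sum>i<n. H_emp x n (x i)) = (\<Sum>w<n. 1 - 3 * (\<Sum>(i,j,k)\<in>triples n. far_ahead x (x w) i j k) / (real n * (real n - 1) * (real n - 2)))"
    proof (rule sum.cong[OF refl])
      fix w assume "w \<in> {..<n}"
      then have "1 < x w" using x by simp
      moreover have "\<And>i. i < n \<Longrightarrow> 0 < x i" using x by (meson less_trans zero_less_one)
      ultimately show "H_emp x n (x w) = 1 - 3 * (\<Sum>(i,j,k)\<in>triples n. far_ahead x (x w) i j k) / (real n * (real n - 1) * (real n - 2))"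
        using H_emp_eq[of n x "x w"] n six_choose_three[of n] by simp
    qed
    also have "\<dots> = n - 3 * SB / (real n * (real n - 1) * (real n - 2))"
      by (simp add: sum_subtractf SB_def sum_divide_distrib sum_distrib_left)
    finally have "(\<Sum>i<n. H_emp x n (x i)) / n = (n - 3 * SB / (real n * (real n - 1) * (real n - 2))) / n" by simp
    also have "\<dots> = 1 - 3 * SB / (real n * (real n - 1) * (real n - 2)) / n"
      using pos by (simp add: diff_divide_distrib)
    also have "\<dots> = 1 - 3 * (SB / D)" unfolding D_def by (simp add: power2_eq_square mult_ac)
    finally show ?thesis .
  qed
  \<comment> \<open>error of normalising by n^2 (n-1) (n-2) instead of n^4\<close>
  have e1: "\<bar>SB / D - SB / real n ^ 4\<bar> \<le> 3 * m"
  proof -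
    have "D \<le> real n ^ 4"
    proof -
      have "D \<le> real n ^ 2 * real n * real n" unfolding D_def using pos by (intro mult_mono) auto
      then show ?thesis by (simp add: power2_eq_square power4_eq_xxxx)
    qed
    then have "0 \<le> SB / D - SB / real n ^ 4" unfolding diff_ge_0_iff_ge using SB0 D pos by (intro divide_left_mono mult_pos_pos zero_less_power)
    moreover have "SB / D - SB / real n ^ 4 \<le> 3 * m"
    proof -
    have "SB / D - SB / real n ^ 4 = (SB / D) * (1 - D / real n ^ 4)"
      using D pos by (simp add: field_simps)
    also have "(SB / D) * (1 - D / real n ^ 4) \<le> 1 * (1 - D / real n ^ 4)"
    proof (rule mult_right_mono)
      show "SB / D \<le> 1" using SB1 D unfolding D_def[symmetric] by simp
      show "0 \<le> 1 - D / real n ^ 4" using \<open>D \<le> real n ^ 4\<close> pos by simp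
    qed
    also have "1 * (1 - D / real n ^ 4) = 3 / n - 2 / (real n)\<^sup>2"
      using pos unfolding D_def by (simp add: field_simps power2_eq_square power4_eq_xxxx)
    also have "\<dots> \<le> 3 * (1 / n)" by simp
    also have "\<dots> \<le> 3 * m" using m1 by simp
    finally show ?thesis .
    qed
    ultimately show ?thesis by (simp only: abs_of_nonneg)
  qed
  \<comment> \<open>error of admitting triples with coinciding entries\<close>
  have e2: "\<bar>SB / real n ^ 4 - SA / real n ^ 4\<bar> \<le> 3 * m"
  proof -
    have "\<bar>SB / real n ^ 4 - SA / real n ^ 4\<bar> = (SA - SB) / real n ^ 4"
    proof -
      have "SB / real n ^ 4 - SA / real n ^ 4 = - ((SA - SB) / real n ^ 4)"
        by (simp add: diff_divide_distrib)
      moreover have "0 \<le> (SA - SB) / real n ^ 4" using BA by simp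
      ultimately show ?thesis by linarith
    qed
    also have "\<dots> \<le> 3 * real n ^ 3 / real n ^ 4" using AB by (intro divide_right_mono) auto
    also have "\<dots> = 3 * (1 / n)" using pos by (simp add: power3_eq_cube power4_eq_xxxx)
    also have "\<dots> \<le> 3 * m" using m1 by simp
    finally show ?thesis .
  qed
  \<comment> \<open>error from the quadruples that the cells do not decide\<close>
  have e3: "\<bar>SA / real n ^ 4 - Q\<bar> \<le> 3 * m"
  proof -
    have "SA / real n ^ 4 - Q = (SA - real n ^ 4 * Q) / real n ^ 4" using pos by (simp add: field_simps)
    then have "\<bar>SA / real n ^ 4 - Q\<bar> = \<bar>SA - real n ^ 4 * Q\<bar> / real n ^ 4" by (simp add: abs_divide)
    also have "\<dots> \<le> 3 * real n ^ 4 * m / real n ^ 4" using AK by (intro divide_right_mono) auto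
    finally show ?thesis using pos by simp
  qed
  have cong: "c i = c j" if "i < n" "j < n" "x i = x j" for i j
  proof -
    have "real (c i) / N < real (c j + 1) / N" "real (c j) / N < real (c i + 1) / N"
      using c(1)[of i] c(1)[of j] c(2)[of i] c(2)[of j] that by auto
    then show ?thesis using N by (simp add: divide_less_cancel)
  qed
  have F: "\<bar>(\<Sum>i<n. F_emp x n (x i)) / n - 1 / 2\<bar> \<le> m / 2"
    by (rule F_emp_average(1)[OF n0 m0 c(3) cong q])
  have "I_stat x n = (\<Sum>i<n. H_emp x n (x i)) / n - (\<Sum>i<n. F_emp x n (x i)) / n"
    by (simp add: I_stat_def sum_subtractf diff_divide_distrib)
  then have eq: "I_stat x n - (1 / 2 - bad_mass N (freq n c)) =
     - 3 * (SB / D - SB / real n ^ 4) - 3 * (SB / real n ^ 4 - SA / real n ^ 4) - 3 * (SA / real n ^ 4 - Q)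
     - ((\<Sum>i<n. F_emp x n (x i)) / n - 1 / 2)"
    unfolding H by (simp add: bad_mass_def Q_def)
  have "\<bar>- 3 * u - 3 * v - 3 * w - z\<bar> \<le> 30 * m"
    if "\<bar>u\<bar> \<le> 3 * m" "\<bar>v\<bar> \<le> 3 * m" "\<bar>w\<bar> \<le> 3 * m" "\<bar>z\<bar> \<le> m / 2" for u v w z :: real
    using that m0 by (auto simp: abs_le_iff)
  then show ?thesis unfolding eq using e1 e2 e3 F by blast
qed

section \<open>Counting words by their cell frequencies\<close>

text \<open>A word lists the cells of the n observations.\<close>

abbreviation words :: "nat \<Rightarrow> nat \<Rightarrow> (nat \<Rightarrow> nat) set" where
  "words N n \<equiv> {..<n} \<rightarrow>\<^sub>E {..<N}"

lemma finite_words: "finite (words N n)"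
  by (intro finite_PiE) auto

lemma sum_words_prod: "(\<Sum>w\<in>words N n. \<Prod>i<n. f (w i)) = (\<Sum>v<N. f v :: real) ^ n"
  using prod_sum_PiE[of "{..<n}" "\<lambda>_. {..<N}" "\<lambda>_. f"] by simp

lemma words_lt: "w \<in> words N n \<Longrightarrow> i < n \<Longrightarrow> w i < N"
  by auto

lemma freq_pos:
  assumes "i < n"
  shows "0 < freq n w (w i)"
proof -
  have "card {k. k < n \<and> w k = w i} \<noteq> 0" using assms by auto
  then show ?thesis using assms unfolding freq_def by (intro divide_pos_pos) (auto simp: card_gt_0_iff)
qed

lemma prod_over_word:
  assumes w: "w \<in> words N n" and N: "0 < N" and q: "\<And>i. i < n \<Longrightarrow> 0 < q (w i)"
  shows "(1 / real N) ^ n = exp (- (real n * (\<Sum>j<N. freq n w j * ln (N * q j)))) * (\<Prod>i<n. q (w i))"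
proof -
  have "real n * (\<Sum>j<N. freq n w j * ln (N * q j)) = (\<Sum>i<n. ln (N * q (w i)))"
    by (rule sum_over_cells[symmetric]) (use words_lt[OF w] in auto)
  also have "exp (- \<dots>) = (\<Prod>i<n. 1 / (N * q (w i)))"
    unfolding sum_negf[symmetric] exp_sum[OF finite_lessThan]
    by (rule prod.cong) (use q N in \<open>auto simp: exp_minus inverse_eq_divide\<close>)
  finally have "exp (- (real n * (\<Sum>j<N. freq n w j * ln (N * q j)))) * (\<Prod>i<n. q (w i))
     = (\<Prod>i<n. 1 / (N * q (w i)) * q (w i))" by (simp only: prod.distrib)
  also have "\<dots> = (\<Prod>i<n. 1 / real N)" by (rule prod.cong[OF refl]) (use q in \<open>force simp: less_imp_neq[symmetric]\<close>)
  finally show ?thesis by simp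
qed

lemma card_types: "finite (freq n ` words N n)" "card (freq n ` words N n) \<le> (n + 1) ^ N"
proof -
  let ?F = "\<lambda>k j. if j < N then real (k j) / n else 0 :: real"
  have sub: "freq n ` words N n \<subseteq> ?F ` ({..<N} \<rightarrow>\<^sub>E {..n})"
  proof
    fix f assume "f \<in> freq n ` words N n"
    then obtain w where w: "w \<in> words N n" "f = freq n w" by auto
    let ?k = "\<lambda>j\<in>{..<N}. card {i. i < n \<and> w i = j}"
    have "f = ?F ?k"
    proof
      fix j
      show "f j = ?F ?k j"
      proof (cases "j < N")
        case False
        then have e: "{i. i < n \<and> w i = j} = {}" using words_lt[OF w(1)] by auto
        show ?thesis unfolding w(2) freq_def e using False by simp
      qed (simp add: w(2) freq_def)
    qed
    moreover have "?k \<in> {..<N} \<rightarrow>\<^sub>E {..n}"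
    proof (rule PiE_I)
      fix j assume "j \<in> {..<N}"
      have "card {i. i < n \<and> w i = j} \<le> card {..<n}" by (rule card_mono) auto
      then show "?k j \<in> {..n}" using \<open>j \<in> {..<N}\<close> by simp
    qed auto
    ultimately show "f \<in> ?F ` ({..<N} \<rightarrow>\<^sub>E {..n})" by blast
  qed
  show "finite (freq n ` words N n)" using finite_words by blast
  have fin: "finite ({..<N} \<rightarrow>\<^sub>E {..n})" by (intro finite_PiE) auto
  have "card (freq n ` words N n) \<le> card (?F ` ({..<N} \<rightarrow>\<^sub>E {..n}))"
    by (rule card_mono[OF _ sub]) (use fin in auto)
  also have "\<dots> \<le> card ({..<N} \<rightarrow>\<^sub>E {..n})" by (rule card_image_le[OF fin])
  also have "\<dots> = (n + 1) ^ N" by (simp add: card_PiE)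
  finally show "card (freq n ` words N n) \<le> (n + 1) ^ N" .
qed

text \<open>The upper bound of Sanov's theorem. Under its own frequencies \<tau> a word has weight exp (n * KL \<tau>) times its uniform
weight, and for each of the at most (n + 1)^N vectors \<tau> the weights of all words under \<tau> add up to 1.\<close>

lemma fraction_of_words_le_exp_KL:
  assumes S: "S \<subseteq> words N n" and n: "0 < n" and N: "0 < N"
    and K: "\<And>w. w \<in> S \<Longrightarrow> \<kappa> \<le> KL N (freq n w)"
  shows "real (card S) / real N ^ n \<le> (real n + 1) ^ N * exp (- (n * \<kappa>))"
proof -
  have fS: "finite S" using S finite_words finite_subset by blast
  let ?T = "freq n ` words N n"
  have Tnn: "0 \<le> (\<Prod>i<n. \<tau> (w i))" if T: "\<tau> \<in> ?T" for \<tau> w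
  proof -
    from T obtain v where "\<tau> = freq n v" by blast
    then show ?thesis by (intro prod_nonneg) (simp add: freq_def)
  qed
  have "real (card S) / real N ^ n = (\<Sum>w\<in>S. (1 / real N) ^ n)" by (simp add: power_divide)
  also have "\<dots> \<le> (\<Sum>w\<in>S. exp (- (n * \<kappa>)) * (\<Sum>\<tau>\<in>?T. \<Prod>i<n. \<tau> (w i)))"
  proof (rule sum_mono)
    fix w assume w: "w \<in> S"
    then have wW: "w \<in> words N n" using S by auto
    have "(1 / real N) ^ n = exp (- (real n * KL N (freq n w))) * (\<Prod>i<n. freq n w (w i))"
      unfolding KL_def by (rule prod_over_word[OF wW N, of "freq n w"]) (rule freq_pos)
    also have "\<dots> \<le> exp (- (n * \<kappa>)) * (\<Prod>i<n. freq n w (w i))"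
    proof (rule mult_right_mono)
      show "exp (- (real n * KL N (freq n w))) \<le> exp (- (n * \<kappa>))" using K[OF w] by (simp add: mult_left_mono)
      show "0 \<le> (\<Prod>i<n. freq n w (w i))" by (rule Tnn) (use wW in blast)
    qed
    also have "\<dots> \<le> exp (- (n * \<kappa>)) * (\<Sum>\<tau>\<in>?T. \<Prod>i<n. \<tau> (w i))"
    proof (rule mult_left_mono)
      show "(\<Prod>i<n. freq n w (w i)) \<le> (\<Sum>\<tau>\<in>?T. \<Prod>i<n. \<tau> (w i))"
        using wW Tnn card_types(1) by (intro member_le_sum[of "freq n w" ?T "\<lambda>\<tau>. \<Prod>i<n. \<tau> (w i)"]) blast+
    qed simp
    finally show "(1 / real N) ^ n \<le> exp (- (n * \<kappa>)) * (\<Sum>\<tau>\<in>?T. \<Prod>i<n. \<tau> (w i))" .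
  qed
  also have "\<dots> = exp (- (n * \<kappa>)) * (\<Sum>\<tau>\<in>?T. \<Sum>w\<in>S. \<Prod>i<n. \<tau> (w i))"
    by (subst sum.swap) (simp add: sum_distrib_left)
  also have "\<dots> \<le> exp (- (n * \<kappa>)) * (\<Sum>\<tau>\<in>?T. 1)"
  proof (intro mult_left_mono sum_mono)
    fix \<tau> assume "\<tau> \<in> ?T"
    then obtain v where v: "v \<in> words N n" "\<tau> = freq n v" by auto
    have p: "\<tau> \<in> prob_vecs N"
      unfolding v(2) by (rule freq_prob_vecs) (use words_lt[OF v(1)] n in auto)
    have "(\<Sum>w\<in>S. \<Prod>i<n. \<tau> (w i)) \<le> (\<Sum>w\<in>words N n. \<Prod>i<n. \<tau> (w i))"
      by (rule sum_mono2[OF finite_words S]) (rule Tnn[OF \<open>\<tau> \<in> ?T\<close>])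
    also have "\<dots> = 1" by (simp add: sum_words_prod prob_vecs_sum[OF p])
    finally show "(\<Sum>w\<in>S. \<Prod>i<n. \<tau> (w i)) \<le> 1" .
  qed simp
  also have "\<dots> = exp (- (n * \<kappa>)) * real (card ?T)" by simp
  also have "\<dots> \<le> exp (- (n * \<kappa>)) * real ((n + 1) ^ N)"
    by (intro mult_left_mono of_nat_mono card_types(2)) auto
  also have "\<dots> = (real n + 1) ^ N * exp (- (n * \<kappa>))" by (simp add: add.commute)
  finally show ?thesis .
qed

lemma exponential_markov_words:
  fixes g :: "nat \<Rightarrow> real"
  assumes q: "q \<in> prob_vecs N"
  shows "(\<Sum>w | w \<in> words N n \<and> 0 \<le> (\<Sum>i<n. g (w i)). \<Prod>i<n. q (w i)) \<le> (\<Sum>v<N. q v * exp (g v)) ^ n"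
proof -
  have q0: "\<forall>i<n. 0 \<le> q (w i)" if "w \<in> words N n" for w
    using prob_vecs_nonneg[OF q] words_lt[OF that] by auto
  have "(\<Sum>w | w \<in> words N n \<and> 0 \<le> (\<Sum>i<n. g (w i)). \<Prod>i<n. q (w i))
     \<le> (\<Sum>w | w \<in> words N n \<and> 0 \<le> (\<Sum>i<n. g (w i)). \<Prod>i<n. q (w i) * exp (g (w i)))"
  proof (rule sum_mono)
    fix w assume w: "w \<in> {w \<in> words N n. 0 \<le> (\<Sum>i<n. g (w i))}"
    have "(\<Prod>i<n. q (w i)) * 1 \<le> (\<Prod>i<n. q (w i)) * exp (\<Sum>i<n. g (w i))"
      by (intro mult_left_mono prod_nonneg) (use w q0[of w] in auto)
    then show "(\<Prod>i<n. q (w i)) \<le> (\<Prod>i<n. q (w i) * exp (g (w i)))"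
      by (simp add: exp_sum prod.distrib)
  qed
  also have "\<dots> \<le> (\<Sum>w\<in>words N n. \<Prod>i<n. q (w i) * exp (g (w i)))"
  proof (rule sum_mono2[OF finite_words])
    fix w assume "w \<in> words N n - {w \<in> words N n. 0 \<le> (\<Sum>i<n. g (w i))}"
    then show "0 \<le> (\<Prod>i<n. q (w i) * exp (g (w i)))" using q0[of w] by (intro prod_nonneg) auto
  qed auto
  also have "\<dots> = (\<Sum>v<N. q v * exp (g v)) ^ n" by (rule sum_words_prod)
  finally show ?thesis .
qed

lemma exp_le_quadratic:
  assumes "\<bar>x::real\<bar> \<le> 1"
  shows "exp x \<le> 1 + x + x\<^sup>2"
proof (cases "0 \<le> x")
  case True then show ?thesis using exp_bound[of x] assms by simp
next
  case False
  then have x: "0 < -x" by simp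
  have "1 / exp (-x) \<le> 1 / (1 + (-x))"
    using x exp_ge_add_one_self[of "-x"] by (intro divide_left_mono mult_pos_pos) auto
  also have "\<dots> \<le> 1 + x + x\<^sup>2"
  proof -
    have "1 \<le> (1 + x + x\<^sup>2) * (1 - x)"
    proof -
      have "(1 + x + x\<^sup>2) * (1 - x) = 1 + (-x) ^ 3" by (simp add: power2_eq_square power3_eq_cube algebra_simps)
      then show ?thesis using x by (smt (verit) zero_le_power)
    qed
    then show ?thesis using x by (simp add: divide_le_eq)
  qed
  finally show ?thesis by (simp add: exp_minus field_simps)
qed

text \<open>A Chernoff bound with the exponential parameter t = \<delta> / 2; the sign s selects the upper or the lower deviation.\<close>

lemma freq_deviation:
  assumes q: "q \<in> prob_vecs N" and j: "j < N" and d: "0 < \<delta>" "\<delta> \<le> 1" and s: "s = 1 \<or> s = -(1::real)"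
  shows "(\<Sum>w | w \<in> words N n \<and> n * \<delta> \<le> s * (n * freq n w j - n * q j). \<Prod>i<n. q (w i)) \<le> exp (- (\<delta>\<^sup>2 / 4)) ^ n"
proof -
  define t where "t = \<delta> / 2"
  define g where "g v = t * (s * (of_bool (v = j) - q j) - \<delta>)" for v
  have t: "0 < t" "t \<le> 1" using d by (auto simp: t_def)
  have s2: "s * s = 1" "\<bar>s\<bar> = 1" using s by auto
  have cnt: "(\<Sum>i<n. of_bool (w i = j)) = n * freq n w j" for w
    by (cases "n = 0") (auto simp: freq_def of_bool_def sum.If_cases Int_def)
  have sg: "(\<Sum>i<n. g (w i)) = t * (s * (n * freq n w j - n * q j) - n * \<delta>)" for w
  proof -
    have "(\<Sum>i<n. g (w i)) = t * (s * ((\<Sum>i<n. of_bool (w i = j)) - n * q j) - n * \<delta>)"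
      by (simp add: g_def sum_distrib_left[symmetric] sum_subtractf)
    then show ?thesis unfolding cnt .
  qed
  have set: "{w. w \<in> words N n \<and> n * \<delta> \<le> s * (n * freq n w j - n * q j)} =
      {w. w \<in> words N n \<and> 0 \<le> (\<Sum>i<n. g (w i))}"
    unfolding sg using t by (simp add: zero_le_mult_iff)
  have "(\<Sum>v<N. q v * exp (g v)) \<le> exp (- (\<delta>\<^sup>2 / 4))"
  proof -
    have "(\<Sum>v<N. q v * exp (g v)) = exp (- t * (s * q j + \<delta>)) * (\<Sum>v<N. q v * exp (if v = j then t * s else 0))"
      unfolding sum_distrib_left
      by (rule sum.cong) (auto simp: g_def exp_add[symmetric] algebra_simps)
    also have "(\<Sum>v<N. q v * exp (if v = j then t * s else 0)) = (\<Sum>v<N. q v + (if v = j then q j * (exp (t * s) - 1) else 0))"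
      by (rule sum.cong) (auto simp: algebra_simps)
    also have "\<dots> = 1 + q j * (exp (t * s) - 1)" using j by (simp add: sum.distrib prob_vecs_sum[OF q])
    also have "\<dots> \<le> 1 + q j * (t * s + t\<^sup>2)"
    proof -
      have "exp (t * s) \<le> 1 + t * s + (t * s)\<^sup>2" by (rule exp_le_quadratic) (use t s2 in \<open>auto simp: abs_mult\<close>)
      also have "(t * s)\<^sup>2 = t\<^sup>2" using s by auto
      finally show ?thesis using prob_vecs_nonneg[OF q j] by (intro add_left_mono mult_left_mono) auto
    qed
    also have "\<dots> \<le> exp (q j * (t * s + t\<^sup>2))" by (rule exp_ge_add_one_self)
    finally have "(\<Sum>v<N. q v * exp (g v)) \<le> exp (- t * (s * q j + \<delta>)) * exp (q j * (t * s + t\<^sup>2))" by simp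
    also have "\<dots> = exp (- (t * \<delta>) + q j * t\<^sup>2)" by (simp add: exp_add[symmetric] algebra_simps)
    also have "\<dots> \<le> exp (- (t * \<delta>) + 1 * t\<^sup>2)" using prob_vecs_le_1[OF q j] mult_right_mono[of "q j" 1 "t\<^sup>2"] by simp
    also have "- (t * \<delta>) + 1 * t\<^sup>2 = - (\<delta>\<^sup>2 / 4)" by (simp add: t_def power2_eq_square)
    finally show ?thesis .
  qed
  then have "(\<Sum>v<N. q v * exp (g v)) ^ n \<le> exp (- (\<delta>\<^sup>2 / 4)) ^ n"
    by (intro power_mono sum_nonneg mult_nonneg_nonneg) (use prob_vecs_nonneg[OF q] in auto)
  then show ?thesis unfolding set using exponential_markov_words[OF q, of n g] by simp
qed

lemma sum_UN_le:
  fixes f :: "'b \<Rightarrow> real"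
  assumes "finite I" "\<And>i. i \<in> I \<Longrightarrow> finite (B i)" "\<And>i x. i \<in> I \<Longrightarrow> x \<in> B i \<Longrightarrow> 0 \<le> f x"
  shows "sum f (\<Union>i\<in>I. B i) \<le> (\<Sum>i\<in>I. sum f (B i))"
  using assms
proof (induction I rule: finite_induct)
  case (insert i I)
  let ?U = "\<Union>i\<in>I. B i"
  have fin: "finite (B i)" "finite ?U" using insert.prems(1) insert.hyps(1) by simp_all
  have "0 \<le> sum f (B i \<inter> ?U)" by (rule sum_nonneg) (use insert.prems(2)[of i] in auto)
  then have "sum f (B i \<union> ?U) \<le> sum f (B i) + sum f ?U" unfolding sum_Un[OF fin] by linarith
  moreover have "sum f ?U \<le> (\<Sum>i\<in>I. sum f (B i))"
    by (rule insert.IH) (use insert.prems in blast)+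
  ultimately show ?case using insert.hyps by simp
qed simp

text \<open>The lower bound of Sanov's theorem. Words with frequencies near q carry at least half of the weight under q,
and their uniform weight is at least exp (- n * KL q), up to the factor coming from \<delta>, times their weight under q.\<close>

lemma fraction_of_words_near_ge_exp_KL:
  assumes q: "q \<in> prob_vecs N" and d: "0 < \<delta>" "\<delta> \<le> 1"
  shows "\<forall>\<^sub>F n in sequentially.
    exp (- (n * (KL N q + \<delta> * (\<Sum>j<N. \<bar>ln (N * q j)\<bar>)))) / 2
      \<le> real (card {w \<in> words N n. \<forall>j<N. \<bar>freq n w j - q j\<bar> \<le> \<delta>}) / real N ^ n"
proof -
  have N: "0 < N" using q by (rule prob_vecs_pos)
  define \<rho> where "\<rho> = exp (- (\<delta>\<^sup>2 / 4))"
  have "(\<lambda>n. \<rho> ^ n) \<longlonglongrightarrow> 0" by (rule LIMSEQ_realpow_zero) (use d in \<open>auto simp: \<rho>_def\<close>)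
  then have "\<forall>\<^sub>F n in sequentially. \<rho> ^ n < 1 / (4 * N)" by (rule order_tendstoD) (use N in simp)
  then show ?thesis
  proof (rule eventually_mono[OF eventually_conj[OF eventually_gt_at_top[of 0]]], elim conjE)
    fix n :: nat assume n: "0 < n" and \<rho>: "\<rho> ^ n < 1 / (4 * N)"
    let ?D = "{w \<in> words N n. \<forall>j<N. \<bar>freq n w j - q j\<bar> \<le> \<delta>}"
    define P where "P w = (\<Prod>i<n. q (w i))" for w
    define B where "B j s = {w. w \<in> words N n \<and> n * \<delta> \<le> s * (n * freq n w j - n * q j)}" for j s
    define C where "C = KL N q + \<delta> * (\<Sum>j<N. \<bar>ln (N * q j)\<bar>)"
    have P0: "0 \<le> P w" if "w \<in> words N n" for w
      unfolding P_def by (rule prod_nonneg) (use prob_vecs_nonneg[OF q] words_lt[OF that] in auto)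
    have sub: "words N n - ?D \<subseteq> (\<Union>j<N. B j 1 \<union> B j (-1))"
    proof
      fix w assume w: "w \<in> words N n - ?D"
      then obtain j where j: "j < N" "\<delta> < \<bar>freq n w j - q j\<bar>" by force
      then consider "\<delta> \<le> freq n w j - q j" | "\<delta> \<le> - (freq n w j - q j)" by linarith
      then have "n * \<delta> \<le> 1 * (n * freq n w j - n * q j) \<or> n * \<delta> \<le> (-1) * (n * freq n w j - n * q j)"
      proof cases
        case 1
        then have "n * \<delta> \<le> n * (freq n w j - q j)" by (intro mult_left_mono) auto
        then show ?thesis by (simp add: algebra_simps)
      next
        case 2
        then have "n * \<delta> \<le> n * (- (freq n w j - q j))" by (intro mult_left_mono) auto
        then show ?thesis by (simp add: algebra_simps)
      qed
      then show "w \<in> (\<Union>j<N. B j 1 \<union> B j (-1))" using w j(1) unfolding B_def by blast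
    qed
    have fB: "finite (B j s)" for j s unfolding B_def by (rule finite_subset[OF _ finite_words], blast)
    have PB: "0 \<le> P w" if "w \<in> B j s" for w j s using that P0 unfolding B_def by blast
    have "sum P (words N n - ?D) \<le> sum P (\<Union>j<N. B j 1 \<union> B j (-1))"
    proof (rule sum_mono2[OF _ sub])
      show "finite (\<Union>j<N. B j 1 \<union> B j (-1))" using fB by simp
    qed (use PB in blast)
    also have "\<dots> \<le> (\<Sum>j<N. sum P (B j 1 \<union> B j (-1)))"
    proof (rule sum_UN_le)
      show "finite (B j 1 \<union> B j (-1))" for j using fB by simp
    qed (use PB in blast)+
    also have "\<dots> \<le> (\<Sum>j<N. sum P (B j 1) + sum P (B j (-1)))"
    proof (rule sum_mono)
      fix j
      have "0 \<le> sum P (B j 1 \<inter> B j (-1))" by (rule sum_nonneg) (use PB in blast)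
      then show "sum P (B j 1 \<union> B j (-1)) \<le> sum P (B j 1) + sum P (B j (-1))"
        unfolding sum_Un[OF fB fB] by linarith
    qed
    also have "\<dots> \<le> (\<Sum>j<N. \<rho> ^ n + \<rho> ^ n)"
      unfolding \<rho>_def P_def B_def by (intro sum_mono add_mono freq_deviation[OF q _ d]) auto
    also have "\<dots> \<le> 1 / 2" using \<rho> N by (simp add: field_simps)
    finally have "sum P (words N n - ?D) \<le> 1 / 2" .
    moreover have "sum P (words N n) = 1" unfolding P_def by (simp add: sum_words_prod prob_vecs_sum[OF q])
    moreover have "sum P (words N n) = sum P (words N n - ?D) + sum P ?D"
      by (rule sum.subset_diff[OF _ finite_words]) blast
    ultimately have half: "1 / 2 \<le> sum P ?D" by linarith
    have "exp (- (n * C)) * (1 / 2) \<le> exp (- (n * C)) * sum P ?D" using half by (intro mult_left_mono) auto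
    also have "\<dots> = (\<Sum>w\<in>?D. exp (- (n * C)) * P w)" by (rule sum_distrib_left)
    also have "\<dots> \<le> (\<Sum>w\<in>?D. (1 / real N) ^ n)"
    proof (rule sum_mono)
      fix w assume w: "w \<in> ?D"
      show "exp (- (n * C)) * P w \<le> (1 / real N) ^ n"
      proof (cases "P w = 0")
        case False
        have qp: "0 < q (w i)" if "i < n" for i
        proof -
          have "q (w i) \<noteq> 0" using False that unfolding P_def by (auto simp: prod_zero_iff)
          moreover have "w i < N" by (rule words_lt[of w n N]) (use w that in auto)
          ultimately show ?thesis using prob_vecs_nonneg[OF q, of "w i"] by simp
        qed
        have "(\<Sum>j<N. freq n w j * ln (N * q j)) \<le> (\<Sum>j<N. q j * ln (N * q j) + \<delta> * \<bar>ln (N * q j)\<bar>)"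
        proof (rule sum_mono)
          fix j assume "j \<in> {..<N}"
          then have "\<bar>freq n w j - q j\<bar> \<le> \<delta>" using w by auto
          then have "\<bar>freq n w j - q j\<bar> * \<bar>ln (N * q j)\<bar> \<le> \<delta> * \<bar>ln (N * q j)\<bar>" by (intro mult_right_mono) auto
          moreover have "(freq n w j - q j) * ln (N * q j) \<le> \<bar>freq n w j - q j\<bar> * \<bar>ln (N * q j)\<bar>"
            by (metis abs_ge_self abs_mult)
          ultimately show "freq n w j * ln (N * q j) \<le> q j * ln (N * q j) + \<delta> * \<bar>ln (N * q j)\<bar>"
            by (simp add: algebra_simps)
        qed
        also have "\<dots> = C" by (simp add: C_def KL_def sum.distrib sum_distrib_left)
        finally have "exp (- (n * C)) \<le> exp (- (real n * (\<Sum>j<N. freq n w j * ln (N * q j))))"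
          by (simp add: mult_left_mono)
        then have "exp (- (n * C)) * P w \<le> exp (- (real n * (\<Sum>j<N. freq n w j * ln (N * q j)))) * P w"
          using P0[of w] w by (intro mult_right_mono) auto
        also have "\<dots> = (1 / real N) ^ n"
          unfolding P_def by (rule prod_over_word[where w = w and N = N and n = n and q = q, symmetric]) (use w N qp in auto)
        finally show ?thesis .
      qed (use N in simp)
    qed
    also have "\<dots> = real (card ?D) / real N ^ n" by (simp add: power_divide)
    finally show "exp (- (n * (KL N q + \<delta> * (\<Sum>j<N. \<bar>ln (N * q j)\<bar>)))) / 2 \<le> real (card ?D) / real N ^ n"
      by (simp add: C_def)
  qed
qed

section \<open>Tail probabilities of Pareto samples\<close>

text \<open>Replace the four arguments of the form one at a time.\<close>

lemma bad_mass_Lipschitz: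
  assumes p: "p \<in> prob_vecs N" and q: "q \<in> prob_vecs N"
  shows "\<bar>bad_mass N q - bad_mass N p\<bar> \<le> 12 * (\<Sum>j<N. \<bar>q j - p j\<bar>)"
proof -
  let ?d = "\<lambda>j. 1 * q j + (-1) * p j"
  let ?e = "\<Sum>j<N. \<bar>q j - p j\<bar>"
  have n1: "(\<Sum>j<N. \<bar>q j\<bar>) = 1" "(\<Sum>j<N. \<bar>p j\<bar>) = 1"
    using prob_vecs_sum[OF p] prob_vecs_sum[OF q] prob_vecs_nonneg[OF p] prob_vecs_nonneg[OF q] by simp_all
  have e: "(\<Sum>j<N. \<bar>?d j\<bar>) = ?e" by simp
  have "quad N q q q q - quad N p p p p
     = quad N ?d q q q + quad N p ?d q q + quad N p p ?d q + quad N p p p ?d"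
    unfolding quad_linear by simp
  moreover have "\<bar>quad N ?d q q q\<bar> \<le> ?e" "\<bar>quad N p ?d q q\<bar> \<le> ?e" "\<bar>quad N p p ?d q\<bar> \<le> ?e" "\<bar>quad N p p p ?d\<bar> \<le> ?e"
    using abs_quad_le[of N ?d q q q] abs_quad_le[of N p ?d q q] abs_quad_le[of N p p ?d q] abs_quad_le[of N p p p ?d]
    unfolding n1 e by simp_all
  ultimately show ?thesis unfolding bad_mass_def by linarith
qed

text \<open>The set of observations x > 1 with x powr (- l) in the cell j of (0, 1).\<close>

definition cell :: "real \<Rightarrow> nat \<Rightarrow> nat \<Rightarrow> real set" where
  "cell l N j = {x. 1 < x \<and> real j / N \<le> x powr (- l) \<and> x powr (- l) < real (j + 1) / N}"

lemma cell_borel [measurable]: "cell l N j \<in> sets borel"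
  unfolding cell_def by measurable

text \<open>Closed forms in terms of minimum and maximum, from which measurability is evident.\<close>

lemma order_stat_three_formula:
  fixes x :: "nat \<Rightarrow> real"
  assumes d: "i \<noteq> j" "i \<noteq> k" "j \<noteq> k"
  shows "order_stat x 2 {i,j,k} = max (min (x i) (x j)) (min (max (x i) (x j)) (x k))"
    and "order_stat x 3 {i,j,k} = max (max (x i) (x j)) (x k)"
proof -
  have e: "{i,j,k} = {j,i,k}" "{i,j,k} = {i,k,j}" "{i,j,k} = {k,i,j}" "{i,j,k} = {j,k,i}" "{i,j,k} = {k,j,i}" by auto
  consider "x i \<le> x j" "x j \<le> x k" | "x i \<le> x k" "x k \<le> x j" | "x j \<le> x i" "x i \<le> x k"
    | "x j \<le> x k" "x k \<le> x i" | "x k \<le> x i" "x i \<le> x j" | "x k \<le> x j" "x j \<le> x i" by linarith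
  then have "order_stat x 2 {i,j,k} = max (min (x i) (x j)) (min (max (x i) (x j)) (x k))
     \<and> order_stat x 3 {i,j,k} = max (max (x i) (x j)) (x k)"
  proof cases
    case 1 then show ?thesis using order_stat_three[of i j k x] d by simp
  next
    case 2 then show ?thesis unfolding e(2) using order_stat_three[of i k j x] d by (simp add: max_def min_def)
  next
    case 3 then show ?thesis unfolding e(1) using order_stat_three[of j i k x] d by (simp add: max_def min_def)
  next
    case 4 then show ?thesis unfolding e(4) using order_stat_three[of j k i x] d by (simp add: max_def min_def)
  next
    case 5 then show ?thesis unfolding e(3) using order_stat_three[of k i j x] d by (simp add: max_def min_def)
  next
    case 6 then show ?thesis unfolding e(5) using order_stat_three[of k j i x] d by (simp add: max_def min_def)
  qed
  then show "order_stat x 2 {i,j,k} = max (min (x i) (x j)) (min (max (x i) (x j)) (x k))"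
    and "order_stat x 3 {i,j,k} = max (max (x i) (x j)) (x k)" by auto
qed

locale pareto_sample = prob_space M for M :: "'a measure" +
  fixes X :: "nat \<Rightarrow> 'a \<Rightarrow> real" and l :: real
  assumes indep: "indep_vars (\<lambda>_. borel) X UNIV"
    and l_pos: "0 < l"
    and cdf_X: "\<And>i. cdf (distr M borel (X i)) = pareto_cdf l"
begin

lemma X_measurable [measurable]: "X i \<in> borel_measurable M"
  using indep unfolding indep_vars_def by simp

lemma prob_X_greater:
  assumes "1 \<le> t"
  shows "prob {\<omega> \<in> space M. t < X i \<omega>} = t powr (- l)"
proof -
  have "prob {\<omega> \<in> space M. X i \<omega> \<le> t} = cdf (distr M borel (X i)) t"
    unfolding cdf_def by (subst measure_distr) (auto intro!: arg_cong[where f = prob])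
  then have "prob {\<omega> \<in> space M. X i \<omega> \<le> t} = 1 - t powr (- l)"
    using assms by (simp add: cdf_X pareto_cdf_def)
  moreover have "prob (space M - {\<omega> \<in> space M. X i \<omega> \<le> t}) = 1 - prob {\<omega> \<in> space M. X i \<omega> \<le> t}"
    by (rule prob_compl) measurable
  moreover have "space M - {\<omega> \<in> space M. X i \<omega> \<le> t} = {\<omega> \<in> space M. t < X i \<omega>}" by auto
  ultimately show ?thesis by simp
qed

text \<open>The transform X powr (- l) is uniform on (0, 1).\<close>

lemma prob_powr_less:
  assumes "0 \<le> s" "s \<le> 1"
  shows "prob {\<omega> \<in> space M. 1 < X i \<omega> \<and> X i \<omega> powr (- l) < s} = s"
proof (cases "s = 0")
  case True
  have e: "{\<omega> \<in> space M. 1 < X i \<omega> \<and> X i \<omega> powr (- l) < s} = {}"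
    unfolding True by (auto simp: not_less)
  show ?thesis unfolding e using True by simp
next
  case False
  then have s: "0 < s" using assms by simp
  define t where "t = s powr (- 1 / l)"
  have t1: "1 \<le> t"
  proof -
    have "1 powr (- 1 / l) \<le> s powr (- 1 / l)" by (rule powr_mono2') (use s assms l_pos in auto)
    then show ?thesis by (simp add: t_def)
  qed
  have tl: "t powr (- l) = s" unfolding t_def powr_powr using l_pos s by simp
  have "(1 < x \<and> x powr (- l) < s) = (t < x)" for x
  proof
    assume "t < x"
    moreover have "x powr (- l) < t powr (- l)" by (rule powr_less_mono2_neg) (use l_pos t1 \<open>t < x\<close> in auto)
    ultimately show "1 < x \<and> x powr (- l) < s" using t1 tl by simp
  next
    assume x: "1 < x \<and> x powr (- l) < s"
    show "t < x"
    proof (rule ccontr)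
      assume "\<not> t < x"
      then have "t powr (- l) \<le> x powr (- l)" by (intro powr_mono2') (use x l_pos in auto)
      then show False using x tl by simp
    qed
  qed
  then show ?thesis using prob_X_greater[OF t1, of i] tl by simp
qed

lemma prob_cell:
  assumes j: "j < N"
  shows "prob (X i -` cell l N j \<inter> space M) = 1 / N"
proof -
  let ?L = "\<lambda>s. {\<omega> \<in> space M. 1 < X i \<omega> \<and> X i \<omega> powr (- l) < s}"
  have N: "0 < real N" using j by simp
  have e: "X i -` cell l N j \<inter> space M = ?L (real (j + 1) / N) - ?L (real j / N)"
    by (auto simp: cell_def)
  have "real j / N \<le> real (j + 1) / N" using N by (simp add: divide_right_mono)
  then have "prob (?L (real (j + 1) / N) - ?L (real j / N)) = prob (?L (real (j + 1) / N)) - prob (?L (real j / N))"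
    by (intro finite_measure_Diff) (measurable, auto)
  also have "\<dots> = real (j + 1) / N - real j / N"
    using j N by (subst (1 2) prob_powr_less) (auto simp: divide_simps)
  also have "\<dots> = 1 / N" by (simp add: add_divide_distrib)
  finally show ?thesis unfolding e .
qed

definition word_event :: "nat \<Rightarrow> nat \<Rightarrow> (nat \<Rightarrow> nat) \<Rightarrow> 'a set" where
  "word_event N n w = {\<omega> \<in> space M. \<forall>i<n. X i \<omega> \<in> cell l N (w i)}"

lemma word_event_measurable [measurable]: "word_event N n w \<in> events"
  unfolding word_event_def by measurable

lemma prob_word_event:
  assumes w: "w \<in> words N n"
  shows "prob (word_event N n w) = (1 / N) ^ n"
proof (cases "n = 0")
  case True then show ?thesis by (simp add: word_event_def prob_space)
next
  case False
  have "word_event N n w = (\<Inter>i\<in>{..<n}. X i -` cell l N (w i) \<inter> space M)"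
    using False by (auto simp: word_event_def)
  also have "prob \<dots> = (\<Prod>i<n. prob (X i -` cell l N (w i) \<inter> space M))"
    by (rule indep_varsD[OF indep]) (use False in auto)
  also have "\<dots> = (\<Prod>i<n. 1 / N)"
    by (rule prod.cong[OF refl]) (use words_lt[OF w] prob_cell in auto)
  finally show ?thesis by simp
qed

lemma cell_unique: "x \<in> cell l N j \<Longrightarrow> x \<in> cell l N k \<Longrightarrow> j = k"
proof -
  assume a: "x \<in> cell l N j" "x \<in> cell l N k"
  then have "real j / N < real (k + 1) / N" "real k / N < real (j + 1) / N" unfolding cell_def by auto
  then show "j = k" by (auto simp: divide_less_cancel split: if_splits)
qed

lemma disjoint_word_events: "disjoint_family_on (word_event N n) (words N n)"
  unfolding disjoint_family_on_def
proof (intro ballI impI)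
  fix v w assume vw: "v \<in> words N n" "w \<in> words N n" "v \<noteq> w"
  show "word_event N n v \<inter> word_event N n w = {}"
  proof (rule ccontr)
    assume "\<not> ?thesis"
    then obtain \<omega> where o: "\<omega> \<in> word_event N n v" "\<omega> \<in> word_event N n w" by auto
    have "v = w"
    proof (rule PiE_ext[OF vw(1,2)])
      fix i assume "i \<in> {..<n}"
      then show "v i = w i" using o cell_unique[of "X i \<omega>" N "v i" "w i"] by (auto simp: word_event_def)
    qed
    then show False using vw by simp
  qed
qed

lemma AE_X_gt_1: "AE \<omega> in M. \<forall>i. 1 < X i \<omega>"
proof -
  have "AE \<omega> in M. 1 < X i \<omega>" for i
  proof -
    have "prob {\<omega> \<in> space M. 1 < X i \<omega>} = 1" using prob_X_greater[of 1 i] by simp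
    then have "AE \<omega> in M. \<omega> \<in> {\<omega> \<in> space M. 1 < X i \<omega>}" by (intro AE_prob_1)
    then show ?thesis by eventually_elim auto
  qed
  then show ?thesis by (simp add: AE_all_countable)
qed

lemma ex_word_event:
  assumes N: "0 < N" and o: "\<omega> \<in> space M" and x: "\<forall>i<n. 1 < X i \<omega>"
  shows "\<exists>w\<in>words N n. \<omega> \<in> word_event N n w"
proof -
  define u where "u i = X i \<omega> powr (- l)" for i
  define w where "w = (\<lambda>i\<in>{..<n}. nat \<lfloor>N * u i\<rfloor>)"
  have u: "0 < u i" "u i < 1" if "i < n" for i
  proof -
    show "0 < u i" using x that by (auto simp: u_def)
    have "X i \<omega> powr (- l) < 1 powr (- l)" by (rule powr_less_mono2_neg) (use x that l_pos in auto)
    then show "u i < 1" by (simp add: u_def)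
  qed
  have f: "real (nat \<lfloor>N * u i\<rfloor>) \<le> N * u i" "N * u i < real (nat \<lfloor>N * u i\<rfloor>) + 1" if "i < n" for i
    using u[OF that] N by (auto simp: of_nat_floor)
  have "w \<in> words N n"
  proof (rule PiE_I)
    fix i assume "i \<in> {..<n}"
    then have i: "i < n" by simp
    have "real N * u i < real N * 1" using u[OF i] N by (intro mult_strict_left_mono) auto
    then have "real (nat \<lfloor>N * u i\<rfloor>) < N" using f(1)[OF i] by simp
    then show "w i \<in> {..<N}" using i by (simp add: w_def)
  qed (simp add: w_def)
  moreover have "\<omega> \<in> word_event N n w"
    unfolding word_event_def cell_def using o x f N
    by (auto simp: w_def u_def[symmetric] divide_le_eq less_divide_eq mult.commute add.commute)
  ultimately show ?thesis by blast
qed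

lemma prob_le_fraction:
  assumes N: "0 < N" and A: "A \<in> events"
    and P: "\<And>w \<omega>. w \<in> words N n \<Longrightarrow> \<omega> \<in> word_event N n w \<Longrightarrow> \<omega> \<in> A \<Longrightarrow> P w"
  shows "prob A \<le> card {w \<in> words N n. P w} / real N ^ n"
proof -
  let ?S = "{w \<in> words N n. P w}"
  have fS: "finite ?S" by (rule finite_subset[OF _ finite_words]) blast
  have "prob A \<le> prob (\<Union>w\<in>?S. word_event N n w)"
  proof (rule finite_measure_mono_AE)
    show "AE \<omega> in M. \<omega> \<in> A \<longrightarrow> \<omega> \<in> (\<Union>w\<in>?S. word_event N n w)"
      using AE_X_gt_1
    proof eventually_elim
      case (elim \<omega>)
      show ?case
      proof
        assume a: "\<omega> \<in> A"
        then have "\<omega> \<in> space M" using A sets.sets_into_space by blast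
        then obtain w where "w \<in> words N n" "\<omega> \<in> word_event N n w"
          using ex_word_event[OF N, of \<omega> n] elim by blast
        then show "\<omega> \<in> (\<Union>w\<in>?S. word_event N n w)" using P a by blast
      qed
    qed
    show "(\<Union>w\<in>?S. word_event N n w) \<in> events" using fS by (intro sets.finite_UN) auto
  qed
  also have "\<dots> \<le> (\<Sum>w\<in>?S. prob (word_event N n w))"
    by (rule finite_measure_subadditive_finite[OF fS]) (use word_event_measurable in blast)
  also have "\<dots> = (\<Sum>w\<in>?S. (1 / N) ^ n)" by (rule sum.cong[OF refl]) (use prob_word_event in blast)
  also have "\<dots> = card ?S / real N ^ n" by (simp add: power_divide)
  finally show ?thesis .
qed

lemma prob_ge_fraction:
  assumes A: "A \<in> events" and S: "S \<subseteq> words N n" and sub: "\<And>w. w \<in> S \<Longrightarrow> word_event N n w \<subseteq> A"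
  shows "card S / real N ^ n \<le> prob A"
proof -
  have fS: "finite S" using S finite_words finite_subset by blast
  have "card S / real N ^ n = (\<Sum>w\<in>S. prob (word_event N n w))"
    using S by (subst sum.cong[OF refl prob_word_event]) (auto simp: power_divide)
  also have "\<dots> = prob (\<Union>w\<in>S. word_event N n w)"
    by (rule finite_measure_finite_Union[OF fS, symmetric])
      (auto intro: disjoint_family_on_mono[OF S disjoint_word_events])
  also have "\<dots> \<le> prob A" by (rule finite_measure_mono[OF _ A]) (use sub in blast)
  finally show ?thesis .
qed

lemma I_stat_measurable [measurable]: "(\<lambda>\<omega>. I_stat (\<lambda>i. X i \<omega>) n) \<in> borel_measurable M"
proof -
  have os: "(\<lambda>\<omega>. order_stat (\<lambda>i. X i \<omega>) s J) \<in> borel_measurable M"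
    if c: "card J = 3" and s: "s = 2 \<or> s = 3" for J s
  proof -
    obtain i j k where J: "J = {i,j,k}" and d: "i \<noteq> j" "i \<noteq> k" "j \<noteq> k"
      using c by (auto simp: card_3_iff)
    show ?thesis unfolding J using s
    proof
      assume "s = 2"
      show "(\<lambda>\<omega>. order_stat (\<lambda>i. X i \<omega>) s {i,j,k}) \<in> borel_measurable M"
        unfolding \<open>s = 2\<close> order_stat_three_formula(1)[OF d] by measurable
    next
      assume "s = 3"
      show "(\<lambda>\<omega>. order_stat (\<lambda>i. X i \<omega>) s {i,j,k}) \<in> borel_measurable M"
        unfolding \<open>s = 3\<close> order_stat_three_formula(2)[OF d] by measurable
    qed
  qed
  have H: "(\<lambda>\<omega>. H_emp (\<lambda>i. X i \<omega>) n (X m \<omega>)) \<in> borel_measurable M" for m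
    unfolding H_emp_def
  proof (intro borel_measurable_divide borel_measurable_sum borel_measurable_const)
    fix J assume "J \<in> {J. J \<subseteq> {..<n} \<and> card J = 3}"
    then have [measurable]: "(\<lambda>\<omega>. order_stat (\<lambda>i. X i \<omega>) 2 J) \<in> borel_measurable M"
      "(\<lambda>\<omega>. order_stat (\<lambda>i. X i \<omega>) 3 J) \<in> borel_measurable M" using os by auto
    show "(\<lambda>\<omega>. of_bool (order_stat (\<lambda>i. X i \<omega>) 3 J / order_stat (\<lambda>i. X i \<omega>) 2 J < X m \<omega>) :: real)
        \<in> borel_measurable M"
      unfolding of_bool_def by measurable
  qed
  have F: "(\<lambda>\<omega>. F_emp (\<lambda>i. X i \<omega>) n (X m \<omega>)) \<in> borel_measurable M" for m
    unfolding F_emp_def of_bool_def by measurable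
  show ?thesis unfolding I_stat_def using H F by measurable
qed

definition tail :: "nat \<Rightarrow> real \<Rightarrow> real" where
  "tail n a = prob {\<omega> \<in> space M. a < I_stat (\<lambda>i. X i \<omega>) n}"

lemma tail_event [measurable]: "{\<omega> \<in> space M. a < I_stat (\<lambda>i. X i \<omega>) n} \<in> events"
  by measurable

lemma tail_nonneg: "0 \<le> tail n a" and tail_le_1: "tail n a \<le> 1"
  by (auto simp: tail_def)

lemma tail_antimono: "a \<le> b \<Longrightarrow> tail n b \<le> tail n a"
  unfolding tail_def by (rule finite_measure_mono) auto

lemma I_stat_on_word_event:
  assumes N: "0 < N" and n: "3 \<le> n" and w: "w \<in> words N n" and o: "\<omega> \<in> word_event N n w"
    and m: "\<And>j. j < N \<Longrightarrow> freq n w j \<le> m"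
  shows "\<bar>I_stat (\<lambda>i. X i \<omega>) n - (1 / 2 - bad_mass N (freq n w))\<bar> \<le> 30 * m"
proof (rule I_stat_approx[OF N l_pos n _ _ _ _ m])
  fix i assume i: "i < n"
  then have c: "X i \<omega> \<in> cell l N (w i)" using o by (simp add: word_event_def)
  show "1 < X i \<omega>" "real (w i) / N \<le> X i \<omega> powr (- l)" "X i \<omega> powr (- l) < real (w i + 1) / N"
    using c unfolding cell_def by blast+
  show "w i < N" by (rule words_lt[OF w i])
qed

text \<open>Frequency vectors with an entry above \<epsilon> are not excluded from the infimum, because the discretisation error is not
controlled for them; their entropy is large when N is.\<close>

lemma tail_le:
  assumes N: "0 < N" and n: "3 \<le> n"
    and K: "\<And>q. q \<in> prob_vecs N \<Longrightarrow> (\<exists>j<N. \<epsilon> < q j) \<or> a - 30 * \<epsilon> \<le> 1 / 2 - bad_mass N q \<Longrightarrow> \<kappa> \<le> KL N q"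
  shows "tail n a \<le> (real n + 1) ^ N * exp (- (n * \<kappa>))"
proof -
  let ?P = "\<lambda>w. \<kappa> \<le> KL N (freq n w)"
  have "tail n a \<le> card {w \<in> words N n. ?P w} / real N ^ n"
    unfolding tail_def
  proof (rule prob_le_fraction[OF N tail_event])
    fix w \<omega> assume w: "w \<in> words N n" and o: "\<omega> \<in> word_event N n w"
      and i: "\<omega> \<in> {\<omega> \<in> space M. a < I_stat (\<lambda>i. X i \<omega>) n}"
    have q: "freq n w \<in> prob_vecs N"
      by (rule freq_prob_vecs) (use words_lt[OF w] n in auto)
    show "\<kappa> \<le> KL N (freq n w)"
    proof (rule K[OF q])
      show "(\<exists>j<N. \<epsilon> < freq n w j) \<or> a - 30 * \<epsilon> \<le> 1 / 2 - bad_mass N (freq n w)"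
      proof (cases "\<exists>j<N. \<epsilon> < freq n w j")
        case False
        then have "freq n w j \<le> \<epsilon>" if "j < N" for j using that not_less by blast
        then have "\<bar>I_stat (\<lambda>i. X i \<omega>) n - (1 / 2 - bad_mass N (freq n w))\<bar> \<le> 30 * \<epsilon>"
          by (rule I_stat_on_word_event[OF N n w o])
        then show ?thesis using i by auto
      qed blast
    qed
  qed
  also have "\<dots> \<le> (real n + 1) ^ N * exp (- (n * \<kappa>))"
    by (rule fraction_of_words_le_exp_KL[OF _ _ N]) (use n in \<open>blast | simp\<close>)+
  finally show ?thesis .
qed

text \<open>A change of measure: on words with frequencies near q the statistic exceeds a for certain.\<close>

lemma tail_ge:
  assumes q: "q \<in> prob_vecs N" and m: "\<And>j. j < N \<Longrightarrow> q j \<le> m"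
    and a: "a + 30 * m < 1 / 2 - bad_mass N q" and \<eta>: "0 < \<eta>"
  shows "\<forall>\<^sub>F n in sequentially. exp (- (n * (KL N q + \<eta>))) \<le> tail n a"
proof -
  have N: "0 < N" using q by (rule prob_vecs_pos)
  define L where "L = (\<Sum>j<N. \<bar>ln (N * q j)\<bar>)"
  define g where "g = 1 / 2 - bad_mass N q - a - 30 * m"
  have g: "0 < g" using a by (simp add: g_def)
  have L: "0 \<le> L" unfolding L_def by (rule sum_nonneg) auto
  \<comment> \<open>small enough for the entropy bound and for the Lipschitz bound of the bad mass\<close>
  define \<delta> where "\<delta> = min 1 (min (\<eta> / (2 * (L + 1))) (g / (2 * (30 + 12 * N))))"
  have d: "0 < \<delta>" "\<delta> \<le> 1" using g L \<eta> by (auto simp: \<delta>_def)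
  have dL: "\<delta> * L \<le> \<eta> / 2"
  proof -
    have "\<delta> * (L + 1) \<le> \<eta> / (2 * (L + 1)) * (L + 1)" by (rule mult_right_mono) (use L in \<open>auto simp: \<delta>_def\<close>)
    also have "\<dots> = \<eta> / 2" using L by (simp add: field_simps)
    finally show ?thesis using d L by (simp add: algebra_simps)
  qed
  have dg: "\<delta> * (30 + 12 * N) < g"
  proof -
    have "\<delta> * (30 + 12 * N) \<le> g / (2 * (30 + 12 * N)) * (30 + 12 * N)"
      by (rule mult_right_mono) (auto simp: \<delta>_def)
    also have "\<dots> = g / 2" by (simp add: field_simps)
    finally show ?thesis using g by simp
  qed
  have half: "\<forall>\<^sub>F n in sequentially. exp (- (n * (\<eta> / 2))) < 1 / 2"
  proof -
    have "(\<lambda>n. exp (- (\<eta> / 2)) ^ n) \<longlonglongrightarrow> 0" by (rule LIMSEQ_realpow_zero) (use \<eta> in auto)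
    then have "\<forall>\<^sub>F n in sequentially. exp (- (\<eta> / 2)) ^ n < 1 / 2" by (rule order_tendstoD) simp
    then show ?thesis by (simp add: exp_of_nat_mult[symmetric])
  qed
  show ?thesis
    using fraction_of_words_near_ge_exp_KL[OF q d] half eventually_ge_at_top[of 3]
  proof eventually_elim
    case (elim n)
    let ?D = "{w \<in> words N n. \<forall>j<N. \<bar>freq n w j - q j\<bar> \<le> \<delta>}"
    have "real (card ?D) / real N ^ n \<le> tail n a"
      unfolding tail_def
    proof (rule prob_ge_fraction[OF tail_event])
      fix w assume "w \<in> ?D"
      then have w: "w \<in> words N n" and c: "\<And>j. j < N \<Longrightarrow> \<bar>freq n w j - q j\<bar> \<le> \<delta>" by auto
      show "word_event N n w \<subseteq> {\<omega> \<in> space M. a < I_stat (\<lambda>i. X i \<omega>) n}"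
      proof
        fix \<omega> assume o: "\<omega> \<in> word_event N n w"
        have fq: "freq n w \<in> prob_vecs N"
          by (rule freq_prob_vecs) (use words_lt[OF w] elim(3) in auto)
        have "\<bar>I_stat (\<lambda>i. X i \<omega>) n - (1 / 2 - bad_mass N (freq n w))\<bar> \<le> 30 * (m + \<delta>)"
        proof (rule I_stat_on_word_event[OF N elim(3) w o])
          fix j assume "j < N"
          then show "freq n w j \<le> m + \<delta>" using c[of j] m[of j] by linarith
        qed
        moreover have "\<bar>bad_mass N (freq n w) - bad_mass N q\<bar> \<le> 12 * (N * \<delta>)"
        proof -
          have "(\<Sum>j<N. \<bar>freq n w j - q j\<bar>) \<le> (\<Sum>j<N. \<delta>)" by (rule sum_mono) (use c in auto)
          then show ?thesis using bad_mass_Lipschitz[OF q fq] by simp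
        qed
        moreover have "30 * \<delta> + 12 * (N * \<delta>) < g" using dg by (simp add: algebra_simps)
        ultimately have "1 / 2 - bad_mass N (freq n w) - I_stat (\<lambda>i. X i \<omega>) n \<le> 30 * m + 30 * \<delta>"
          "bad_mass N (freq n w) - bad_mass N q \<le> 12 * (N * \<delta>)"
          "30 * \<delta> + 12 * (N * \<delta>) < 1 / 2 - bad_mass N q - a - 30 * m"
          unfolding abs_le_iff g_def by simp_all
        then have "a < I_stat (\<lambda>i. X i \<omega>) n" by linarith
        then show "\<omega> \<in> {\<omega> \<in> space M. a < I_stat (\<lambda>i. X i \<omega>) n}" using o by (simp add: word_event_def)
      qed
    qed auto
    moreover have "exp (- (n * (KL N q + \<eta>))) \<le> exp (- (n * (KL N q + \<delta> * L))) / 2"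
    proof -
      have "exp (- (n * (KL N q + \<eta>))) = exp (- (n * (KL N q + \<eta> / 2))) * exp (- (n * (\<eta> / 2)))"
        by (simp add: exp_add[symmetric] algebra_simps)
      also have "\<dots> \<le> exp (- (n * (KL N q + \<delta> * L))) * (1 / 2)"
        by (intro mult_mono) (use elim(2) dL in \<open>auto intro!: mult_left_mono\<close>)
      finally show ?thesis by simp
    qed
    ultimately show "exp (- (n * (KL N q + \<eta>))) \<le> tail n a" using elim(1) unfolding L_def by linarith
  qed
qed

text \<open>If all U_i lie in [1/4, 1/2), then no quadruple is bad, as U_j U_k < 1/4. Hence H_n is 1 at every
observation, while the average of F_n is below 1/2. The interval has probability 1/4.\<close>

lemma tail_ge_quarter_power:
  assumes n: "3 \<le> n" and a: "a \<le> 1 / 2"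
  shows "(1 / 4) ^ n \<le> tail n a"
proof -
  \<comment> \<open>with four cells, the cell 1 is [1/4, 1/2)\<close>
  let ?w = "\<lambda>i\<in>{..<n}. 1 :: nat"
  have w: "?w \<in> words 4 n" by auto
  have "word_event 4 n ?w \<subseteq> {\<omega> \<in> space M. a < I_stat (\<lambda>i. X i \<omega>) n}"
  proof
    fix \<omega> assume o: "\<omega> \<in> word_event 4 n ?w"
    define x where "x i = X i \<omega>" for i
    have x: "1 < x i" "1 / 4 \<le> x i powr (- l)" "x i powr (- l) < 1 / 2" if "i < n" for i
      using o that by (auto simp: word_event_def cell_def x_def)
    have big: "x i < x j * x k" if "i < n" "j < n" "k < n" for i j k
    proof (rule ccontr)
      assume "\<not> x i < x j * x k"
      then have "x i powr (- l) \<le> (x j * x k) powr (- l)"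
        using x(1)[OF that(2)] x(1)[OF that(3)] l_pos by (intro powr_mono2') auto
      also have "\<dots> = x j powr (- l) * x k powr (- l)" by (rule powr_mult)
      also have "\<dots> < (1 / 2) * (1 / 2)"
        using x(3)[OF that(2)] x(3)[OF that(3)] by (intro mult_strict_mono) auto
      finally show False using x(2)[OF that(1)] by simp
    qed
    have H: "H_emp x n (x m) = 1" if m: "m < n" for m
    proof -
      have "far_ahead x (x m) i j k = 0" if "(i,j,k) \<in> triples n" for i j k
        using big[of i j m] big[of i k m] m that by (auto simp: far_ahead_def triples_def max_def)
      then have "(\<Sum>(i,j,k)\<in>triples n. far_ahead x (x m) i j k) = 0" by (intro sum.neutral) auto
      moreover have "\<And>i. i < n \<Longrightarrow> 0 < x i" using x(1) by (meson less_trans zero_less_one)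
      ultimately show ?thesis using H_emp_eq[of n x "x m"] x(1)[OF m] n by simp
    qed
    have "freq n ?w \<in> prob_vecs 4" by (rule freq_prob_vecs) (use n in auto)
    then have F: "(\<Sum>i<n. F_emp x n (x i)) / n < 1 / 2"
      by (intro F_emp_average(2)[where m = 1 and c = ?w and N = 4]) (use n prob_vecs_le_1 in auto)
    have "I_stat x n = (\<Sum>i<n. H_emp x n (x i)) / n - (\<Sum>i<n. F_emp x n (x i)) / n"
      by (simp add: I_stat_def sum_subtractf diff_divide_distrib)
    also have "(\<Sum>i<n. H_emp x n (x i)) / n = 1" using H n by simp
    finally have "a < I_stat x n" using F a by simp
    then show "\<omega> \<in> {\<omega> \<in> space M. a < I_stat (\<lambda>i. X i \<omega>) n}"
      using o by (simp add: word_event_def x_def[abs_def])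
  qed
  then have "real (card {?w}) / real 4 ^ n \<le> tail n a"
    unfolding tail_def by (intro prob_ge_fraction[OF tail_event]) (use w in auto)
  then show ?thesis by (simp add: power_divide)
qed

end

section \<open>Improving the functional at small entropy cost\<close>

text \<open>The coefficients are grouped by the number of arguments that come from r.\<close>

lemma bad_mass_mixture:
  fixes s t :: real and N :: nat
  defines "Q \<equiv> quad N"
  shows "bad_mass N (\<lambda>j. s * q j + t * r j) =
    s ^ 4 * bad_mass N q
    + s ^ 3 * t * (3 * (Q r q q q + Q q r q q + Q q q r q + Q q q q r))
    + s ^ 2 * t ^ 2 * (3 * (Q r r q q + Q r q r q + Q r q q r + Q q r r q + Q q r q r + Q q q r r))
    + s * t ^ 3 * (3 * (Q q r r r + Q r q r r + Q r r q r + Q r r r q))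
    + t ^ 4 * bad_mass N r"
  unfolding Q_def bad_mass_def quad_linear
  by (simp add: algebra_simps power2_eq_square power3_eq_cube power4_eq_xxxx)

lemma quad_prob_vecs_le:
  assumes "f \<in> prob_vecs N" "g \<in> prob_vecs N" "h \<in> prob_vecs N" "k \<in> prob_vecs N"
  shows "0 \<le> quad N f g h k" "quad N f g h k \<le> 1"
proof -
  have a: "(\<Sum>j<N. \<bar>q j\<bar>) = 1" if "q \<in> prob_vecs N" for q
    using prob_vecs_sum[OF that] prob_vecs_nonneg[OF that] by simp
  have "\<bar>quad N f g h k\<bar> \<le> 1" using abs_quad_le[of N f g h k] assms by (simp add: a)
  then show "quad N f g h k \<le> 1" by simp
  show "0 \<le> quad N f g h k" by (rule quad_nonneg) (use assms prob_vecs_nonneg in auto)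
qed

text \<open>If badness confines the arguments to given sets, the form is at most the product of the masses of these sets.\<close>

lemma quad_le_product_sum:
  assumes p: "f \<in> prob_vecs N" "g \<in> prob_vecs N" "h \<in> prob_vecs N" "k \<in> prob_vecs N"
    and le: "\<And>a b c d. a < N \<Longrightarrow> b < N \<Longrightarrow> c < N \<Longrightarrow> d < N \<Longrightarrow> f a \<noteq> 0 \<Longrightarrow> g b \<noteq> 0 \<Longrightarrow> h c \<noteq> 0 \<Longrightarrow> k d \<noteq> 0
      \<Longrightarrow> a * N < min b c * d \<Longrightarrow> a \<in> A \<and> b \<in> B \<and> c \<in> C \<and> d \<in> D"
  shows "quad N f g h k \<le> sum f ({..<N} \<inter> A) * sum g ({..<N} \<inter> B) * sum h ({..<N} \<inter> C) * sum k ({..<N} \<inter> D)"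
proof -
  let ?r = "\<lambda>(f::nat \<Rightarrow> real) A j. if j \<in> A then f j else 0"
  have "quad N f g h k \<le> (\<Sum>a<N. \<Sum>b<N. \<Sum>c<N. \<Sum>d<N. ?r f A a * ?r g B b * ?r h C c * ?r k D d)"
    unfolding quad_def
  proof (intro sum_mono)
    fix a b c d assume "a \<in> {..<N}" "b \<in> {..<N}" "c \<in> {..<N}" "d \<in> {..<N}"
    then have lt: "a < N" "b < N" "c < N" "d < N" by auto
    have nn: "0 \<le> f a" "0 \<le> g b" "0 \<le> h c" "0 \<le> k d" using p lt prob_vecs_nonneg by auto
    then have R: "0 \<le> ?r f A a * ?r g B b * ?r h C c * ?r k D d" by simp
    show "f a * g b * h c * k d * cell_kernel N a b c d \<le> ?r f A a * ?r g B b * ?r h C c * ?r k D d"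
    proof (cases "f a \<noteq> 0 \<and> g b \<noteq> 0 \<and> h c \<noteq> 0 \<and> k d \<noteq> 0 \<and> a * N < min b c * d")
      case True
      then show ?thesis using le[OF lt] by (simp add: cell_kernel_def)
    next
      case False
      then have z: "f a * g b * h c * k d * cell_kernel N a b c d = 0" by (auto simp: cell_kernel_def)
      show ?thesis unfolding z by (rule R)
    qed
  qed
  also have "\<dots> = sum f ({..<N} \<inter> A) * sum g ({..<N} \<inter> B) * sum h ({..<N} \<inter> C) * sum k ({..<N} \<inter> D)"
    unfolding sum4_factor by (simp add: sum.inter_restrict)
  finally show ?thesis .
qed

text \<open>Multiplying the entries by factors close to 1 changes the entropy by little.\<close>

lemma KL_tilt_le:
  assumes q: "q \<in> prob_vecs N" and \<rho>: "0 \<le> \<rho>" "\<rho> \<le> 1"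
    and m: "\<And>j. j < N \<Longrightarrow> \<bar>m j - 1\<bar> \<le> \<rho>"
  shows "KL N (\<lambda>j. q j * m j) \<le> KL N q + \<rho> * (KL N q + 4)"
proof -
  have N: "0 < N" using q by (rule prob_vecs_pos)
  have "KL N (\<lambda>j. q j * m j) \<le> (\<Sum>j<N. q j * ln (N * q j) + \<rho> * (q j * \<bar>ln (N * q j)\<bar>) + 2 * \<rho> * q j)"
    unfolding KL_def
  proof (rule sum_mono)
    fix j assume "j \<in> {..<N}"
    then have j: "j < N" by simp
    have q0: "0 \<le> q j" by (rule prob_vecs_nonneg[OF q j])
    have mj: "0 \<le> m j" "m j \<le> 2" "m j - 1 \<le> \<rho>" using m[OF j] \<rho> by linarith+
    show "q j * m j * ln (N * (q j * m j)) \<le> q j * ln (N * q j) + \<rho> * (q j * \<bar>ln (N * q j)\<bar>) + 2 * \<rho> * q j"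
    proof (cases "q j = 0")
      case False
      then have qp: "0 < q j" using q0 by simp
      have 1: "(m j - 1) * ln (N * q j) \<le> \<rho> * \<bar>ln (N * q j)\<bar>"
      proof -
        have "(m j - 1) * ln (N * q j) \<le> \<bar>m j - 1\<bar> * \<bar>ln (N * q j)\<bar>" by (metis abs_ge_self abs_mult)
        also have "\<dots> \<le> \<rho> * \<bar>ln (N * q j)\<bar>" using m[OF j] by (intro mult_right_mono) auto
        finally show ?thesis .
      qed
      have 2: "m j * ln (N * (q j * m j)) = m j * ln (N * q j) + m j * ln (m j)"
      proof (cases "m j = 0")
        case False
        then show ?thesis using mj qp N by (simp add: ln_mult algebra_simps)
      qed simp
      have 3: "m j * ln (m j) \<le> 2 * \<rho>"
      proof (cases "m j = 0")
        case False
        then have "m j * ln (m j) \<le> m j * (m j - 1)" using mj by (intro mult_left_mono ln_le_minus_one) auto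
        also have "\<dots> \<le> m j * \<rho>" using mj by (intro mult_left_mono) auto
        also have "\<dots> \<le> 2 * \<rho>" using mj \<rho> by (intro mult_right_mono) auto
        finally show ?thesis .
      qed (use \<rho> in simp)
      have "m j * ln (N * (q j * m j)) \<le> ln (N * q j) + \<rho> * \<bar>ln (N * q j)\<bar> + 2 * \<rho>"
        using 1 2 3 by (simp add: algebra_simps)
      then have "q j * (m j * ln (N * (q j * m j))) \<le> q j * (ln (N * q j) + \<rho> * \<bar>ln (N * q j)\<bar> + 2 * \<rho>)"
        using qp by (intro mult_left_mono) auto
      then show ?thesis by (simp add: algebra_simps)
    qed simp
  qed
  also have "\<dots> = KL N q + \<rho> * (\<Sum>j<N. q j * \<bar>ln (N * q j)\<bar>) + 2 * \<rho>"
    by (simp add: KL_def sum.distrib sum_distrib_left[symmetric] prob_vecs_sum[OF q])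
  also have "\<dots> \<le> KL N q + \<rho> * (KL N q + 2) + 2 * \<rho>"
    using \<rho> sum_abs_log_le_KL[OF q] by (intro add_right_mono add_left_mono mult_left_mono) auto
  finally show ?thesis by (simp add: algebra_simps)
qed

lemma mass_of_small_set:
  fixes s :: real
  assumes q: "q \<in> prob_vecs N" and KL: "KL N q \<le> C" and S: "S \<subseteq> {..<N}" and c: "real (card S) \<le> s * N"
    and s: "0 < s" "s \<le> exp (- ((C + 1) / \<epsilon>))" and e: "0 < \<epsilon>"
  shows "sum q S \<le> \<epsilon>"
proof -
  have C0: "0 \<le> C" using KL KL_nonneg[OF q] by simp
  have "ln s \<le> ln (exp (- ((C + 1) / \<epsilon>)))" using s by (subst ln_le_cancel_iff) auto
  then have L: "(C + 1) / \<epsilon> \<le> ln (1 / s)" using s by (simp add: ln_div)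
  have "exp (- ((C + 1) / \<epsilon>)) \<le> 1" using C0 e by simp
  then have "s \<le> 1" using s by linarith
  then have "ln (1 / s) * sum q S \<le> KL N q + ln 2"
    by (intro KL_small_set[OF q S c] s)
  also have "\<dots> \<le> C + 1" using KL ln_2_less_1 by simp
  finally have "ln (1 / s) * sum q S \<le> C + 1" .
  moreover have "(C + 1) / \<epsilon> * sum q S \<le> ln (1 / s) * sum q S"
    using L prob_vecs_subset_le_1(2)[OF q S] by (rule mult_right_mono)
  ultimately have "(C + 1) / \<epsilon> * sum q S \<le> C + 1" by linarith
  then have "(C + 1) * sum q S \<le> (C + 1) * \<epsilon>" using e by (simp add: field_simps)
  then show ?thesis using C0 by simp
qed

lemma card_upper_cells:
  fixes N g :: nat
  assumes N: "0 < N" shows "real (card {d. d < N \<and> N * g < d * (g + 1)}) \<le> real N / real (g + 1)"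
proof -
  define y where "y = N * g div (g + 1)"
  have y: "y * (g + 1) \<le> N * g" "N * g < (y + 1) * (g + 1)"
    unfolding y_def using div_times_less_eq_dividend[of "N * g" "g + 1"] dividend_less_div_times[of "g + 1" "N * g"]
    by (simp_all add: algebra_simps)
  have "{d. d < N \<and> N * g < d * (g + 1)} \<subseteq> {y<..<N}"
  proof
    fix d assume "d \<in> {d. d < N \<and> N * g < d * (g + 1)}"
    then have "y * (g + 1) < d * (g + 1)" "d < N" using y by auto
    then have "y < d \<and> d < N" by (simp only: mult_less_cancel2)
    then show "d \<in> {y<..<N}" by simp
  qed
  then have "card {d. d < N \<and> N * g < d * (g + 1)} \<le> card {y<..<N}" by (intro card_mono) auto
  also have "\<dots> = N - Suc y" by simp
  finally have c: "card {d. d < N \<and> N * g < d * (g + 1)} \<le> N - Suc y" .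
  have "y < N"
  proof (rule ccontr)
    assume "\<not> y < N"
    then have "N * (g + 1) \<le> y * (g + 1)" by (intro mult_right_mono) auto
    then have "N * (g + 1) \<le> N * g" using y by linarith
    then show False using N by simp
  qed
  have "real (N * g) < real ((y + 1) * (g + 1))" using y(2) by (simp only: of_nat_less_iff)
  then have "real N * real (g + 1) - real (y + 1) * real (g + 1) \<le> N"
    by (simp add: algebra_simps)
  then have "(real N - real (y + 1)) * real (g + 1) \<le> N" by (simp only: left_diff_distrib)
  then have "real N - real (y + 1) \<le> real N / real (g + 1)" by (simp add: pos_le_divide_eq)
  then show ?thesis using c \<open>y < N\<close> by simp
qed

text \<open>The g-th of consecutive blocks of r cells each. If N = G * r, these are G blocks of width 1 / G, so that
windows have a size that does not depend on N.\<close>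

definition block :: "nat \<Rightarrow> nat \<Rightarrow> nat set" where
  "block r g = {g * r ..< (g + 1) * r}"

lemma sum_blocks: "sum f {..<g * r} = (\<Sum>i<g. sum f (block r i))" for f :: "nat \<Rightarrow> real"
proof (induction g)
  case (Suc g)
  have "{..<Suc g * r} = {..<g * r} \<union> block r g" "{..<g * r} \<inter> block r g = {}"
    by (auto simp: block_def)
  then show ?case using Suc by (simp add: sum.union_disjoint block_def)
qed simp

lemma block_subset: "g < G \<Longrightarrow> block r g \<subseteq> {..<G * r}"
proof -
  assume "g < G"
  then have "(g + 1) * r \<le> G * r" by (intro mult_right_mono) auto
  then show ?thesis by (auto simp: block_def)
qed

text \<open>A block that carries a mass of at least \<epsilon> / G while little mass lies below its upper end. Blocks with index below
g0 carry little mass because there are few of them; among the others take the first one that is not too light. All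
numbers depend only on \<epsilon> and the entropy bound, and g0 is large, so that the ratio of two points of the block is
close to 1.\<close>

lemma ex_heavy_block_over_light_prefix:
  assumes e: "0 < \<epsilon>" "\<epsilon> \<le> 1 / 8" and C: "0 \<le> C"
  obtains G g0 :: nat where "0 < G"
    "exp ((C + 1) / \<epsilon>) \<le> g0"
    "\<And>r q. 0 < r \<Longrightarrow> q \<in> prob_vecs (G * r) \<Longrightarrow> KL (G * r) q \<le> C \<Longrightarrow>
       \<exists>g\<ge>g0. g < G \<and> \<epsilon> / G \<le> sum q (block r g) \<and> sum q {..<(g + 1) * r} \<le> 3 * \<epsilon>"
proof -
  define A where "A = exp ((C + 1) / \<epsilon>)"
  have A: "0 < A" by (simp add: A_def)
  \<comment> \<open>a set of uniform mass at most 1 / A has q-mass at most \<epsilon>\<close>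
  define g0 where "g0 = nat \<lceil>A\<rceil> + 1"
  define G where "G = nat \<lceil>A * g0\<rceil> + 1"
  have g0: "A \<le> g0" "0 < g0" unfolding g0_def by linarith+
  have G: "A * g0 \<le> G" "0 < G" unfolding G_def by linarith+
  have exA: "exp (- ((C + 1) / \<epsilon>)) = 1 / A" unfolding A_def by (simp add: exp_minus inverse_eq_divide)
  have sG: "real g0 / G \<le> 1 / A" using G A by (simp add: field_simps)
  show ?thesis
  proof (rule that[OF G(2) g0(1)[unfolded A_def]])
    fix r q assume r: "0 < r" and q: "q \<in> prob_vecs (G * r)" and K: "KL (G * r) q \<le> C"
    let ?N = "G * r"
    have low: "sum q {..<g0 * r} \<le> \<epsilon>" if "g0 \<le> G"
    proof (rule mass_of_small_set[OF q K])
      show "{..<g0 * r} \<subseteq> {..<?N}" using that by auto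
      show "real (card {..<g0 * r}) \<le> real g0 / G * real ?N" using G by simp
      show "0 < real g0 / G" using g0 G by simp
      show "real g0 / G \<le> exp (- ((C + 1) / \<epsilon>))" unfolding exA by (rule sG)
    qed (rule e)
    have A1: "1 \<le> A" unfolding A_def using C e by simp
    have g0G: "g0 \<le> G"
    proof -
      have "1 * real g0 \<le> A * g0" using A1 by (intro mult_right_mono) auto
      then show ?thesis using G by linarith
    qed
    have blk: "sum q (block r g) \<le> \<epsilon>" if "g < G" for g
    proof (rule mass_of_small_set[OF q K block_subset[OF that]])
      show "real (card (block r g)) \<le> 1 / G * real ?N" using G by (simp add: block_def)
      have "1 / G \<le> real g0 / G" using g0 by (intro divide_right_mono) auto
      then show "1 / real G \<le> exp (- ((C + 1) / \<epsilon>))" unfolding exA using sG by linarith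
    qed (use G e in auto)
    let ?H = "\<lambda>g. g0 \<le> g \<and> g < G \<and> \<epsilon> / G \<le> sum q (block r g)"
    have split: "sum q {..<g * r} \<le> \<epsilon> + (\<Sum>i\<in>{g0..<g}. sum q (block r i))" if "g0 \<le> g" for g
    proof -
      have "sum q {..<g * r} = (\<Sum>i<g0. sum q (block r i)) + (\<Sum>i\<in>{g0..<g}. sum q (block r i))"
        unfolding sum_blocks using that by (subst sum.union_disjoint[symmetric]) (auto intro!: sum.cong)
      then show ?thesis using low[OF g0G] by (simp add: sum_blocks)
    qed
    have small: "(\<Sum>i\<in>{g0..<g}. sum q (block r i)) \<le> \<epsilon>"
      if "\<And>i. g0 \<le> i \<Longrightarrow> i < g \<Longrightarrow> \<not> ?H i" "g \<le> G" for g
    proof -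
      have "(\<Sum>i\<in>{g0..<g}. sum q (block r i)) \<le> (\<Sum>i\<in>{g0..<g}. \<epsilon> / G)"
        by (rule sum_mono) (use that in force)
      also have "\<dots> = real (g - g0) * \<epsilon> / G" by simp
      also have "\<dots> \<le> real G * \<epsilon> / G" using that(2) e by (intro divide_right_mono mult_right_mono) auto
      finally show ?thesis using G by simp
    qed
    have ex: "\<exists>g. ?H g"
    proof (rule ccontr)
      assume "\<nexists>g. ?H g"
      then have "sum q {..<G * r} \<le> \<epsilon> + \<epsilon>" using split[OF g0G] small[of G] by force
      then show False using prob_vecs_sum[OF q] e by simp
    qed
    define g where "g = (LEAST g. ?H g)"
    have H: "?H g" unfolding g_def using ex by (rule LeastI_ex)
    have nH: "\<not> ?H i" if "i < g" for i using not_less_Least[of i ?H] that unfolding g_def by blast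
    have "(g + 1) * r = Suc g * r" by simp
    then have "sum q {..<(g + 1) * r} = sum q {..<g * r} + sum q (block r g)"
      unfolding sum_blocks by simp
    also have "\<dots> \<le> (\<epsilon> + \<epsilon>) + \<epsilon>"
      using split[of g] small[of g] nH H blk[of g] by (intro add_mono) force+
    finally show "\<exists>g\<ge>g0. g < G \<and> \<epsilon> / G \<le> sum q (block r g) \<and> sum q {..<(g + 1) * r} \<le> 3 * \<epsilon>"
      using H by auto
  qed
qed


text \<open>If two points of the block are compared through a factor d, then d must exceed g / (g + 1), so it is close to 1.\<close>

lemma block_pair_forces_top:
  assumes "a \<in> block r g" "b \<in> block r g" "a * N < b * d"
  shows "N * g < d * (g + 1)"
proof -
  have ab: "g * r \<le> a" "b < (g + 1) * r" using assms by (auto simp: block_def)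
  have "r * (N * g) \<le> a * N" using mult_right_mono[OF ab(1), of N] by (simp add: mult_ac)
  also have "\<dots> < b * d" by fact
  also have "\<dots> \<le> (g + 1) * r * d" using ab(2) by (intro mult_right_mono) auto
  also have "\<dots> = r * (d * (g + 1))" by (simp add: algebra_simps)
  finally show ?thesis by simp
qed

lemma less_of_mult_less:
  fixes a b d N :: nat
  assumes "a * N < b * d" "d < N" shows "a < b"
proof (rule ccontr)
  assume "\<not> a < b"
  then have "b * d \<le> a * N" using assms by (intro mult_mono) auto
  then show False using assms by simp
qed

text \<open>Two arguments in the block R make badness rare. If one of them is the leading argument, some other argument is close
to 1 (a set of small mass); if not, the leading argument lies below the upper end of the block (again of small mass).\<close>

lemma quad_two_in_block:
  fixes q R :: "nat \<Rightarrow> real"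
  assumes q: "q \<in> prob_vecs N" and R: "R \<in> prob_vecs N" and supp_R: "{j. R j \<noteq> 0} \<subseteq> block r g"
    and S: "sum q {d. d < N \<and> N * g < d * (g + 1)} \<le> \<epsilon>" and P: "sum q ({..<N} \<inter> {..<(g + 1) * r}) \<le> \<epsilon>"
  shows "quad N R R q q \<le> \<epsilon>" "quad N R q R q \<le> \<epsilon>" "quad N R q q R \<le> \<epsilon>"
    "quad N q R R q \<le> \<epsilon>" "quad N q R q R \<le> \<epsilon>" "quad N q q R R \<le> \<epsilon>"
proof -
  have supp: "\<And>j. R j \<noteq> 0 \<Longrightarrow> j \<in> block r g" using supp_R by blast
  let ?S = "{d. N * g < d * (g + 1)}"
  let ?P = "{..<(g + 1) * r}"
  have tot: "sum q ({..<N} \<inter> UNIV) = 1" "sum R ({..<N} \<inter> UNIV) = 1"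
    using prob_vecs_sum[OF q] prob_vecs_sum[OF R] by simp_all
  have S': "sum q ({..<N} \<inter> ?S) \<le> \<epsilon>"
  proof -
    have "{..<N} \<inter> ?S = {d. d < N \<and> N * g < d * (g + 1)}" by auto
    then show ?thesis using S by simp
  qed
  have P': "j \<in> ?P" if "j \<in> block r g" for j using that by (auto simp: block_def)
  have min1: "a * N < b * d" and min2: "a * N < c * d" if "a * N < min b c * d" for a b c d
  proof -
    have "min b c * d \<le> b * d" "min b c * d \<le> c * d" by (auto intro: mult_right_mono)
    then show "a * N < b * d" "a * N < c * d" using that by linarith+
  qed
  have "quad N R R q q \<le> sum R ({..<N} \<inter> UNIV) * sum R ({..<N} \<inter> UNIV) * sum q ({..<N} \<inter> UNIV) * sum q ({..<N} \<inter> ?S)"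
    by (rule quad_le_product_sum[OF R R q q]) (use block_pair_forces_top[OF supp supp] min1 in blast)
  then show "quad N R R q q \<le> \<epsilon>" unfolding tot using S' by simp
  have "quad N R q R q \<le> sum R ({..<N} \<inter> UNIV) * sum q ({..<N} \<inter> UNIV) * sum R ({..<N} \<inter> UNIV) * sum q ({..<N} \<inter> ?S)"
    by (rule quad_le_product_sum[OF R q R q]) (use block_pair_forces_top[OF supp supp] min2 in blast)
  then show "quad N R q R q \<le> \<epsilon>" unfolding tot using S' by simp
  have top3: "b \<in> ?S" if "R a \<noteq> 0" "R d \<noteq> 0" "a * N < min b c * d" for a b c d
    using block_pair_forces_top[OF supp[OF that(1)] supp[OF that(2)], of N b] min1[OF that(3)]
    by (simp add: mult.commute)
  have "quad N R q q R \<le> sum R ({..<N} \<inter> UNIV) * sum q ({..<N} \<inter> ?S) * sum q ({..<N} \<inter> UNIV) * sum R ({..<N} \<inter> UNIV)"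
    by (rule quad_le_product_sum[OF R q q R]) (use top3 in blast)
  then show "quad N R q q R \<le> \<epsilon>" unfolding tot using S' by simp
  have low1: "a \<in> ?P" if "R b \<noteq> 0" "d < N" "a * N < min b c * d" for a b c d
    using less_of_mult_less[OF min1[OF that(3)] that(2)] P'[OF supp[OF that(1)]] by simp
  have low2: "a \<in> ?P" if "R d \<noteq> 0" "b < N" "a * N < min b c * d" for a b c d
    using less_of_mult_less[of a N d b] min1[OF that(3)] that(2) P'[OF supp[OF that(1)]]
    by (simp add: mult.commute)
  have "quad N q R R q \<le> sum q ({..<N} \<inter> ?P) * sum R ({..<N} \<inter> UNIV) * sum R ({..<N} \<inter> UNIV) * sum q ({..<N} \<inter> UNIV)"
    by (rule quad_le_product_sum[OF q R R q]) (use low1 in blast)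
  then show "quad N q R R q \<le> \<epsilon>" unfolding tot using P by simp
  have "quad N q R q R \<le> sum q ({..<N} \<inter> ?P) * sum R ({..<N} \<inter> UNIV) * sum q ({..<N} \<inter> UNIV) * sum R ({..<N} \<inter> UNIV)"
    by (rule quad_le_product_sum[OF q R q R]) (use low1 in blast)
  then show "quad N q R q R \<le> \<epsilon>" unfolding tot using P by simp
  have "quad N q q R R \<le> sum q ({..<N} \<inter> ?P) * sum q ({..<N} \<inter> UNIV) * sum R ({..<N} \<inter> UNIV) * sum R ({..<N} \<inter> UNIV)"
    by (rule quad_le_product_sum[OF q q R R]) (use low2 in blast)
  then show "quad N q q R R \<le> \<epsilon>" unfolding tot using P by simp
qed

text \<open>The elementary inequality behind the improvement: with B1 compared to 4 B0, one of the two signs turns the first two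
terms into at most B0 (1 - h)^3 (1 + 3 h) = B0 (1 - 6 h^2 + 8 h^3 - 3 h^4), h being \<eta> or - \<eta>.\<close>

lemma quartic_decrease:
  fixes \<eta> b0 B0 B1 B2 B3 B4 :: real
  assumes e: "0 < \<eta>" "\<eta> \<le> 1 / 10" "\<eta> \<le> b0 / 39" and b: "0 < b0" "b0 \<le> B0" "B0 \<le> 3"
    and B: "0 \<le> B2" "B2 \<le> b0 / 2" "0 \<le> B3" "B3 \<le> 12" "0 \<le> B4" "B4 \<le> 3"
  defines "p \<equiv> \<lambda>h. (1 - h) ^ 4 * B0 + (1 - h) ^ 3 * h * B1 + (1 - h)\<^sup>2 * h\<^sup>2 * B2 + (1 - h) * h ^ 3 * B3 + h ^ 4 * B4"
  shows "p \<eta> \<le> B0 - 4 * \<eta>\<^sup>2 * b0 \<or> p (- \<eta>) \<le> B0 - 4 * \<eta>\<^sup>2 * b0"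
proof -
  have e3: "\<eta> ^ 3 \<le> \<eta>\<^sup>2 * (b0 / 39)"
    using e by (simp add: power3_eq_cube power2_eq_square mult_left_mono)
  have e4: "\<eta> ^ 4 \<le> \<eta> ^ 3 / 10"
  proof -
    have "\<eta> ^ 4 = \<eta> ^ 3 * \<eta>" by (simp add: power3_eq_cube power4_eq_xxxx)
    also have "\<dots> \<le> \<eta> ^ 3 * (1 / 10)" by (rule mult_left_mono) (use e in auto)
    finally show ?thesis by simp
  qed
  have eb: "\<eta>\<^sup>2 * b0 \<le> \<eta>\<^sup>2 * B0" using b by (intro mult_left_mono) auto
  have p3: "0 < \<eta> ^ 3" "0 < \<eta> ^ 4" "0 < \<eta>\<^sup>2" using e by auto
  have t4: "\<eta> ^ 4 * B4 \<le> \<eta> ^ 4 * 3" using B p3 by (intro mult_left_mono) auto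
  show ?thesis
  proof (cases "B1 \<le> 4 * B0")
    case True
    have "(1 - \<eta>) ^ 3 * \<eta> * B1 \<le> (1 - \<eta>) ^ 3 * \<eta> * (4 * B0)"
      using True e by (intro mult_left_mono) auto
    moreover have "(1 - \<eta>) ^ 4 * B0 + (1 - \<eta>) ^ 3 * \<eta> * (4 * B0) = B0 - 6 * (\<eta>\<^sup>2 * B0) + 8 * (\<eta> ^ 3 * B0) - 3 * (\<eta> ^ 4 * B0)"
      by (simp add: algebra_simps power2_eq_square power3_eq_cube power4_eq_xxxx)
    moreover have "\<eta> ^ 3 * B0 \<le> \<eta> ^ 3 * 3" "0 \<le> \<eta> ^ 4 * B0" using b p3 by (auto intro!: mult_left_mono)
    moreover have "(1 - \<eta>)\<^sup>2 * \<eta>\<^sup>2 * B2 \<le> 1 * \<eta>\<^sup>2 * (b0 / 2)"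
      using e B b by (intro mult_mono) (auto intro: power_le_one)
    moreover have "(1 - \<eta>) * \<eta> ^ 3 * B3 \<le> 1 * \<eta> ^ 3 * 12" using e B by (intro mult_mono) auto
    ultimately have "p \<eta> \<le> B0 - 6 * (\<eta>\<^sup>2 * b0) + 24 * \<eta> ^ 3 + \<eta>\<^sup>2 * b0 / 2 + 12 * \<eta> ^ 3 + 3 * \<eta> ^ 4"
      unfolding p_def using eb t4 by linarith
    also have "\<dots> \<le> B0 - 4 * (\<eta>\<^sup>2 * b0)" using e3 e4 p3 by linarith
    finally show ?thesis by simp
  next
    case False
    have "(1 + \<eta>) ^ 3 * \<eta> * (4 * B0) \<le> (1 + \<eta>) ^ 3 * \<eta> * B1"
      using False e by (intro mult_left_mono) auto
    moreover have "(1 + \<eta>) ^ 4 * B0 - (1 + \<eta>) ^ 3 * \<eta> * (4 * B0) = B0 - 6 * (\<eta>\<^sup>2 * B0) - 8 * (\<eta> ^ 3 * B0) - 3 * (\<eta> ^ 4 * B0)"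
      by (simp add: algebra_simps power2_eq_square power3_eq_cube power4_eq_xxxx)
    moreover have "0 \<le> \<eta> ^ 3 * B0" "0 \<le> \<eta> ^ 4 * B0" using b p3 by auto
    moreover have "(1 + \<eta>)\<^sup>2 * \<eta>\<^sup>2 * B2 \<le> 2 * \<eta>\<^sup>2 * (b0 / 2)"
    proof (intro mult_mono)
      have "(1 + \<eta>)\<^sup>2 \<le> (1 + 1 / 10)\<^sup>2" using e by (intro power_mono) auto
      then show "(1 + \<eta>)\<^sup>2 \<le> 2" by (simp add: power2_eq_square)
    qed (use B b in auto)
    moreover have "0 \<le> (1 + \<eta>) * \<eta> ^ 3 * B3" using e B by simp
    moreover have "p (- \<eta>) = (1 + \<eta>) ^ 4 * B0 - (1 + \<eta>) ^ 3 * \<eta> * B1 + (1 + \<eta>)\<^sup>2 * \<eta>\<^sup>2 * B2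
       - (1 + \<eta>) * \<eta> ^ 3 * B3 + \<eta> ^ 4 * B4" unfolding p_def by simp
    ultimately have "p (- \<eta>) \<le> B0 - 6 * (\<eta>\<^sup>2 * b0) + \<eta>\<^sup>2 * b0 + 3 * \<eta> ^ 4" using eb t4 by linarith
    also have "\<dots> \<le> B0 - 4 * (\<eta>\<^sup>2 * b0)" using e3 e4 p3 by linarith
    finally show ?thesis by simp
  qed
qed

text \<open>No vector with positive bad mass is a local minimum of the bad mass, uniformly in the number of cells. The gain
\<gamma> depends only on the entropy bound C, on b0 and on the permitted cost \<omega>. The bound q' \<le> 2 q keeps the discretisation
error under control.\<close>

lemma cheap_improvement:
  fixes C b0 \<omega> :: real
  assumes C: "0 \<le> C" and b0: "0 < b0" and w: "0 < \<omega>"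
  obtains \<gamma> :: real and G :: nat where "0 < \<gamma>" "0 < G"
    "\<And>r q. 0 < r \<Longrightarrow> q \<in> prob_vecs (G * r) \<Longrightarrow> KL (G * r) q \<le> C \<Longrightarrow> b0 \<le> bad_mass (G * r) q \<Longrightarrow>
      \<exists>q'\<in>prob_vecs (G * r). bad_mass (G * r) q' \<le> bad_mass (G * r) q - \<gamma>
         \<and> KL (G * r) q' \<le> KL (G * r) q + \<omega> \<and> (\<forall>j<G * r. q' j \<le> 2 * q j)"
proof -
  define \<epsilon> where "\<epsilon> = min (1 / 8) (b0 / 108)"
  have e: "0 < \<epsilon>" "\<epsilon> \<le> 1 / 8" "108 * \<epsilon> \<le> b0" using b0 by (auto simp: \<epsilon>_def)
  obtain G g0 :: nat where G: "0 < G" and g0: "exp ((C + 1) / \<epsilon>) \<le> g0"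
    and heavy: "\<And>r q. 0 < r \<Longrightarrow> q \<in> prob_vecs (G * r) \<Longrightarrow> KL (G * r) q \<le> C \<Longrightarrow>
       \<exists>g\<ge>g0. g < G \<and> \<epsilon> / G \<le> sum q (block r g) \<and> sum q {..<(g + 1) * r} \<le> 3 * \<epsilon>"
    using ex_heavy_block_over_light_prefix[OF e(1,2) C] by metis
  define \<kappa> where "\<kappa> = \<epsilon> / G"
  have k: "0 < \<kappa>" using e G by (simp add: \<kappa>_def)
  \<comment> \<open>the last term bounds the relative change of each entry, and with it the entropy cost\<close>
  define \<eta> where "\<eta> = min (min (1 / 10) (b0 / 39)) (\<kappa> * min 1 (\<omega> / (C + 4)))"
  have eta: "0 < \<eta>" "\<eta> \<le> 1 / 10" "\<eta> \<le> b0 / 39" "\<eta> \<le> \<kappa> * min 1 (\<omega> / (C + 4))"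
  proof -
    have "0 < min 1 (\<omega> / (C + 4))" using w C by simp
    then show "0 < \<eta>" unfolding \<eta>_def using k b0 by simp
    show "\<eta> \<le> 1 / 10" "\<eta> \<le> b0 / 39" "\<eta> \<le> \<kappa> * min 1 (\<omega> / (C + 4))"
      unfolding \<eta>_def by linarith+
  qed
  define \<rho> where "\<rho> = \<eta> / \<kappa>"
  have rho: "0 \<le> \<rho>" "\<rho> \<le> 1" "\<rho> * (C + 4) \<le> \<omega>"
  proof -
    show "0 \<le> \<rho>" using eta k by (simp add: \<rho>_def)
    have r: "\<rho> \<le> min 1 (\<omega> / (C + 4))" unfolding \<rho>_def pos_divide_le_eq[OF k] using eta(4) by (simp add: mult.commute)
    then show "\<rho> \<le> 1" by simp
    have "\<rho> \<le> \<omega> / (C + 4)" using r by simp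
    then show "\<rho> * (C + 4) \<le> \<omega>" using C by (simp add: field_simps)
  qed
  show ?thesis
  proof (rule that[of "4 * \<eta>\<^sup>2 * b0" G])
    show "0 < 4 * \<eta>\<^sup>2 * b0" using eta b0 by simp
    show "0 < G" by (rule G)
    fix r q assume r: "0 < r" and q: "q \<in> prob_vecs (G * r)" and K: "KL (G * r) q \<le> C" and bq: "b0 \<le> bad_mass (G * r) q"
    let ?N = "G * r"
    have N: "0 < ?N" using r G by simp
    obtain g where g: "g0 \<le> g" "g < G" "\<kappa> \<le> sum q (block r g)" "sum q {..<(g + 1) * r} \<le> 3 * \<epsilon>"
      using heavy[OF r q K] unfolding \<kappa>_def by blast
    define m where "m = sum q (block r g)"
    have m: "\<kappa> \<le> m" "0 < m" "m \<le> 1"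
      using g k prob_vecs_subset_le_1(1)[OF q block_subset[OF g(2)]] by (auto simp: m_def)
    define R where "R j = (if j \<in> block r g then q j / m else 0)" for j
    have R: "R \<in> prob_vecs ?N"
    proof -
      have "(\<Sum>j<?N. R j) = (\<Sum>j\<in>block r g. q j / m)" unfolding R_def
        by (rule sum.mono_neutral_cong_right) (use block_subset[OF g(2), of r] in auto)
      also have "\<dots> = 1" using m by (simp add: sum_divide_distrib[symmetric] m_def[symmetric])
      finally show ?thesis using prob_vecs_nonneg[OF q] m by (auto simp: prob_vecs_def R_def)
    qed
    have S: "sum q {d. d < ?N \<and> ?N * g < d * (g + 1)} \<le> 3 * \<epsilon>"
    proof -
      have "sum q {d. d < ?N \<and> ?N * g < d * (g + 1)} \<le> \<epsilon>"
      proof (rule mass_of_small_set[OF q K])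
        show "{d. d < ?N \<and> ?N * g < d * (g + 1)} \<subseteq> {..<?N}" by auto
        show "real (card {d. d < ?N \<and> ?N * g < d * (g + 1)}) \<le> 1 / real (g + 1) * real ?N"
          using card_upper_cells[OF N, of g] by simp
        have "exp ((C + 1) / \<epsilon>) \<le> real (g + 1)" using g0 g(1) by linarith
        then have "1 / real (g + 1) \<le> 1 / exp ((C + 1) / \<epsilon>)" by (intro divide_left_mono) auto
        then show "1 / real (g + 1) \<le> exp (- ((C + 1) / \<epsilon>))" by (simp add: exp_minus inverse_eq_divide)
      qed (use e in auto)
      then show ?thesis using e by simp
    qed
    have P: "sum q ({..<?N} \<inter> {..<(g + 1) * r}) \<le> 3 * \<epsilon>"
    proof -
      have "(g + 1) * r \<le> ?N" using g(2) by (intro mult_right_mono) auto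
      then have "{..<?N} \<inter> {..<(g + 1) * r} = {..<(g + 1) * r}" by auto
      then show ?thesis using g(4) by simp
    qed
    have supp: "{j. R j \<noteq> 0} \<subseteq> block r g" by (auto simp: R_def)
    note two = quad_two_in_block[OF q R supp S P]
    let ?Q = "quad ?N"
    define B0 where "B0 = bad_mass ?N q"
    define B1 where "B1 = 3 * (?Q R q q q + ?Q q R q q + ?Q q q R q + ?Q q q q R)"
    define B2 where "B2 = 3 * (?Q R R q q + ?Q R q R q + ?Q R q q R + ?Q q R R q + ?Q q R q R + ?Q q q R R)"
    define B3 where "B3 = 3 * (?Q q R R R + ?Q R q R R + ?Q R R q R + ?Q R R R q)"
    define B4 where "B4 = bad_mass ?N R"
    note le1 = quad_prob_vecs_le(2) and ge0 = quad_prob_vecs_le(1)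
    have B: "B0 \<le> 3" "0 \<le> B2" "B2 \<le> b0 / 2" "0 \<le> B3" "B3 \<le> 12" "0 \<le> B4" "B4 \<le> 3"
    proof -
      show "B0 \<le> 3" "0 \<le> B4" "B4 \<le> 3" unfolding B0_def B4_def bad_mass_def
        using le1[OF q q q q] le1[OF R R R R] ge0[OF R R R R] by auto
      show "0 \<le> B2" unfolding B2_def
        using ge0[OF R R q q] ge0[OF R q R q] ge0[OF R q q R] ge0[OF q R R q] ge0[OF q R q R] ge0[OF q q R R] by simp
      have "?Q R R q q + ?Q R q R q + ?Q R q q R + ?Q q R R q + ?Q q R q R + ?Q q q R R
          \<le> 3 * \<epsilon> + 3 * \<epsilon> + 3 * \<epsilon> + 3 * \<epsilon> + 3 * \<epsilon> + 3 * \<epsilon>" by (intro add_mono two)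
      then show "B2 \<le> b0 / 2" unfolding B2_def using e by simp
      show "0 \<le> B3" unfolding B3_def
        using ge0[OF q R R R] ge0[OF R q R R] ge0[OF R R q R] ge0[OF R R R q] by simp
      show "B3 \<le> 12" unfolding B3_def
        using le1[OF q R R R] le1[OF R q R R] le1[OF R R q R] le1[OF R R R q] by simp
    qed
    have mix: "bad_mass ?N (\<lambda>j. (1 - h) * q j + h * R j) =
      (1 - h) ^ 4 * B0 + (1 - h) ^ 3 * h * B1 + (1 - h)\<^sup>2 * h\<^sup>2 * B2 + (1 - h) * h ^ 3 * B3 + h ^ 4 * B4" for h
      unfolding bad_mass_mixture B0_def B1_def B2_def B3_def B4_def by simp
    \<comment> \<open>mass is moved towards the block or away from it, whichever decreases the bad mass\<close>
    obtain h where h: "\<bar>h\<bar> = \<eta>" "bad_mass ?N (\<lambda>j. (1 - h) * q j + h * R j) \<le> B0 - 4 * \<eta>\<^sup>2 * b0"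
    proof -
      have "b0 \<le> B0" using bq by (simp add: B0_def)
      then consider "bad_mass ?N (\<lambda>j. (1 - \<eta>) * q j + \<eta> * R j) \<le> B0 - 4 * \<eta>\<^sup>2 * b0"
        | "bad_mass ?N (\<lambda>j. (1 - (- \<eta>)) * q j + (- \<eta>) * R j) \<le> B0 - 4 * \<eta>\<^sup>2 * b0"
        using quartic_decrease[OF eta(1-3) b0 _ B, of B1] unfolding mix by blast
      then show ?thesis
      proof cases
        case 1 then show ?thesis using that[of \<eta>] eta by simp
      next
        case 2 then show ?thesis using that[of "- \<eta>"] eta by simp
      qed
    qed
    define t where "t j = 1 - h + h * (if j \<in> block r g then 1 / m else 0)" for j
    define q' where "q' j = q j * t j" for j
    have q'eq: "q' = (\<lambda>j. (1 - h) * q j + h * R j)"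
      by (rule ext) (simp add: q'_def t_def R_def algebra_simps)
    have t: "\<bar>t j - 1\<bar> \<le> \<rho>" for j
    proof -
      have im: "1 \<le> 1 / m" "1 / m \<le> 1 / \<kappa>" using m k by (auto simp: field_simps)
      have "t j - 1 = h * ((if j \<in> block r g then 1 / m else 0) - 1)" by (simp add: t_def algebra_simps)
      then have "\<bar>t j - 1\<bar> = \<eta> * \<bar>(if j \<in> block r g then 1 / m else 0) - 1\<bar>" by (simp add: abs_mult h)
      also have "\<dots> \<le> \<eta> * (1 / \<kappa>)" using im eta by (intro mult_left_mono) auto
      finally show ?thesis by (simp add: \<rho>_def)
    qed
    have t02: "0 \<le> t j" "t j \<le> 2" for j using t[of j] rho by linarith+
    have "q' \<in> prob_vecs ?N"
    proof -
      have "(\<Sum>j<?N. q' j) = 1" unfolding q'eq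
        by (simp add: sum.distrib sum_distrib_left[symmetric] prob_vecs_sum[OF q] prob_vecs_sum[OF R])
      then show ?thesis using prob_vecs_nonneg[OF q] t02 by (auto simp: prob_vecs_def q'_def)
    qed
    moreover have "bad_mass ?N q' \<le> bad_mass ?N q - 4 * \<eta>\<^sup>2 * b0" using h(2) unfolding q'eq B0_def .
    moreover have "KL ?N q' \<le> KL ?N q + \<omega>"
    proof -
      have "KL ?N q' \<le> KL ?N q + \<rho> * (KL ?N q + 4)" unfolding q'_def by (rule KL_tilt_le[OF q rho(1,2) t])
      also have "\<dots> \<le> KL ?N q + \<rho> * (C + 4)" using K rho by (intro add_left_mono mult_left_mono) auto
      finally show ?thesis using rho by linarith
    qed
    moreover have "\<forall>j<?N. q' j \<le> 2 * q j"
    proof (intro allI impI)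
      fix j assume "j < ?N"
      then have "q j * t j \<le> q j * 2" using t02 prob_vecs_nonneg[OF q] by (intro mult_left_mono) auto
      then show "q' j \<le> 2 * q j" by (simp add: q'_def)
    qed
    ultimately show "\<exists>q'\<in>prob_vecs ?N. bad_mass ?N q' \<le> bad_mass ?N q - 4 * \<eta>\<^sup>2 * b0
         \<and> KL ?N q' \<le> KL ?N q + \<omega> \<and> (\<forall>j<?N. q' j \<le> 2 * q j)" by blast
  qed
qed

section \<open>The projection of the kernel and its variance\<close>

text \<open>The function psi3 after the substitution u = 1 / s. At u = 0 the convention ln 0 = 0 gives the
continuous extension.\<close>

definition kernel_projection :: "real \<Rightarrow> real" where
  "kernel_projection u = 9 / 8 * u\<^sup>2 - 3 / 2 * (u * ln u) - u - 1 / 4"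

definition kernel_projection_int :: "real \<Rightarrow> real" where
  "kernel_projection_int u = 3 / 8 * u ^ 3 - 3 / 4 * (u * (u * ln u)) - u\<^sup>2 / 8 - u / 4"

text \<open>An antiderivative of the squared projection. Powers are arranged so that ln u occurs only in the product u * ln u,
which is continuous at 0.\<close>

definition kernel_projection_sq_int :: "real \<Rightarrow> real" where
  "kernel_projection_sq_int u = 81 / 320 * u ^ 5 - 45 / 128 * u ^ 4 - u ^ 3 / 48 + u\<^sup>2 / 16 + u / 16
     + (u * ln u) * (- 27 / 32 * u ^ 3 + u\<^sup>2 / 2 + 3 / 8 * u) + 3 / 4 * u * (u * ln u)\<^sup>2"

lemma kernel_projection_int_deriv: "0 < u \<Longrightarrow> (kernel_projection_int has_real_derivative kernel_projection u) (at u)"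
  unfolding kernel_projection_int_def kernel_projection_def
  apply (rule derivative_eq_intros refl | simp)+
  apply (simp add: power2_eq_square power3_eq_cube power4_eq_xxxx field_simps)
  done

lemma kernel_projection_sq_int_deriv: "0 < u \<Longrightarrow> (kernel_projection_sq_int has_real_derivative (kernel_projection u)\<^sup>2) (at u)"
  unfolding kernel_projection_sq_int_def kernel_projection_def
  apply (rule derivative_eq_intros refl | simp)+
  apply (simp add: power2_eq_square power3_eq_cube power4_eq_xxxx field_simps)
  done

lemma psi3_eq_kernel_projection: "0 < s \<Longrightarrow> psi3 s = kernel_projection (1 / s)"
  by (simp add: psi3_def kernel_projection_def ln_div power_divide field_simps)

text \<open>With F s = - W (1 / s), W the antiderivative of the squared projection, the integrand is F'. The integral is W 1 - W 0.\<close>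

lemma Delta3_sq_value: "Delta3_sq = 11 / 1920"
proof -
  let ?f = "\<lambda>s. (psi3 s)\<^sup>2 / s\<^sup>2"
  let ?F = "\<lambda>s. - kernel_projection_sq_int (1 / s)"
  have lim: "(?F \<longlongrightarrow> 0) at_top" unfolding kernel_projection_sq_int_def by real_asymp
  have F1: "?F 1 = - (11 / 1920)" by (simp add: kernel_projection_sq_int_def)
  have "(\<integral>\<^sup>+ x. ennreal (?f x) * indicator {1..} x \<partial>lborel) = ennreal (0 - ?F 1)"
  proof (rule nn_integral_FTC_atLeast[OF _ _ _ lim])
    show "?f \<in> borel_measurable borel" unfolding psi3_def by measurable
    fix x :: real assume x: "1 \<le> x"
    show "0 \<le> ?f x" by simp
    have "((\<lambda>s. 1 / s) has_real_derivative - (1 / x\<^sup>2)) (at x)"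
      using x by (auto intro!: derivative_eq_intros simp: power2_eq_square)
    then have "((\<lambda>s. kernel_projection_sq_int (1 / s)) has_real_derivative (kernel_projection (1 / x))\<^sup>2 * - (1 / x\<^sup>2)) (at x)"
      by (rule DERIV_chain2[rotated]) (use x in \<open>auto intro!: kernel_projection_sq_int_deriv\<close>)
    then have "(?F has_real_derivative - ((kernel_projection (1 / x))\<^sup>2 * - (1 / x\<^sup>2))) (at x)" by (rule DERIV_minus)
    then show "(?F has_real_derivative ?f x) (at x)" using x by (simp add: psi3_eq_kernel_projection)
  qed
  moreover have "(\<integral>\<^sup>+ x. ennreal (indicator {1..} x * ?f x) \<partial>lborel) = (\<integral>\<^sup>+ x. ennreal (?f x) * indicator {1..} x \<partial>lborel)"
    by (rule nn_integral_cong) (auto split: split_indicator)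
  ultimately have n: "(\<integral>\<^sup>+ x. ennreal (indicator {1..} x * ?f x) \<partial>lborel) = ennreal (11 / 1920)"
    unfolding F1 by simp
  have "has_bochner_integral lborel (\<lambda>x. indicator {1..} x * ?f x) (11 / 1920)"
    by (rule has_bochner_integral_nn_integral[OF _ _ _ n]) (auto simp: psi3_def)
  then show ?thesis
    unfolding Delta3_sq_def set_lebesgue_integral_def by (simp add: has_bochner_integral_integral_eq)
qed

lemma continuous_u_ln_u: "continuous_on {0..1} (\<lambda>u::real. u * ln u)"
  unfolding continuous_on_def
proof
  fix u :: real assume u: "u \<in> {0..1}"
  show "((\<lambda>u. u * ln u) \<longlongrightarrow> u * ln u) (at u within {0..1})"
  proof (cases "u = 0")
    case True
    have "((\<lambda>u::real. u * ln u) \<longlongrightarrow> 0) (at_right 0)" by real_asymp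
    then show ?thesis unfolding True by (simp add: at_within_Icc_at_right)
  next
    case False
    then have "isCont (\<lambda>u. u * ln u) u" using u by (intro continuous_intros) auto
    then show ?thesis unfolding isCont_def by (rule tendsto_within_subset) auto
  qed
qed

lemma continuous_kernel_projection: "continuous_on {0..1} kernel_projection"
  unfolding kernel_projection_def[abs_def] by (rule continuous_u_ln_u | rule continuous_intros | simp)+

lemma continuous_kernel_projection_int: "continuous_on {0..1} kernel_projection_int"
  unfolding kernel_projection_int_def[abs_def] by (rule continuous_u_ln_u | rule continuous_intros | simp)+

lemma continuous_kernel_projection_sq_int: "continuous_on {0..1} kernel_projection_sq_int"
  unfolding kernel_projection_sq_int_def[abs_def] by (rule continuous_u_ln_u | rule continuous_intros | simp)+

text \<open>By the mean value theorem each cell contributes g at some point of the cell to the telescoping sum of W.\<close>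

lemma left_Riemann_sums:
  fixes g W :: "real \<Rightarrow> real"
  assumes g: "continuous_on {0..1} g" and W: "continuous_on {0..1} W"
    and d: "\<And>u. 0 < u \<Longrightarrow> u < 1 \<Longrightarrow> (W has_real_derivative g u) (at u)"
  shows "(\<lambda>N::nat. (\<Sum>j<N. g (real j / real N)) / N) \<longlonglongrightarrow> W 1 - W 0"
proof (rule LIMSEQ_I)
  fix \<epsilon> :: real assume e: "0 < \<epsilon>"
  have "uniformly_continuous_on {0..1} g" by (rule compact_uniformly_continuous[OF g]) simp
  then obtain \<delta> where dl: "0 < \<delta>" and uc: "\<And>x y. x \<in> {0..1} \<Longrightarrow> y \<in> {0..1} \<Longrightarrow> dist y x < \<delta> \<Longrightarrow> dist (g y) (g x) < \<epsilon> / 2"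
    unfolding uniformly_continuous_on_def using e by (metis half_gt_zero)
  obtain N0 :: nat where N0: "1 / \<delta> < N0" using reals_Archimedean2 by blast
  show "\<exists>no. \<forall>N::nat\<ge>no. norm ((\<Sum>j<N. g (real j / real N)) / N - (W 1 - W 0)) < \<epsilon>"
  proof (rule exI[of _ "max N0 1"], intro allI impI)
    fix N :: nat assume "max N0 1 \<le> N"
    then have N: "0 < real N" "1 / \<delta> < N" using N0 by linarith+
    then have Nd: "1 / N < \<delta>" using dl by (simp add: field_simps)
    have cellwise: "\<bar>g (real j / real N) / N - (W ((real j + 1) / N) - W (real j / real N))\<bar> \<le> \<epsilon> / 2 / N" if j: "j < N" for j :: nat
    proof -
      let ?a = "real j / N" and ?b = "(real j + 1) / N"
      have ab: "?a < ?b" "0 \<le> ?a" "?b \<le> 1" using j N by (auto simp: divide_strict_right_mono)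
      have "\<exists>l z. ?a < z \<and> z < ?b \<and> DERIV W z :> l \<and> W ?b - W ?a = (?b - ?a) * l"
      proof (rule MVT[OF ab(1)])
        show "continuous_on {?a..?b} W" by (rule continuous_on_subset[OF W]) (use ab in auto)
        fix x assume "?a < x" "x < ?b"
        then show "W differentiable (at x)" using d[of x] ab by (auto simp: real_differentiable_def)
      qed
      then obtain m z where z: "?a < z" "z < ?b" "DERIV W z :> m" "W ?b - W ?a = (?b - ?a) * m" by auto
      have z01: "0 < z" "z < 1" using z ab by linarith+
      have m: "m = g z" by (rule DERIV_unique[OF z(3) d[OF z01]])
      have w: "?b - ?a = 1 / N" by (simp add: add_divide_distrib)
      have "dist (g ?a) (g z) < \<epsilon> / 2"
      proof (rule uc)
        show "z \<in> {0..1}" "?a \<in> {0..1}" using z01 ab by auto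
        have "\<bar>?a - z\<bar> < \<delta>" using z(1,2) w Nd by linarith
        then show "dist ?a z < \<delta>" by (simp add: dist_real_def)
      qed
      then have "\<bar>g ?a - g z\<bar> \<le> \<epsilon> / 2" by (simp add: dist_real_def)
      then have "\<bar>g ?a - g z\<bar> / N \<le> \<epsilon> / 2 / N" using N by (intro divide_right_mono) auto
      moreover have "g ?a / N - (W ?b - W ?a) = (g ?a - g z) / N"
        unfolding z(4) m w by (simp add: diff_divide_distrib)
      ultimately show ?thesis by (simp only: abs_divide abs_of_nat)
    qed
    have tel: "(\<Sum>j<N. W ((real j + 1) / N) - W (real j / real N)) = W 1 - W 0"
      using sum_lessThan_telescope[of "\<lambda>j. W (real j / N)" N] N by (simp add: add.commute)
    have eq: "(\<Sum>j<N. g (real j / real N)) / N - (W 1 - W 0) = (\<Sum>j<N. g (real j / real N) / N - (W ((real j + 1) / N) - W (real j / real N)))"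
      unfolding tel[symmetric] sum_subtractf[symmetric] sum_divide_distrib by simp
    have "\<bar>(\<Sum>j<N. g (real j / real N)) / N - (W 1 - W 0)\<bar> \<le> (\<Sum>j<N. \<bar>g (real j / real N) / N - (W ((real j + 1) / N) - W (real j / real N))\<bar>)"
      unfolding eq by (rule sum_abs)
    also have "\<dots> \<le> (\<Sum>j<N. \<epsilon> / 2 / N)" by (rule sum_mono) (use cellwise in auto)
    also have "\<dots> = \<epsilon> / 2" using N by simp
    finally show "norm ((\<Sum>j<N. g (real j / real N)) / N - (W 1 - W 0)) < \<epsilon>" using e by simp
  qed
qed

lemma mean_kernel_projection: "(\<lambda>N::nat. (\<Sum>j<N. kernel_projection (real j / real N)) / N) \<longlonglongrightarrow> 0"
  using left_Riemann_sums[OF continuous_kernel_projection continuous_kernel_projection_int kernel_projection_int_deriv] by (simp add: kernel_projection_int_def)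

lemma mean_kernel_projection_sq: "(\<lambda>N::nat. (\<Sum>j<N. (kernel_projection (real j / real N))\<^sup>2) / N) \<longlonglongrightarrow> 11 / 1920"
  using left_Riemann_sums[OF continuous_on_power[OF continuous_kernel_projection] continuous_kernel_projection_sq_int kernel_projection_sq_int_deriv]
  by (simp add: kernel_projection_sq_int_def)

lemma abs_u_ln_u_le:
  assumes "0 \<le> u" "u \<le> (1::real)" shows "\<bar>u * ln u\<bar> \<le> 1"
proof (cases "u = 0")
  case False
  then have u: "0 < u" using assms by simp
  have "ln (1 / u) \<le> 1 / u - 1" by (rule ln_le_minus_one) (use u in simp)
  then have "- ln u \<le> 1 / u" using u by (simp add: ln_div)
  then have "u * (- ln u) \<le> u * (1 / u)" using u by (intro mult_left_mono) auto
  moreover have "u * ln u \<le> 0" using u assms by (intro mult_nonneg_nonpos) auto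
  ultimately show ?thesis using u by simp
qed simp

lemma abs_kernel_projection_le: "0 \<le> u \<Longrightarrow> u \<le> 1 \<Longrightarrow> \<bar>kernel_projection u\<bar> \<le> 4"
proof -
  assume u: "0 \<le> u" "u \<le> 1"
  have "u\<^sup>2 \<le> 1" "0 \<le> u\<^sup>2" using u by (auto intro: power_le_one)
  then show ?thesis using abs_u_ln_u_le[OF u] u unfolding kernel_projection_def by linarith
qed

section \<open>Counting estimates for the discretised projection\<close>

text \<open>The number of a with a * N < t * d is t * d / N rounded up.\<close>

lemma count_first_argument:
  assumes N: "0 < N" and t: "t < N" "d < N" and bc: "min b c = t"
  shows "\<bar>(\<Sum>a<N. cell_kernel N a b c d) - real t * real d / N\<bar> \<le> 1"
proof -
  define m where "m = (t * d + N - 1) div N"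
  have iff: "a * N < t * d \<longleftrightarrow> a < m" for a
  proof -
    have "a < m \<longleftrightarrow> Suc a * N \<le> t * d + N - 1"
      unfolding m_def using less_eq_div_iff_mult_less_eq[OF N, of "Suc a" "t * d + N - 1"] by (simp add: Suc_le_eq)
    then show ?thesis using N by auto
  qed
  have mN: "a < N" if "a < m" for a
  proof -
    have "a * N < t * d" using that iff by simp
    also have "\<dots> \<le> N * N" using t by (intro mult_mono) auto
    finally show ?thesis by simp
  qed
  have "(\<Sum>a<N. cell_kernel N a b c d) = real (card {a. a < N \<and> a < m})"
    unfolding cell_kernel_def bc iff by (simp add: of_bool_def sum.If_cases Int_def)
  also have "{a. a < N \<and> a < m} = {..<m}" using mN by auto
  finally have s: "(\<Sum>a<N. cell_kernel N a b c d) = m" by simp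
  have "\<not> m * N < t * d" using iff[of m] by simp
  then have "real (t * d) \<le> real (m * N)" by (simp only: of_nat_le_iff not_less)
  then have 1: "real t * real d / N \<le> m" using N by (simp add: pos_divide_le_eq)
  have 2: "real m \<le> real t * real d / N + 1"
  proof (cases m)
    case (Suc k)
    then have "k * N < t * d" using iff by simp
    then have "real (k * N) < real (t * d)" by (simp only: of_nat_less_iff)
    then have "real k < real t * real d / N" using N by (simp add: pos_less_divide_eq)
    then show ?thesis using Suc by simp
  qed simp
  show ?thesis using 1 2 s by linarith
qed

lemma count_last_argument:
  fixes j t :: nat
  assumes N: "0 < N" and t: "t < N" "min b c = t"
  shows "\<bar>(\<Sum>d<N. cell_kernel N j b c d) - (if j < t then N - real j * N / t else 0)\<bar> \<le> 1"
proof (cases "j < t")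
  case False
  have "cell_kernel N j b c d = 0" if "d < N" for d
  proof -
    have "t * d \<le> j * N" using False that by (intro mult_mono) auto
    then show ?thesis by (simp add: cell_kernel_def t(2))
  qed
  then show ?thesis using False by simp
next
  case True
  define y where "y = j * N div t"
  have t0: "0 < t" using True by simp
  have y: "y * t \<le> j * N" "j * N < (y + 1) * t"
    unfolding y_def using div_times_less_eq_dividend[of "j * N" t] dividend_less_div_times[OF t0, of "j * N"]
    by (simp_all add: algebra_simps)
  have iff: "j * N < t * d \<longleftrightarrow> y < d" for d
  proof
    assume "j * N < t * d"
    with y(1) have "y * t < t * d" by (rule le_less_trans)
    then have "y * t < d * t" by (simp only: mult.commute[of t d])
    then show "y < d" by (simp only: mult_less_cancel2)
  next
    assume "y < d"
    then have "(y + 1) * t \<le> d * t" by (intro mult_right_mono) auto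
    then show "j * N < t * d" using y by (simp add: mult.commute)
  qed
  have yN: "y < N"
  proof -
    have "j * N < t * N" using True N by simp
    then show ?thesis by (simp only: iff)
  qed
  have "(\<Sum>d<N. cell_kernel N j b c d) = real (card {d. d < N \<and> y < d})"
    unfolding cell_kernel_def t(2) iff by (simp add: of_bool_def sum.If_cases Int_def)
  also have "{d. d < N \<and> y < d} = {y<..<N}" by auto
  finally have s: "(\<Sum>d<N. cell_kernel N j b c d) = real N - 1 - y" using yN by simp
  have "real (y * t) \<le> real (j * N)" using y(1) by (simp only: of_nat_le_iff)
  then have 1: "real y \<le> real j * N / t" using t0 by (simp add: pos_le_divide_eq)
  have "real (j * N) < real ((y + 1) * t)" using y(2) by (simp only: of_nat_less_iff)
  then have 2: "real j * N / t < real y + 1" using t0 by (simp add: pos_divide_less_eq algebra_simps)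
  show ?thesis using True s 1 2 by simp
qed

text \<open>The minimum of two indices below N equals t for 2 (N - t) - 1 pairs.\<close>

lemma sum_min_pairs:
  fixes f :: "nat \<Rightarrow> real"
  shows "(\<Sum>b<N. \<Sum>c<N. f (min b c)) = (\<Sum>t<N. (2 * (real N - t) - 1) * f t)"
proof (induction N)
  case (Suc N)
  have "(\<Sum>b<Suc N. \<Sum>c<Suc N. f (min b c)) = (\<Sum>b<N. \<Sum>c<N. f (min b c)) + 2 * (\<Sum>b<N. f b) + f N"
  proof -
    have 1: "(\<Sum>b<N. f (min b N)) = (\<Sum>b<N. f b)" by (rule sum.cong) auto
    have 2: "(\<Sum>c<N. f (min N c)) = (\<Sum>b<N. f b)" by (rule sum.cong) auto
    show ?thesis by (simp add: sum.distrib 1 2)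
  qed
  also have "\<dots> = (\<Sum>t<N. (2 * (real N - t) - 1) * f t + 2 * f t) + f N"
    unfolding Suc by (simp add: sum.distrib sum_distrib_left)
  also have "\<dots> = (\<Sum>t<Suc N. (2 * (real (Suc N) - t) - 1) * f t)"
    by (simp add: algebra_simps)
  finally show ?case .
qed simp

lemma harmonic_segment_bounds:
  assumes j: "0 < j" and m: "j \<le> m"
  shows "ln ((real m + 1) / (real j + 1)) \<le> (\<Sum>t\<in>{j<..m}. 1 / real t) \<and> (\<Sum>t\<in>{j<..m}. 1 / real t) \<le> ln (real m / j)"
  using m
proof (induction m rule: dec_induct)
  case base
  then show ?case using j by simp
next
  case (step m)
  have mp: "0 < real m" using step j by simp
  have e: "{j<..Suc m} = insert (Suc m) {j<..m}" using step by auto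
  have s: "(\<Sum>t\<in>{j<..Suc m}. 1 / real t) = (\<Sum>t\<in>{j<..m}. 1 / real t) + 1 / (real m + 1)"
    unfolding e by (simp add: add.commute)
  have "ln ((real m + 2) / (real m + 1)) \<le> (real m + 2) / (real m + 1) - 1" by (rule ln_le_minus_one) simp
  also have "\<dots> = 1 / (real m + 1)" by (simp add: field_simps)
  finally have "ln (real m + 2) - ln (real m + 1) \<le> 1 / (real m + 1)" by (simp add: ln_div)
  moreover have "ln (real m / (real m + 1)) \<le> real m / (real m + 1) - 1" by (rule ln_le_minus_one) (use mp in simp)
  then have "ln (real m) - ln (real m + 1) \<le> - (1 / (real m + 1))" using mp by (simp add: ln_div field_simps)
  ultimately show ?case using step.IH j mp unfolding s by (simp add: ln_div add.commute)
qed

text \<open>The error of replacing the harmonic sum by a logarithm is of order 1 / j, and the factor j compensates it even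
for small j. This is where the term u ln u of the projection comes from.\<close>

lemma harmonic_tail_bounds:
  assumes j: "j < N"
  shows "\<bar>real j * (\<Sum>t\<in>{j<..<N}. 1 / real t) - real j * ln (N / j)\<bar> \<le> 1"
proof (cases "j = 0")
  case False
  then have j0: "0 < j" by simp
  obtain m where m: "N = Suc m" "j \<le> m" using j by (cases N) auto
  have e: "{j<..<Suc m} = {j<..m}" by auto
  let ?S = "\<Sum>t\<in>{j<..<N}. 1 / real t"
  have b: "ln (N / (real j + 1)) \<le> ?S" "?S \<le> ln (real m / j)"
    using harmonic_segment_bounds[OF j0 m(2)] unfolding m(1) e by (simp_all add: add.commute)
  have "ln (real m / j) \<le> ln (N / j)" using j0 m by (simp add: divide_right_mono)
  then have u: "real j * ?S \<le> real j * ln (N / j)" using b by (intro mult_left_mono) auto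
  have "ln ((real j + 1) / j) \<le> (real j + 1) / j - 1" by (rule ln_le_minus_one) (use j0 in simp)
  then have "real j * ln ((real j + 1) / j) \<le> real j * (1 / j)"
    using j0 by (intro mult_left_mono) (auto simp: field_simps)
  then have "real j * ln ((real j + 1) / j) \<le> 1" using j0 by simp
  moreover have "ln (N / j) - ln ((real j + 1) / j) = ln (N / (real j + 1))" using j0 j by (simp add: ln_div)
  then have "real j * ln (N / j) - real j * ln ((real j + 1) / j) = real j * ln (N / (real j + 1))"
    by (simp only: right_diff_distrib[symmetric])
  moreover have "real j * ln (N / (real j + 1)) \<le> real j * ?S" using b by (intro mult_left_mono) auto
  ultimately show ?thesis using u by linarith
qed simp

lemma sum_arithmetic_tail:
  fixes A :: real
  assumes "j < n"
  shows "(\<Sum>t\<in>{j<..<n}. A - 2 * real t) = A * (real n - 1 - j) - (real n - 1) * n + real j * (real j + 1)"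
proof -
  have "Suc j \<le> n" using assms by simp
  then show ?thesis
  proof (induction n rule: dec_induct)
    case base
    have "{j<..<Suc j} = {}" by auto
    then show ?case by (simp add: algebra_simps)
  next
    case (step n)
    have "{j<..<Suc n} = insert n {j<..<n}" using step by auto
    then show ?case using step.IH by (simp add: algebra_simps)
  qed
qed

text \<open>For uniform B, C, D the probability of u < min B C * D is 1 - u^2 + 2 u ln u. The double sum over b and c is
reduced to the minimum t, and the remaining sum over t > j splits into an arithmetic and a harmonic part.\<close>

lemma first_argument_average:
  assumes j: "j < N"
  defines "u \<equiv> real j / N"
  shows "\<bar>(\<Sum>b<N. \<Sum>c<N. \<Sum>d<N. cell_kernel N j b c d) / real N ^ 3 - (1 - u\<^sup>2 + 2 * (u * ln u))\<bar> \<le> 7 / N"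
proof -
  have N: "0 < N" "0 < real N" "1 \<le> real N" using j by auto
  define f where "f t = (if j < t then N - real j * N / t else 0)" for t :: nat
  define S where "S = (\<Sum>t\<in>{j<..<N}. (2 * (real N - t) - 1) * (1 - real j / t))"
  let ?K = "\<Sum>b<N. \<Sum>c<N. \<Sum>d<N. cell_kernel N j b c d"
  have e1: "\<bar>?K - (\<Sum>b<N. \<Sum>c<N. f (min b c))\<bar> \<le> real N ^ 2"
  proof -
    have "\<bar>?K - (\<Sum>b<N. \<Sum>c<N. f (min b c))\<bar> \<le> (\<Sum>b<N. \<Sum>c<N. \<bar>(\<Sum>d<N. cell_kernel N j b c d) - f (min b c)\<bar>)"
      unfolding sum_subtractf[symmetric] by (intro order_trans[OF sum_abs] sum_mono order_refl)
    also have "\<dots> \<le> (\<Sum>b<N. \<Sum>c<N. 1)"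
      unfolding f_def by (intro sum_mono count_last_argument[OF N(1)]) auto
    finally show ?thesis by (simp add: power2_eq_square)
  qed
  have e2: "(\<Sum>b<N. \<Sum>c<N. f (min b c)) = N * S"
  proof -
    have "(\<Sum>b<N. \<Sum>c<N. f (min b c)) = (\<Sum>t<N. (2 * (real N - t) - 1) * f t)" by (rule sum_min_pairs)
    also have "\<dots> = (\<Sum>t\<in>{j<..<N}. (2 * (real N - t) - 1) * (N * (1 - real j / t)))"
      by (rule sum.mono_neutral_cong_right) (auto simp: f_def right_diff_distrib)
    finally show ?thesis by (simp add: S_def sum_distrib_left mult_ac)
  qed
  let ?H = "\<Sum>t\<in>{j<..<N}. 1 / real t"
  have e3: "S = real N ^ 2 - real j ^ 2 - 2 * N + 1 - (2 * real N - 1) * (real j * ?H)"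
  proof -
    have "S = (\<Sum>t\<in>{j<..<N}. (2 * real N + 2 * j - 1 - 2 * real t) - (2 * real N - 1) * (real j * (1 / real t)))"
      unfolding S_def by (rule sum.cong) (auto simp: field_simps)
    also have "\<dots> = (\<Sum>t\<in>{j<..<N}. 2 * real N + 2 * j - 1 - 2 * real t) - (2 * real N - 1) * (real j * ?H)"
      by (simp add: sum_subtractf sum_distrib_left)
    finally show ?thesis unfolding sum_arithmetic_tail[OF j] by (simp add: algebra_simps power2_eq_square)
  qed
  have uln: "u * ln u * N = - (real j * ln (N / j))"
    unfolding u_def using N by (cases "j = 0") (auto simp: ln_div algebra_simps)
  have u01: "0 \<le> u" "u \<le> 1" using j by (auto simp: u_def)
  have L: "\<bar>real j * ln (N / j)\<bar> \<le> N"
  proof -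
    have "\<bar>u * ln u\<bar> * N \<le> 1 * real N" using abs_u_ln_u_le[OF u01] by (intro mult_right_mono) auto
    moreover have "\<bar>u * ln u * N\<bar> = \<bar>u * ln u\<bar> * N" by (simp add: abs_mult)
    ultimately show ?thesis unfolding uln by simp
  qed
  define e where "e = real j * ?H - real j * ln (N / j)"
  have ee: "\<bar>e\<bar> \<le> 1" unfolding e_def by (rule harmonic_tail_bounds[OF j])
  define T where "T = 1 - u\<^sup>2 + 2 * (u * ln u)"
  have TN: "T * real N ^ 2 = real N ^ 2 - real j ^ 2 - 2 * N * (real j * ln (N / j))"
  proof -
    have "T * real N ^ 2 = real N ^ 2 - (u * N)\<^sup>2 + 2 * N * (u * ln u * N)"
      by (simp add: T_def algebra_simps power2_eq_square)
    then show ?thesis unfolding uln using N by (simp add: u_def)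
  qed
  have d: "S - T * real N ^ 2 = 1 - 2 * real N + real j * ln (N / j) - (2 * real N - 1) * e"
    unfolding e3 TN e_def by (simp add: algebra_simps)
  have "\<bar>(2 * real N - 1) * e\<bar> \<le> (2 * real N - 1) * 1"
    unfolding abs_mult using ee N by (intro mult_mono) auto
  then have E: "\<bar>(2 * real N - 1) * e\<bar> \<le> 2 * real N - 1" by simp
  have "\<bar>1 - 2 * n + x - y\<bar> \<le> 6 * n" if "\<bar>y\<bar> \<le> 2 * n - 1" "\<bar>x\<bar> \<le> n" "1 \<le> n" for n x y :: real
    using that by linarith
  from this[OF E L N(3)] have e4: "\<bar>S - T * real N ^ 2\<bar> \<le> 6 * real N" unfolding d .
  have "\<bar>?K - T * real N ^ 3\<bar> \<le> 7 * real N ^ 2"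
  proof -
    have "?K - T * real N ^ 3 = (?K - N * S) + N * (S - T * real N ^ 2)"
      by (simp add: algebra_simps power2_eq_square power3_eq_cube)
    moreover have "\<bar>N * (S - T * real N ^ 2)\<bar> \<le> real N * (6 * real N)" unfolding abs_mult using e4 by (intro mult_mono) auto
    ultimately show ?thesis using e1 unfolding e2 by (simp add: power2_eq_square)
  qed
  then have "\<bar>?K - T * real N ^ 3\<bar> / real N ^ 3 \<le> 7 * real N ^ 2 / real N ^ 3" by (intro divide_right_mono) auto
  also have "\<dots> = 7 / N" using N by (simp add: power2_eq_square power3_eq_cube)
  also have "\<bar>?K - T * real N ^ 3\<bar> / real N ^ 3 = \<bar>?K / real N ^ 3 - T\<bar>"
  proof -
    have "?K / real N ^ 3 - T = (?K - T * real N ^ 3) / real N ^ 3" using N by (simp add: diff_divide_distrib)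
    then show ?thesis by (simp add: abs_divide)
  qed
  finally show ?thesis unfolding T_def .
qed

text \<open>Rounding errors of at most 1 in each of N^2 terms disappear after division by N^3.\<close>

lemma average_of_rounded_products:
  fixes t :: "nat \<Rightarrow> nat \<Rightarrow> nat" and d' :: "nat \<Rightarrow> nat \<Rightarrow> nat"
  assumes N: "0 < N" and t: "\<And>c d. c < N \<Longrightarrow> d < N \<Longrightarrow> t c d < N \<and> d' c d < N"
    and K: "\<And>c d. c < N \<Longrightarrow> d < N \<Longrightarrow> \<bar>K c d - real (t c d) * real (d' c d) / N\<bar> \<le> (1::real)"
    and V: "\<bar>(\<Sum>c<N. \<Sum>d<N. real (t c d) * real (d' c d)) / real N ^ 4 - v\<bar> \<le> 1 / N"
  shows "\<bar>(\<Sum>c<N. \<Sum>d<N. K c d) / real N ^ 3 - v\<bar> \<le> 2 / N"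
proof -
  let ?V = "\<Sum>c<N. \<Sum>d<N. real (t c d) * real (d' c d)"
  have "\<bar>(\<Sum>c<N. \<Sum>d<N. K c d) - ?V / N\<bar> \<le> (\<Sum>c<N. \<Sum>d<N. \<bar>K c d - real (t c d) * real (d' c d) / N\<bar>)"
    unfolding sum_divide_distrib sum_subtractf[symmetric] by (intro order_trans[OF sum_abs] sum_mono order_refl)
  also have "\<dots> \<le> (\<Sum>c<N. \<Sum>d<N. 1)" by (intro sum_mono K) auto
  finally have "\<bar>(\<Sum>c<N. \<Sum>d<N. K c d) - ?V / N\<bar> \<le> real N ^ 2" by (simp add: power2_eq_square)
  then have "\<bar>(\<Sum>c<N. \<Sum>d<N. K c d) - ?V / N\<bar> / real N ^ 3 \<le> real N ^ 2 / real N ^ 3" by (intro divide_right_mono) auto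
  moreover have "real N ^ 2 / real N ^ 3 = 1 / N" using N by (simp add: power2_eq_square power3_eq_cube)
  moreover have "\<bar>(\<Sum>c<N. \<Sum>d<N. K c d) - ?V / N\<bar> / real N ^ 3 = \<bar>(\<Sum>c<N. \<Sum>d<N. K c d) / real N ^ 3 - ?V / real N ^ 4\<bar>"
  proof -
    have "(\<Sum>c<N. \<Sum>d<N. K c d) / real N ^ 3 - ?V / real N ^ 4 = ((\<Sum>c<N. \<Sum>d<N. K c d) - ?V / N) / real N ^ 3"
      by (simp add: diff_divide_distrib power3_eq_cube power4_eq_xxxx mult_ac)
    then show ?thesis by (simp add: abs_divide)
  qed
  moreover have "2 / real N = 1 / N + 1 / N" by simp
  ultimately show ?thesis using V by linarith
qed

lemma sum_min_fixed:
  assumes "j \<le> n" shows "(\<Sum>c<n. real (min j c)) = real j * n - real j * (real j + 1) / 2"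
  using assms
proof (induction n rule: dec_induct)
  case base
  have "(\<Sum>c<j. real (min j c)) = (\<Sum>c<j. real c)" by (rule sum.cong) auto
  also have "\<dots> = real j * (real j - 1) / 2" by (induction j) (auto simp: field_simps)
  finally show ?case by (simp add: field_simps)
next
  case (step n)
  then show ?case by (simp add: algebra_simps)
qed

lemma sum_real_lessThan: "(\<Sum>c<n. real c) = real n * (real n - 1) / 2"
  by (induction n) (auto simp: field_simps)

lemma sum_min_all: "(\<Sum>b<n. \<Sum>c<n. real (min b c)) = real n * (real n - 1) * (2 * real n - 1) / 6"
proof (induction n)
  case (Suc n)
  have 1: "(\<Sum>b<n. real (min b n)) = (\<Sum>b<n. real b)" by (rule sum.cong) auto
  have 2: "(\<Sum>c<n. real (min n c)) = (\<Sum>b<n. real b)" by (rule sum.cong) auto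
  have "(\<Sum>b<Suc n. \<Sum>c<Suc n. real (min b c)) = (\<Sum>b<n. \<Sum>c<n. real (min b c)) + 2 * (\<Sum>b<n. real b) + n"
    by (simp only: sum.lessThan_Suc sum.distrib 1 2 min.idem)
  then show ?case unfolding Suc sum_real_lessThan by (simp add: field_simps)
qed simp

text \<open>For uniform A, C, D the probability of A < min u C * D is the mean of min u C * D, which is (u - u^2/2) / 2.\<close>

lemma middle_argument_average:
  assumes j: "j < N"
  defines "u \<equiv> real j / N"
  shows "\<bar>(\<Sum>c<N. \<Sum>d<N. \<Sum>a<N. cell_kernel N a j c d) / real N ^ 3 - (u - u\<^sup>2 / 2) / 2\<bar> \<le> 2 / N"
proof (rule average_of_rounded_products[where t = "\<lambda>c d. min j c" and d' = "\<lambda>c d. d"])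
  have N: "0 < N" "0 < real N" "1 \<le> real N" using j by auto
  show "0 < N" by (rule N)
  show "min j c < N \<and> d < N" if "c < N" "d < N" for c d using that by auto
  show "\<bar>(\<Sum>a<N. cell_kernel N a j c d) - real (min j c) * real d / N\<bar> \<le> 1" if "c < N" "d < N" for c d
    by (rule count_first_argument[OF N(1)]) (use that j in auto)
  have u01: "0 \<le> u" "u \<le> 1" using j by (auto simp: u_def)
  have jN: "real j = u * N" using N by (simp add: u_def)
  have "(\<Sum>c<N. \<Sum>d<N. real (min j c) * real d) = (real j * N - real j * (real j + 1) / 2) * (real N * (real N - 1) / 2)"
    unfolding sum_distrib_left[symmetric] sum_distrib_right[symmetric] sum_real_lessThan
    using j by (subst sum_min_fixed) auto
  also have "\<dots> / real N ^ 4 = (u - u\<^sup>2 / 2 - u / (2 * N)) * (1 - 1 / N) / 2"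
    unfolding jN using N by (simp add: field_simps power2_eq_square power4_eq_xxxx)
  finally have e: "(\<Sum>c<N. \<Sum>d<N. real (min j c) * real d) / real N ^ 4 = (u - u\<^sup>2 / 2 - u / (2 * N)) * (1 - 1 / N) / 2" by simp
  define i where "i = 1 / real N"
  have i: "0 \<le> i" "i \<le> 1" using N by (auto simp: i_def)
  have d: "(u - u\<^sup>2 / 2 - u / (2 * N)) * (1 - 1 / N) / 2 - (u - u\<^sup>2 / 2) / 2
     = - (i * ((u - u\<^sup>2 / 2) / 2 + (u * (1 - i)) / 4))"
    unfolding i_def using N by (simp add: field_simps power2_eq_square)
  have "u\<^sup>2 \<le> u" using u01 by (simp add: power2_eq_square mult_left_le_one_le)
  moreover have "0 \<le> (u - v / 2) / 2 \<and> (u - v / 2) / 2 \<le> 1 / 2" if "0 \<le> v" "v \<le> u" for v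
    using that u01 by simp
  ultimately have "0 \<le> (u - u\<^sup>2 / 2) / 2" "(u - u\<^sup>2 / 2) / 2 \<le> 1 / 2" by (meson zero_le_power2)+
  moreover have "0 \<le> u * (1 - i)" "u * (1 - i) \<le> 1" using u01 i mult_mono[of u 1 "1 - i" 1] by simp_all
  ultimately have "0 \<le> (u - u\<^sup>2 / 2) / 2 + (u * (1 - i)) / 4" "(u - u\<^sup>2 / 2) / 2 + (u * (1 - i)) / 4 \<le> 1" by linarith+
  then have "\<bar>i * ((u - u\<^sup>2 / 2) / 2 + (u * (1 - i)) / 4)\<bar> \<le> i * 1" unfolding abs_mult using i by (intro mult_mono) auto
  then show "\<bar>(\<Sum>c<N. \<Sum>d<N. real (min j c) * real d) / real N ^ 4 - (u - u\<^sup>2 / 2) / 2\<bar> \<le> 1 / N"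
    unfolding e d by (simp add: i_def)
qed

text \<open>For uniform A, B, C the probability of A < min B C * u is u / 3.\<close>

lemma last_argument_average:
  assumes j: "j < N"
  defines "u \<equiv> real j / N"
  shows "\<bar>(\<Sum>b<N. \<Sum>c<N. \<Sum>a<N. cell_kernel N a b c j) / real N ^ 3 - u / 3\<bar> \<le> 2 / N"
proof (rule average_of_rounded_products[where t = "\<lambda>b c. min b c" and d' = "\<lambda>b c. j"])
  have N: "0 < N" "0 < real N" "1 \<le> real N" using j by auto
  show "0 < N" by (rule N)
  show "min b c < N \<and> j < N" if "b < N" "c < N" for b c using that j by auto
  show "\<bar>(\<Sum>a<N. cell_kernel N a b c j) - real (min b c) * real j / N\<bar> \<le> 1" if "b < N" "c < N" for b c
    by (rule count_first_argument[OF N(1)]) (use that j in auto)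
  have u01: "0 \<le> u" "u \<le> 1" using j by (auto simp: u_def)
  have jN: "real j = u * N" using N by (simp add: u_def)
  have v: "(\<Sum>b<N. \<Sum>c<N. real (min b c) * real j) = real N * (real N - 1) * (2 * real N - 1) / 6 * real j"
    unfolding sum_distrib_right[symmetric] sum_min_all by simp
  have e: "(\<Sum>b<N. \<Sum>c<N. real (min b c) * real j) / real N ^ 4 - u / 3 = - (1 / N * (u * (3 - 1 / N) / 6))"
    unfolding v unfolding jN using N by (simp add: field_simps power4_eq_xxxx)
  have "0 \<le> 1 / real N" "1 / real N \<le> 1" using N by auto
  then have "0 \<le> u * (3 - 1 / N)" "u * (3 - 1 / N) \<le> 3"
    using u01 mult_mono[of u 1 "3 - 1 / N" 3] by simp_all
  then have "\<bar>1 / N * (u * (3 - 1 / N) / 6)\<bar> \<le> 1 / N * 1" unfolding abs_mult by (intro mult_mono) auto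
  then show "\<bar>(\<Sum>b<N. \<Sum>c<N. real (min b c) * real j) / real N ^ 4 - u / 3\<bar> \<le> 1 / N" unfolding e by simp
qed

section \<open>Entropy bounds near the uniform vector and near the maximum\<close>

text \<open>The sum of the four first order projections of the kernel, times 3; the two middle arguments have the same one.\<close>

definition cell_projection :: "nat \<Rightarrow> nat \<Rightarrow> real" where
  "cell_projection N j = 3 * ((\<Sum>b<N. \<Sum>c<N. \<Sum>d<N. cell_kernel N j b c d)
     + 2 * (\<Sum>c<N. \<Sum>d<N. \<Sum>a<N. cell_kernel N a j c d)
     + (\<Sum>b<N. \<Sum>c<N. \<Sum>a<N. cell_kernel N a b c j)) / real N ^ 3"

text \<open>The limits of the three averages, with their weights, add up to 2 - 4 \<psi>(u).\<close>

lemma cell_projection_approx: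
  assumes j: "j < N"
  shows "\<bar>cell_projection N j - (2 - 4 * kernel_projection (real j / N))\<bar> \<le> 39 / N"
proof -
  define u where "u = real j / N"
  define A where "A = (\<Sum>b<N. \<Sum>c<N. \<Sum>d<N. cell_kernel N j b c d) / real N ^ 3"
  define B where "B = (\<Sum>c<N. \<Sum>d<N. \<Sum>a<N. cell_kernel N a j c d) / real N ^ 3"
  define D where "D = (\<Sum>b<N. \<Sum>c<N. \<Sum>a<N. cell_kernel N a b c j) / real N ^ 3"
  have l: "cell_projection N j = 3 * (A + 2 * B + D)"
    unfolding cell_projection_def A_def B_def D_def by (simp add: add_divide_distrib)
  have p: "2 - 4 * kernel_projection u = 3 * ((1 - u\<^sup>2 + 2 * (u * ln u)) + 2 * ((u - u\<^sup>2 / 2) / 2) + u / 3)"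
    by (simp add: kernel_projection_def field_simps)
  have a: "\<bar>A - (1 - u\<^sup>2 + 2 * (u * ln u))\<bar> \<le> 7 / N" unfolding A_def u_def by (rule first_argument_average[OF j])
  have b: "\<bar>B - (u - u\<^sup>2 / 2) / 2\<bar> \<le> 2 / N" unfolding B_def u_def by (rule middle_argument_average[OF j])
  have d: "\<bar>D - u / 3\<bar> \<le> 2 / N" unfolding D_def u_def by (rule last_argument_average[OF j])
  have gen: "\<bar>3 * (x + 2 * y + z) - 3 * (x' + 2 * y' + z')\<bar> \<le> 39 * i"
    if "\<bar>x - x'\<bar> \<le> 7 * i" "\<bar>y - y'\<bar> \<le> 2 * i" "\<bar>z - z'\<bar> \<le> 2 * i" for x y z x' y' z' i :: real
    using that by (auto simp: abs_le_iff)
  have "\<bar>3 * (A + 2 * B + D) - 3 * ((1 - u\<^sup>2 + 2 * (u * ln u)) + 2 * ((u - u\<^sup>2 / 2) / 2) + u / 3)\<bar> \<le> 39 * (1 / N)"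
    by (rule gen) (use a b d in simp_all)
  then show ?thesis unfolding u_def[symmetric] l p by (simp only: times_divide_eq_right mult_1_right)
qed

text \<open>The part of the bad mass that is linear in a perturbation of the uniform vector.\<close>

lemma first_order_terms:
  fixes \<mu> :: "nat \<Rightarrow> real" and N :: nat
  defines "p \<equiv> \<lambda>_::nat. 1 / real N"
  shows "3 * (quad N \<mu> p p p + quad N p \<mu> p p + quad N p p \<mu> p + quad N p p p \<mu>) = (\<Sum>j<N. \<mu> j * cell_projection N j)"
proof -
  let ?k = "cell_kernel N"
  have 1: "quad N \<mu> p p p = (\<Sum>j<N. \<mu> j * ((\<Sum>b<N. \<Sum>c<N. \<Sum>d<N. ?k j b c d) / real N ^ 3))"
    unfolding quad_def p_def by (simp add: sum_distrib_left sum_divide_distrib power3_eq_cube mult_ac)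
  have 2: "quad N p \<mu> p p = (\<Sum>j<N. \<mu> j * ((\<Sum>c<N. \<Sum>d<N. \<Sum>a<N. ?k a j c d) / real N ^ 3))"
  proof -
    have "quad N p \<mu> p p = (\<Sum>b<N. \<Sum>c<N. \<Sum>d<N. \<Sum>a<N. p a * \<mu> b * p c * p d * ?k a b c d)"
      unfolding quad_def
      by (subst sum.swap, rule sum.cong[OF refl], subst sum.swap, rule sum.cong[OF refl], rule sum.swap)
    then show ?thesis unfolding p_def by (simp add: sum_distrib_left sum_divide_distrib power3_eq_cube mult_ac)
  qed
  have 3: "quad N p p \<mu> p = quad N p \<mu> p p"
  proof -
    have "quad N p p \<mu> p = (\<Sum>a<N. \<Sum>c<N. \<Sum>b<N. \<Sum>d<N. p a * p b * \<mu> c * p d * ?k a b c d)"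
      unfolding quad_def by (rule sum.cong[OF refl], rule sum.swap)
    also have "\<dots> = quad N p \<mu> p p" unfolding quad_def
      by (intro sum.cong refl) (simp add: cell_kernel_def min.commute mult_ac)
    finally show ?thesis .
  qed
  have 4: "quad N p p p \<mu> = (\<Sum>j<N. \<mu> j * ((\<Sum>b<N. \<Sum>c<N. \<Sum>a<N. ?k a b c j) / real N ^ 3))"
  proof -
    have "quad N p p p \<mu> = (\<Sum>b<N. \<Sum>c<N. \<Sum>d<N. \<Sum>a<N. p a * p b * p c * \<mu> d * ?k a b c d)"
      unfolding quad_def
      by (subst sum.swap, rule sum.cong[OF refl], subst sum.swap, rule sum.cong[OF refl], rule sum.swap)
    also have "\<dots> = (\<Sum>d<N. \<Sum>b<N. \<Sum>c<N. \<Sum>a<N. p a * p b * p c * \<mu> d * ?k a b c d)"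
      by (subst (2) sum.swap, rule sum.cong[OF refl], rule sum.swap)
    finally show ?thesis unfolding p_def by (simp add: sum_distrib_left sum_divide_distrib power3_eq_cube mult_ac)
  qed
  have "3 * ((\<Sum>j<N. \<mu> j * (A j / n)) + (\<Sum>j<N. \<mu> j * (B j / n)) + (\<Sum>j<N. \<mu> j * (B j / n)) + (\<Sum>j<N. \<mu> j * (D j / n)))
      = (\<Sum>j<N. \<mu> j * (3 * (A j + 2 * B j + D j) / n))" for A B D :: "nat \<Rightarrow> real" and n
    by (simp add: sum.distrib sum_distrib_left add_divide_distrib algebra_simps)
  then show ?thesis unfolding 3 unfolding 1 2 4 cell_projection_def .
qed

lemma uniform_prob_vecs: "0 < N \<Longrightarrow> (\<lambda>_. 1 / real N) \<in> prob_vecs N"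
  by (simp add: prob_vecs_def)

lemma average_cell_projection:
  assumes q: "q \<in> prob_vecs N"
  shows "\<bar>(\<Sum>j<N. q j * cell_projection N j) - (2 - 4 * (\<Sum>j<N. q j * kernel_projection (real j / N)))\<bar> \<le> 39 / N"
proof -
  have "(\<Sum>j<N. q j * cell_projection N j) - (2 - 4 * (\<Sum>j<N. q j * kernel_projection (real j / N)))
     = (\<Sum>j<N. q j * (cell_projection N j - (2 - 4 * kernel_projection (real j / N))))"
    using prob_vecs_sum[OF q]
    by (simp add: right_diff_distrib sum_subtractf sum_distrib_left sum_distrib_right[symmetric] mult.left_commute)
  also have "\<bar>\<dots>\<bar> \<le> (\<Sum>j<N. \<bar>q j * (cell_projection N j - (2 - 4 * kernel_projection (real j / N)))\<bar>)" by (rule sum_abs)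
  also have "\<dots> \<le> (\<Sum>j<N. q j * (39 / N))"
  proof (rule sum_mono)
    fix j assume "j \<in> {..<N}"
    then have j: "j < N" by simp
    show "\<bar>q j * (cell_projection N j - (2 - 4 * kernel_projection (real j / N)))\<bar> \<le> q j * (39 / N)"
      using mult_left_mono[OF cell_projection_approx[OF j] prob_vecs_nonneg[OF q j]] prob_vecs_nonneg[OF q j]
      by (simp add: abs_mult)
  qed
  also have "\<dots> = 39 / N" by (simp only: sum_distrib_right[symmetric] prob_vecs_sum[OF q])
  finally show ?thesis by simp
qed

text \<open>Expansion around the uniform vector p. The linear part is the average of the cell projection against q - p, and the
average against p is 4 times the bad mass of p, which gives the coefficient -3 of the mean projection. The terms of
order at least 2 have total weight 3 (6 \<tau>^2 + 4 \<tau>^3 + \<tau>^4), and \<tau> \<le> 2.\<close>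

lemma bad_mass_expansion:
  assumes q: "q \<in> prob_vecs N"
  defines "\<tau> \<equiv> \<Sum>j<N. \<bar>q j - 1 / N\<bar>"
  shows "\<bar>(1 / 2 - bad_mass N q) - (4 * (\<Sum>j<N. q j * kernel_projection (real j / N)) - 3 * ((\<Sum>j<N. kernel_projection (real j / N)) / N))\<bar>
     \<le> 54 * \<tau>\<^sup>2 + 69 / N"
proof -
  have N: "0 < N" using q by (rule prob_vecs_pos)
  define p where "p = (\<lambda>_::nat. 1 / real N)"
  define \<mu> where "\<mu> j = q j - p j" for j
  have p: "p \<in> prob_vecs N" unfolding p_def by (rule uniform_prob_vecs[OF N])
  have pa: "(\<Sum>j<N. \<bar>p j\<bar>) = 1" using N by (simp add: p_def)
  have ma: "(\<Sum>j<N. \<bar>\<mu> j\<bar>) = \<tau>" by (simp add: \<mu>_def p_def \<tau>_def)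
  have t0: "0 \<le> \<tau>" unfolding \<tau>_def by (rule sum_nonneg) simp
  have t2: "\<tau> \<le> 2"
  proof -
    have "\<tau> \<le> (\<Sum>j<N. q j + 1 / N)" unfolding \<tau>_def
    proof (rule sum_mono)
      fix j assume "j \<in> {..<N}"
      then have "0 \<le> q j" "0 \<le> 1 / real N" using prob_vecs_nonneg[OF q] by auto
      then show "\<bar>q j - 1 / N\<bar> \<le> q j + 1 / N" by linarith
    qed
    also have "\<dots> = 2" using N prob_vecs_sum[OF q] by (simp add: sum.distrib)
    finally show ?thesis .
  qed
  let ?Q = "quad N"
  define R2 where "R2 = ?Q \<mu> \<mu> p p + ?Q \<mu> p \<mu> p + ?Q \<mu> p p \<mu> + ?Q p \<mu> \<mu> p + ?Q p \<mu> p \<mu> + ?Q p p \<mu> \<mu>"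
  define R3 where "R3 = ?Q p \<mu> \<mu> \<mu> + ?Q \<mu> p \<mu> \<mu> + ?Q \<mu> \<mu> p \<mu> + ?Q \<mu> \<mu> \<mu> p"
  define R4 where "R4 = ?Q \<mu> \<mu> \<mu> \<mu>"
  have q_eq: "q = (\<lambda>j. 1 * p j + 1 * \<mu> j)" by (simp add: \<mu>_def)
  have ex: "bad_mass N q = bad_mass N p + (\<Sum>j<N. \<mu> j * cell_projection N j) + 3 * R2 + 3 * R3 + 3 * R4"
    unfolding first_order_terms[symmetric] p_def[symmetric]
    by (subst q_eq, subst bad_mass_mixture) (simp add: R2_def R3_def R4_def bad_mass_def)
  have b2: "\<bar>R2\<bar> \<le> 6 * \<tau>\<^sup>2"
  proof -
    have "\<bar>?Q \<mu> \<mu> p p\<bar> \<le> \<tau>\<^sup>2" "\<bar>?Q \<mu> p \<mu> p\<bar> \<le> \<tau>\<^sup>2" "\<bar>?Q \<mu> p p \<mu>\<bar> \<le> \<tau>\<^sup>2"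
      "\<bar>?Q p \<mu> \<mu> p\<bar> \<le> \<tau>\<^sup>2" "\<bar>?Q p \<mu> p \<mu>\<bar> \<le> \<tau>\<^sup>2" "\<bar>?Q p p \<mu> \<mu>\<bar> \<le> \<tau>\<^sup>2"
      using abs_quad_le[of N \<mu> \<mu> p p] abs_quad_le[of N \<mu> p \<mu> p] abs_quad_le[of N \<mu> p p \<mu>]
        abs_quad_le[of N p \<mu> \<mu> p] abs_quad_le[of N p \<mu> p \<mu>] abs_quad_le[of N p p \<mu> \<mu>]
      unfolding pa ma by (simp_all add: power2_eq_square)
    then show ?thesis unfolding R2_def by linarith
  qed
  have b3: "\<bar>R3\<bar> \<le> 4 * \<tau> ^ 3"
  proof -
    have "\<bar>?Q p \<mu> \<mu> \<mu>\<bar> \<le> \<tau> ^ 3" "\<bar>?Q \<mu> p \<mu> \<mu>\<bar> \<le> \<tau> ^ 3" "\<bar>?Q \<mu> \<mu> p \<mu>\<bar> \<le> \<tau> ^ 3" "\<bar>?Q \<mu> \<mu> \<mu> p\<bar> \<le> \<tau> ^ 3"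
      using abs_quad_le[of N p \<mu> \<mu> \<mu>] abs_quad_le[of N \<mu> p \<mu> \<mu>] abs_quad_le[of N \<mu> \<mu> p \<mu>] abs_quad_le[of N \<mu> \<mu> \<mu> p]
      unfolding pa ma by (simp_all add: power3_eq_cube)
    then show ?thesis unfolding R3_def by linarith
  qed
  have b4: "\<bar>R4\<bar> \<le> \<tau> ^ 4"
    using abs_quad_le[of N \<mu> \<mu> \<mu> \<mu>] unfolding ma R4_def by (simp add: power4_eq_xxxx mult.assoc)
  have t3: "\<tau> ^ 3 \<le> 2 * \<tau>\<^sup>2"
    using mult_right_mono[OF t2, of "\<tau>\<^sup>2"] by (simp add: power3_eq_cube power2_eq_square mult_ac)
  have t4: "\<tau> ^ 4 \<le> 4 * \<tau>\<^sup>2"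
    using mult_right_mono[OF t2, of "\<tau> ^ 3"] t0 t3 by (simp add: power3_eq_cube power2_eq_square power4_eq_xxxx mult_ac)
  define S where "S = (\<Sum>j<N. q j * cell_projection N j)"
  define P where "P = (\<Sum>j<N. p j * cell_projection N j)"
  have "(\<Sum>j<N. \<mu> j * cell_projection N j) = S - P" by (simp add: S_def P_def \<mu>_def left_diff_distrib sum_subtractf)
  moreover have "P = 4 * bad_mass N p"
    unfolding P_def first_order_terms[symmetric] p_def[symmetric] bad_mass_def by simp
  ultimately have b: "bad_mass N q = S - 3 / 4 * P + 3 * (R2 + R3 + R4)" using ex by simp
  have s: "\<bar>S - (2 - 4 * (\<Sum>j<N. q j * kernel_projection (real j / N)))\<bar> \<le> 39 / N" unfolding S_def by (rule average_cell_projection[OF q])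
  have pp: "\<bar>P - (2 - 4 * ((\<Sum>j<N. kernel_projection (real j / N)) / N))\<bar> \<le> 39 / N"
    using average_cell_projection[OF p] unfolding P_def by (simp add: p_def sum_divide_distrib)
  have "\<bar>(1 / 2 - (S' - 3 / 4 * P' + 3 * (r2 + r3 + r4))) - (4 * x - 3 * y)\<bar> \<le> 54 * t + 69 * i"
    if "\<bar>r2\<bar> \<le> 6 * t" "\<bar>r3\<bar> \<le> 8 * t" "\<bar>r4\<bar> \<le> 4 * t" "\<bar>S' - (2 - 4 * x)\<bar> \<le> 39 * i" "\<bar>P' - (2 - 4 * y)\<bar> \<le> 39 * i"
    for S' P' r2 r3 r4 t x y i :: real
  proof -
    have "(1 / 2 - (S' - 3 / 4 * P' + 3 * (r2 + r3 + r4))) - (4 * x - 3 * y)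
       = - (S' - (2 - 4 * x)) + 3 / 4 * (P' - (2 - 4 * y)) - 3 * r2 - 3 * r3 - 3 * r4" by (simp add: field_simps)
    moreover have "\<bar>- a + 3 / 4 * b - 3 * r2 - 3 * r3 - 3 * r4\<bar> \<le> 54 * t + 69 * i"
      if "\<bar>a\<bar> \<le> 39 * i" "\<bar>b\<bar> \<le> 39 * i" for a b
      using that \<open>\<bar>r2\<bar> \<le> 6 * t\<close> \<open>\<bar>r3\<bar> \<le> 8 * t\<close> \<open>\<bar>r4\<bar> \<le> 4 * t\<close> unfolding abs_le_iff by (auto simp: field_simps)
    ultimately show ?thesis using that(4,5) by metis
  qed
  from this[of R2 "\<tau>\<^sup>2" R3 R4 S _ "1 / N" P] b2 b3 b4 t3 t4 s pp
  show ?thesis unfolding b by simp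
qed

text \<open>A single cell of mass \<epsilon> contributes at least \<epsilon> ln N - ln 2.\<close>

lemma KL_large_if_concentrated:
  assumes e: "0 < \<epsilon>"
  shows "\<forall>\<^sub>F N in sequentially. \<forall>q\<in>prob_vecs N. (\<exists>j<N. \<epsilon> < q j) \<longrightarrow> \<kappa> \<le> KL N q"
proof -
  have "filterlim (\<lambda>N::nat. \<epsilon> * ln N - ln 2) at_top sequentially" using e by real_asymp
  then have "\<forall>\<^sub>F N::nat in sequentially. \<kappa> \<le> \<epsilon> * ln N - ln 2" by (simp add: filterlim_at_top)
  then show ?thesis using eventually_gt_at_top[of 0]
  proof eventually_elim
    case (elim N)
    show ?case
    proof (intro ballI impI)
      fix q assume q: "q \<in> prob_vecs N" and "\<exists>j<N. \<epsilon> < q j"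
      then obtain j where j: "j < N" "\<epsilon> < q j" by blast
      have "ln (1 / (1 / real N)) * sum q {j} \<le> KL N q + ln 2"
        by (rule KL_small_set[OF q]) (use j in auto)
      moreover have "\<epsilon> * ln N \<le> q j * ln N" using j by (intro mult_right_mono) auto
      ultimately show "\<kappa> \<le> KL N q" using elim(1) by (simp add: mult.commute)
    qed
  qed
qed

lemma exp_le_cubic:
  assumes "\<bar>x::real\<bar> \<le> 1" shows "exp x \<le> 1 + x + x\<^sup>2 / 2 + \<bar>x\<bar> ^ 3"
proof -
  obtain t where t: "\<bar>t\<bar> \<le> \<bar>x\<bar>" "exp x = (\<Sum>m<3. x ^ m / fact m) + exp t / fact 3 * x ^ 3"
    using Maclaurin_exp_le[of x 3] by auto
  have "exp t \<le> exp 1" using t assms by simp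
  then have "exp t \<le> 3" using exp_le by linarith
  then have e: "exp t / fact 3 \<le> 1" by (simp add: fact_numeral)
  have "exp t / fact 3 * x ^ 3 \<le> exp t / fact 3 * \<bar>x\<bar> ^ 3"
    by (intro mult_left_mono) (auto simp: power_abs[symmetric])
  also have "\<dots> \<le> 1 * \<bar>x\<bar> ^ 3" using e by (intro mult_right_mono) auto
  finally show ?thesis unfolding t(2) by (simp add: numeral_3_eq_3 power2_eq_square)
qed

text \<open>Compare derivatives on both sides of 0; for negative x the derivative is estimated by ln (1 + y) \<ge> y - 2 y^2.\<close>

lemma xlogx_le_cubic:
  assumes x: "\<bar>x::real\<bar> \<le> 1 / 2" shows "(1 + x) * ln (1 + x) \<le> x + x\<^sup>2 / 2 + \<bar>x\<bar> ^ 3"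
proof (cases "0 \<le> x")
  case True
  let ?g = "\<lambda>x::real. x + x\<^sup>2 / 2 + x ^ 3 - (1 + x) * ln (1 + x)"
  have "?g 0 \<le> ?g x"
  proof (rule DERIV_nonneg_imp_nondecreasing[OF True])
    fix y assume y: "0 \<le> y" "y \<le> x"
    have "(?g has_real_derivative 1 + y + 3 * y\<^sup>2 - (ln (1 + y) + (1 + y) * (1 / (1 + y)))) (at y)"
      using y by (auto intro!: derivative_eq_intros simp: power2_eq_square)
    moreover have "1 + y + 3 * y\<^sup>2 - (ln (1 + y) + (1 + y) * (1 / (1 + y))) = y + 3 * y\<^sup>2 - ln (1 + y)"
      using y by simp
    ultimately have "(?g has_real_derivative y + 3 * y\<^sup>2 - ln (1 + y)) (at y)" by (simp only:)
    moreover have "ln (1 + y) \<le> y" using y by (intro ln_add_one_self_le_self)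
    then have "0 \<le> y + 3 * y\<^sup>2 - ln (1 + y)" by (smt (verit) zero_le_power2)
    ultimately show "\<exists>z. (?g has_real_derivative z) (at y) \<and> 0 \<le> z" by blast
  qed
  then show ?thesis using True by simp
next
  case False
  let ?g = "\<lambda>x::real. x + x\<^sup>2 / 2 - x ^ 3 - (1 + x) * ln (1 + x)"
  have "?g 0 \<le> ?g x"
  proof (rule DERIV_nonpos_imp_nonincreasing[of x 0 ?g])
    show "x \<le> 0" using False by simp
    fix y assume y: "x \<le> y" "y \<le> 0"
    have y2: "\<bar>y\<bar> \<le> 1 / 2" using y x by linarith
    have "(?g has_real_derivative 1 + y - 3 * y\<^sup>2 - (ln (1 + y) + (1 + y) * (1 / (1 + y)))) (at y)"
      using y2 by (auto intro!: derivative_eq_intros simp: power2_eq_square)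
    moreover have "1 + y - 3 * y\<^sup>2 - (ln (1 + y) + (1 + y) * (1 / (1 + y))) = y - 3 * y\<^sup>2 - ln (1 + y)"
      using y2 by simp
    ultimately have "(?g has_real_derivative y - 3 * y\<^sup>2 - ln (1 + y)) (at y)" by (simp only:)
    moreover have "y - 3 * y\<^sup>2 - ln (1 + y) \<le> 0"
      using abs_ln_one_plus_x_minus_x_bound[OF y2] by (smt (verit) zero_le_power2)
    ultimately show "\<exists>z. (?g has_real_derivative z) (at y) \<and> z \<le> 0" by blast
  qed
  moreover have "\<bar>x\<bar> ^ 3 = - (x ^ 3)" using False by (simp add: power3_eq_cube)
  ultimately show ?thesis by simp
qed


lemma tendsto_one_over_nat: "(\<lambda>N. c / real N) \<longlonglongrightarrow> 0"
  by real_asymp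

text \<open>The parameter \<theta> is a / (4 \<Delta>^2), which is optimal for the quadratic bound \<theta> a / 4 - \<theta>^2 \<Delta>^2 / 2 and gives it the value
\<theta> a / 8 = a^2 / (32 \<Delta>^2). The factor 1 + 54 \<theta> absorbs the quadratic error of the expansion by way of Pinsker's
inequality.\<close>

lemma KL_ge_quadratic:
  fixes a \<kappa> :: real
  defines "\<theta> \<equiv> 480 / 11 * a"
  assumes a: "0 < a" "a \<le> 1 / 200" and k: "\<kappa> * (1 + 54 * \<theta>) < \<theta> * a / 8 - 64 * \<theta> ^ 3"
  shows "\<exists>\<epsilon>>0. \<forall>\<^sub>F N in sequentially. \<forall>q\<in>prob_vecs N.
    (\<exists>j<N. \<epsilon> < q j) \<or> a - 30 * \<epsilon> \<le> 1 / 2 - bad_mass N q \<longrightarrow> \<kappa> \<le> KL N q"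
proof -
  have th: "0 < \<theta>" "4 * \<theta> \<le> 1" using a by (auto simp: \<theta>_def)
  define g where "g = \<theta> * a / 8 - 64 * \<theta> ^ 3 - \<kappa> * (1 + 54 * \<theta>)"
  have g: "0 < g" using k by (simp add: g_def)
  \<comment> \<open>makes the discretisation error cost a quarter of the gap\<close>
  define \<epsilon> where "\<epsilon> = g / (30 * \<theta>)"
  have e: "0 < \<epsilon>" using g th by (simp add: \<epsilon>_def)
  define m1 where "m1 N = (\<Sum>j<N. kernel_projection (real j / real N)) / N" for N :: nat
  define m2 where "m2 N = (\<Sum>j<N. (kernel_projection (real j / real N))\<^sup>2) / N" for N :: nat
  \<comment> \<open>everything in the bound except the main term, converging as N grows\<close>
  define E where "E N = \<theta> / 4 * (30 * \<epsilon> - 3 * m1 N + 69 / real N) + \<theta> * m1 N + \<theta>\<^sup>2 / 2 * m2 N + 64 * \<theta> ^ 3" for N :: nat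
  have "E \<longlonglongrightarrow> \<theta> / 4 * (30 * \<epsilon> - 3 * 0 + 0) + \<theta> * 0 + \<theta>\<^sup>2 / 2 * (11 / 1920) + 64 * \<theta> ^ 3"
    unfolding E_def m1_def m2_def
    by (intro tendsto_intros mean_kernel_projection mean_kernel_projection_sq tendsto_one_over_nat)
  moreover have "\<theta> / 4 * (30 * \<epsilon> - 3 * 0 + 0) = g / 4" using th by (simp add: \<epsilon>_def)
  moreover have "\<theta>\<^sup>2 / 2 * (11 / 1920) = \<theta> * a / 8" by (simp add: \<theta>_def power2_eq_square)
  ultimately have "E \<longlonglongrightarrow> g / 4 + \<theta> * a / 8 + 64 * \<theta> ^ 3" by (simp only: mult_zero_right add_0_right)
  moreover have "g / 4 + \<theta> * a / 8 + 64 * \<theta> ^ 3 < \<theta> * a / 4 - \<kappa> * (1 + 54 * \<theta>)"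
  proof -
    have "\<kappa> * (1 + 54 * \<theta>) = \<theta> * a / 8 - 64 * \<theta> ^ 3 - g" by (simp add: g_def)
    then show ?thesis using g by (simp only:)
  qed
  ultimately have ev: "\<forall>\<^sub>F N in sequentially. E N < \<theta> * a / 4 - \<kappa> * (1 + 54 * \<theta>)" by (rule order_tendstoD(2))
  have "\<forall>\<^sub>F N in sequentially. \<forall>q\<in>prob_vecs N.
    (\<exists>j<N. \<epsilon> < q j) \<or> a - 30 * \<epsilon> \<le> 1 / 2 - bad_mass N q \<longrightarrow> \<kappa> \<le> KL N q"
    using ev KL_large_if_concentrated[OF e, of \<kappa>]
  proof eventually_elim
    case (elim N)
    show ?case
    proof (intro ballI impI)
      fix q assume q: "q \<in> prob_vecs N" and or: "(\<exists>j<N. \<epsilon> < q j) \<or> a - 30 * \<epsilon> \<le> 1 / 2 - bad_mass N q"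
      show "\<kappa> \<le> KL N q"
      proof (cases "\<exists>j<N. \<epsilon> < q j")
        case True then show ?thesis using elim(2) q by blast
      next
        case False
        then have T: "a - 30 * \<epsilon> \<le> 1 / 2 - bad_mass N q" using or by blast
        have N: "0 < N" using q by (rule prob_vecs_pos)
        let ?psi = "\<lambda>j. kernel_projection (real j / real N)"
        let ?s = "\<Sum>j<N. q j * ?psi j"
        have pb: "\<bar>?psi j\<bar> \<le> 4" if "j < N" for j using that by (intro abs_kernel_projection_le) auto
        define Z where "Z = (\<Sum>j<N. exp (\<theta> * ?psi j)) / N"
        have "Z \<le> 1 + \<theta> * m1 N + \<theta>\<^sup>2 / 2 * m2 N + 64 * \<theta> ^ 3"
        proof -
          have "(\<Sum>j<N. exp (\<theta> * ?psi j)) \<le> (\<Sum>j<N. 1 + \<theta> * ?psi j + \<theta>\<^sup>2 / 2 * (?psi j)\<^sup>2 + 64 * \<theta> ^ 3)"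
          proof (rule sum_mono)
            fix j assume "j \<in> {..<N}"
            then have b: "\<bar>\<theta> * ?psi j\<bar> \<le> 4 * \<theta>"
              using mult_left_mono[OF pb[of j], of \<theta>] th by (simp add: abs_mult mult.commute)
            then have "\<bar>\<theta> * ?psi j\<bar> \<le> 1" using th by linarith
            then have "exp (\<theta> * ?psi j) \<le> 1 + \<theta> * ?psi j + (\<theta> * ?psi j)\<^sup>2 / 2 + \<bar>\<theta> * ?psi j\<bar> ^ 3"
              by (rule exp_le_cubic)
            moreover have "\<bar>\<theta> * ?psi j\<bar> ^ 3 \<le> (4 * \<theta>) ^ 3" using b by (intro power_mono) auto
            ultimately show "exp (\<theta> * ?psi j) \<le> 1 + \<theta> * ?psi j + \<theta>\<^sup>2 / 2 * (?psi j)\<^sup>2 + 64 * \<theta> ^ 3"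
              by (simp add: power_mult_distrib)
          qed
          also have "\<dots> = N * (1 + \<theta> * m1 N + \<theta>\<^sup>2 / 2 * m2 N + 64 * \<theta> ^ 3)"
            using N by (simp add: sum.distrib sum_distrib_left[symmetric] sum_divide_distrib[symmetric] m1_def m2_def algebra_simps)
          finally show ?thesis unfolding Z_def using N by (simp add: pos_divide_le_eq mult.commute)
        qed
        moreover have "0 < Z" unfolding Z_def by (intro divide_pos_pos sum_pos) (use N in auto)
        then have "ln Z \<le> Z - 1" by (rule ln_le_minus_one)
        ultimately have lnZ: "ln Z \<le> \<theta> * m1 N + \<theta>\<^sup>2 / 2 * m2 N + 64 * \<theta> ^ 3" by linarith
        have "(\<Sum>j<N. q j * (\<theta> * ?psi j)) - ln Z \<le> KL N q"
          unfolding Z_def by (rule KL_ge_exp_mean[OF q])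
        moreover have "(\<Sum>j<N. q j * (\<theta> * ?psi j)) = \<theta> * ?s" by (simp add: sum_distrib_left mult_ac)
        ultimately have dv: "\<theta> * ?s \<le> KL N q + ln Z" by linarith
        have "(1 / 2 - bad_mass N q) - (4 * ?s - 3 * m1 N) \<le> 54 * (\<Sum>j<N. \<bar>q j - 1 / N\<bar>)\<^sup>2 + 69 / N"
          using bad_mass_expansion[OF q] unfolding m1_def by (simp only: abs_le_iff)
        then have "a - 30 * \<epsilon> + 3 * m1 N - 216 * KL N q - 69 / N \<le> 4 * ?s"
          using T total_variation_sq_le_KL[OF q] by linarith
        then have "\<theta> / 4 * (a - 30 * \<epsilon> + 3 * m1 N - 216 * KL N q - 69 / N) \<le> \<theta> / 4 * (4 * ?s)"
          using th by (intro mult_left_mono) auto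
        moreover have "\<theta> * a / 4 - E N = \<theta> / 4 * (a - 30 * \<epsilon> + 3 * m1 N - 216 * KL N q - 69 / N)
            + 54 * (\<theta> * KL N q) - (\<theta> * m1 N + \<theta>\<^sup>2 / 2 * m2 N + 64 * \<theta> ^ 3)"
          unfolding E_def by (simp add: algebra_simps)
        moreover have "\<theta> / 4 * (4 * ?s) = \<theta> * ?s" by simp
        moreover have "KL N q * (1 + 54 * \<theta>) = KL N q + 54 * (\<theta> * KL N q)" by (simp add: algebra_simps)
        ultimately have "\<theta> * a / 4 - E N \<le> KL N q * (1 + 54 * \<theta>)" using dv lnZ by (simp only:)
        then have "\<kappa> * (1 + 54 * \<theta>) \<le> KL N q * (1 + 54 * \<theta>)" using elim(1) by linarith
        moreover have "0 < 1 + 54 * \<theta>" using th by simp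
        ultimately show ?thesis by (simp only: mult_le_cancel_right_pos)
      qed
    qed
  qed
  then show ?thesis by (intro exI[of _ \<epsilon>] conjI e)
qed

text \<open>The vectors (1 + h (\<psi> - m1)) / N, with m1 the mean of \<psi>, raise T by about 4 h \<Delta>^2 at the cost h^2 \<Delta>^2 / 2.\<close>

lemma ex_cheap_prob_vec:
  fixes a h K :: real
  assumes h: "0 < h" "h \<le> 1 / 16" and a: "a < 4 * h * (11 / 1920) - 3456 * h\<^sup>2"
    and K: "h\<^sup>2 * (11 / 1920) / 2 + 512 * h ^ 3 < K"
  shows "\<exists>N q m. q \<in> prob_vecs N \<and> (\<forall>j<N. q j \<le> m) \<and> a + 30 * m < 1 / 2 - bad_mass N q \<and> KL N q < K"
proof -
  define m1 where "m1 N = (\<Sum>j<N. kernel_projection (real j / real N)) / N" for N :: nat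
  define m2 where "m2 N = (\<Sum>j<N. (kernel_projection (real j / real N))\<^sup>2) / N" for N :: nat
  have m1: "m1 \<longlonglongrightarrow> 0" and m2: "m2 \<longlonglongrightarrow> 11 / 1920"
    unfolding m1_def[abs_def] m2_def[abs_def] by (rule mean_kernel_projection, rule mean_kernel_projection_sq)
  have "(\<lambda>N. m1 N + 4 * h * (m2 N - (m1 N)\<^sup>2) - 3456 * h\<^sup>2 - 129 / real N) \<longlonglongrightarrow> 0 + 4 * h * (11 / 1920 - 0\<^sup>2) - 3456 * h\<^sup>2 - 0"
    by (intro tendsto_intros m1 m2 tendsto_one_over_nat)
  then have e1: "\<forall>\<^sub>F N in sequentially. a < m1 N + 4 * h * (m2 N - (m1 N)\<^sup>2) - 3456 * h\<^sup>2 - 129 / real N"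
    using a by (intro order_tendstoD(1)) auto
  have "(\<lambda>N. h\<^sup>2 * m2 N / 2 + 512 * h ^ 3) \<longlonglongrightarrow> h\<^sup>2 * (11 / 1920) / 2 + 512 * h ^ 3"
    by (intro tendsto_intros m2) auto
  then have e2: "\<forall>\<^sub>F N in sequentially. h\<^sup>2 * m2 N / 2 + 512 * h ^ 3 < K"
    using K by (intro order_tendstoD(2)) auto
  obtain N where N: "0 < N" and N1: "a < m1 N + 4 * h * (m2 N - (m1 N)\<^sup>2) - 3456 * h\<^sup>2 - 129 / real N"
    and N2: "h\<^sup>2 * m2 N / 2 + 512 * h ^ 3 < K"
    using eventually_happens[OF eventually_conj[OF eventually_gt_at_top[of 0] eventually_conj[OF e1 e2]]] by auto
  define v where "v j = kernel_projection (real j / real N)" for j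
  define x where "x j = h * (v j - m1 N)" for j
  define q where "q j = (1 + x j) / N" for j
  have vb: "\<bar>v j\<bar> \<le> 4" if "j < N" for j unfolding v_def using that by (intro abs_kernel_projection_le) auto
  have sv: "(\<Sum>j<N. v j) = N * m1 N" "(\<Sum>j<N. (v j)\<^sup>2) = N * m2 N" using N by (auto simp: v_def m1_def m2_def)
  have m1b: "\<bar>m1 N\<bar> \<le> 4"
  proof -
    have "\<bar>\<Sum>j<N. v j\<bar> \<le> (\<Sum>j<N. 4)" by (rule order_trans[OF sum_abs]) (rule sum_mono, use vb in auto)
    then have "\<bar>real N * m1 N\<bar> \<le> real N * 4" unfolding sv by simp
    then show ?thesis using N by (simp add: abs_mult)
  qed
  have xb: "\<bar>x j\<bar> \<le> 8 * h" if "j < N" for j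
  proof -
    have "\<bar>v j - m1 N\<bar> \<le> 8" using vb[OF that] m1b by linarith
    then have "h * \<bar>v j - m1 N\<bar> \<le> h * 8" using h by (intro mult_left_mono) auto
    then show ?thesis using h by (simp add: x_def abs_mult)
  qed
  have xh: "\<bar>x j\<bar> \<le> 1 / 2" if "j < N" for j using xb[OF that] h by linarith
  have sx: "(\<Sum>j<N. x j) = 0" unfolding x_def by (simp add: sum_distrib_left[symmetric] sum_subtractf sv)
  have sxv: "(\<Sum>j<N. x j * v j) = N * (h * (m2 N - (m1 N)\<^sup>2))"
  proof -
    have "(\<Sum>j<N. x j * v j) = h * ((\<Sum>j<N. (v j)\<^sup>2) - m1 N * (\<Sum>j<N. v j))"
      unfolding x_def by (simp add: sum_distrib_left sum_subtractf algebra_simps power2_eq_square)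
    then show ?thesis unfolding sv by (simp add: algebra_simps power2_eq_square)
  qed
  have sxx: "(\<Sum>j<N. (x j)\<^sup>2) = N * (h\<^sup>2 * (m2 N - (m1 N)\<^sup>2))"
  proof -
    have "(\<Sum>j<N. (x j)\<^sup>2) = h * (\<Sum>j<N. x j * v j) - h * m1 N * (\<Sum>j<N. x j)"
      unfolding sum_distrib_left sum_subtractf[symmetric]
      by (rule sum.cong) (auto simp: x_def power2_eq_square algebra_simps)
    then show ?thesis unfolding sx sxv by (simp add: power2_eq_square)
  qed
  have q: "q \<in> prob_vecs N"
  proof -
    have "(\<Sum>j<N. q j) = 1" unfolding q_def using N by (simp add: sum_divide_distrib[symmetric] sum.distrib sx)
    moreover have "0 \<le> q j" if "j < N" for j using xh[OF that] unfolding q_def by (intro divide_nonneg_nonneg) auto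
    ultimately show ?thesis by (auto simp: prob_vecs_def)
  qed
  have qm: "q j \<le> 2 / N" if "j < N" for j
    unfolding q_def by (rule divide_right_mono) (use xh[OF that] in auto)
  have sqv: "(\<Sum>j<N. q j * v j) = m1 N + h * (m2 N - (m1 N)\<^sup>2)"
  proof -
    have "(\<Sum>j<N. q j * v j) = ((\<Sum>j<N. v j) + (\<Sum>j<N. x j * v j)) / N"
      unfolding q_def sum.distrib[symmetric] sum_divide_distrib by (rule sum.cong) (auto simp: algebra_simps)
    then show ?thesis unfolding sv sxv using N by (simp add: add_divide_distrib)
  qed
  have tv: "(\<Sum>j<N. \<bar>q j - 1 / N\<bar>) \<le> 8 * h"
  proof -
    have "(\<Sum>j<N. \<bar>q j - 1 / N\<bar>) \<le> (\<Sum>j<N. 8 * h / N)"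
    proof (rule sum_mono)
      fix j assume "j \<in> {..<N}"
      moreover have "q j - 1 / N = x j / N" by (simp add: q_def add_divide_distrib)
      ultimately show "\<bar>q j - 1 / N\<bar> \<le> 8 * h / N" using xb[of j] by (simp add: divide_right_mono)
    qed
    then show ?thesis using N by simp
  qed
  have tv2: "(\<Sum>j<N. \<bar>q j - 1 / N\<bar>)\<^sup>2 \<le> 64 * h\<^sup>2"
    using power_mono[OF tv, of 2] by (simp add: sum_nonneg power_mult_distrib)
  have "(4 * (\<Sum>j<N. q j * v j) - 3 * m1 N) - (1 / 2 - bad_mass N q) \<le> 54 * (\<Sum>j<N. \<bar>q j - 1 / N\<bar>)\<^sup>2 + 69 / N"
    using bad_mass_expansion[OF q] unfolding m1_def v_def by (simp only: abs_le_iff minus_diff_eq)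
  then have T: "a + 30 * (2 / N) < 1 / 2 - bad_mass N q" using N1 tv2 unfolding sqv by simp
  have "KL N q = (\<Sum>j<N. (1 + x j) * ln (1 + x j)) / N"
    unfolding KL_def q_def sum_divide_distrib using N by (intro sum.cong) auto
  also have "(\<Sum>j<N. (1 + x j) * ln (1 + x j)) \<le> (\<Sum>j<N. x j + (x j)\<^sup>2 / 2 + 512 * h ^ 3)"
  proof (rule sum_mono)
    fix j assume "j \<in> {..<N}"
    then have j: "j < N" by simp
    have "\<bar>x j\<bar> ^ 3 \<le> (8 * h) ^ 3" using xb[OF j] by (intro power_mono) auto
    then show "(1 + x j) * ln (1 + x j) \<le> x j + (x j)\<^sup>2 / 2 + 512 * h ^ 3"
      using xlogx_le_cubic[OF xh[OF j]] by (simp add: power_mult_distrib)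
  qed
  also have "\<dots> = N * (h\<^sup>2 * (m2 N - (m1 N)\<^sup>2) / 2 + 512 * h ^ 3)"
    by (simp add: sum.distrib sx sxx sum_divide_distrib[symmetric] algebra_simps)
  also have "\<dots> / N \<le> h\<^sup>2 * m2 N / 2 + 512 * h ^ 3"
    using N by (simp add: mult_left_mono)
  finally have "KL N q < K" using N2 by (simp add: divide_right_mono)
  then show ?thesis using q qm T by blast
qed


text \<open>Because t - t^2 \<le> 1/4.\<close>

lemma card_square_window:
  fixes s t N :: nat
  assumes N: "0 < N" and st: "t * t \<le> s * N"
  shows "real (card {s..t}) \<le> (1 / 4 + 1 / N) * N"
proof -
  have "real (card {s..t}) \<le> real t + 1 - s \<or> card {s..t} = 0" by (cases "s \<le> t") auto
  moreover have "real t + 1 - s \<le> N / 4 + 1"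
  proof -
    have "real (t * t) \<le> real (s * N)" using st by (simp only: of_nat_le_iff)
    then have "(real t - s) * N \<le> real t * N - real t * real t" by (simp add: algebra_simps)
    also have "\<dots> \<le> N\<^sup>2 / 4"
    proof -
      have "0 \<le> (real t - N / 2)\<^sup>2" by simp
      then show ?thesis by (simp add: power2_eq_square algebra_simps)
    qed
    finally have "(real t - s) * N \<le> (N / 4) * N" by (simp add: power2_eq_square)
    then have "real t - s \<le> N / 4" using N by (simp only: mult_le_cancel_right_pos of_nat_0_less_iff)
    then show ?thesis by simp
  qed
  moreover have "(1 / 4 + 1 / real N) * N = N / 4 + 1" using N by (simp add: field_simps)
  moreover have "0 \<le> real N / 4 + 1" by simp
  ultimately show ?thesis by fastforce
qed

text \<open>Take for s and t the lower and the upper \<delta>-quantile. If s were below t^2, then a first argument up to s together with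
three arguments from t on would always be bad, which has mass at least \<delta>^4.\<close>

lemma mass_in_window:
  assumes q: "q \<in> prob_vecs N" and d: "0 < \<delta>" "\<delta> < 1 / 2" and bad: "bad_mass N q < 3 * \<delta> ^ 4"
  shows "\<exists>s t. t * t \<le> s * N \<and> t < N \<and> 1 - 2 * \<delta> \<le> sum q {s..t}"
proof -
  have N: "0 < N" using q by (rule prob_vecs_pos)
  have q0: "0 \<le> q j" if "j < N" for j by (rule prob_vecs_nonneg[OF q that])
  have tot: "sum q {..<N} = 1" by (rule prob_vecs_sum[OF q])
  define s where "s = (LEAST s. \<delta> \<le> sum q {..s})"
  have ex: "\<exists>s. \<delta> \<le> sum q {..s}"
  proof -
    have "{..N - 1} = {..<N}" using N by auto
    then have "\<delta> \<le> sum q {..N - 1}" using tot d by simp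
    then show ?thesis by blast
  qed
  have s1: "\<delta> \<le> sum q {..s}" unfolding s_def using ex by (rule LeastI_ex)
  have s2: "sum q {..<s} < \<delta>"
  proof (cases s)
    case (Suc k)
    then have "\<not> \<delta> \<le> sum q {..k}" using not_less_Least[of k "\<lambda>s. \<delta> \<le> sum q {..s}"] unfolding s_def by simp
    then show ?thesis by (simp add: Suc lessThan_Suc_atMost)
  qed (use d in simp)
  define P where "P t = (t < N \<and> \<delta> \<le> sum q {t..<N})" for t
  have P0: "P 0" using tot d N by (simp add: P_def atLeast0LessThan)
  have bd: "\<forall>t. P t \<longrightarrow> t \<le> N" by (auto simp: P_def)
  define t where "t = (GREATEST t. P t)"
  have Pt: "P t" unfolding t_def by (rule GreatestI_nat[where P = P and k = 0 and b = N]) (use P0 bd in auto)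
  have t1: "t < N" "\<delta> \<le> sum q {t..<N}" using Pt by (auto simp: P_def)
  have t2: "sum q {Suc t..<N} < \<delta>"
  proof (cases "Suc t < N")
    case True
    have "\<not> P (Suc t)"
    proof
      assume "P (Suc t)"
      then have "Suc t \<le> t" unfolding t_def by (rule Greatest_le_nat[where P = P and b = N]) (use bd in auto)
      then show False by simp
    qed
    then show ?thesis using True by (simp add: P_def)
  qed (use d in simp)
  have sN: "s < N"
  proof (rule ccontr)
    assume "\<not> s < N"
    have "\<not> \<delta> \<le> sum q {..N - 1}" 
      using not_less_Least[of "N - 1" "\<lambda>s. \<delta> \<le> sum q {..s}"] \<open>\<not> s < N\<close> N unfolding s_def by simp
    moreover have "{..N - 1} = {..<N}" using N by auto
    ultimately show False using tot d by simp
  qed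
  have "t * t \<le> s * N"
  proof (rule ccontr)
    assume "\<not> t * t \<le> s * N"
    then have lt: "s * N < t * t" by simp
    let ?r = "\<lambda>A j. if j \<in> A then q j else 0 :: real"
    let ?L = "{..s}" and ?H = "{t..<N}"
    have "(\<Sum>a<N. \<Sum>b<N. \<Sum>c<N. \<Sum>d<N. ?r ?L a * ?r ?H b * ?r ?H c * ?r ?H d) \<le> quad N q q q q"
      unfolding quad_def
    proof (intro sum_mono)
      fix a b c d assume "a \<in> {..<N}" "b \<in> {..<N}" "c \<in> {..<N}" "d \<in> {..<N}"
      then have nn: "0 \<le> q a" "0 \<le> q b" "0 \<le> q c" "0 \<le> q d" using q0 by auto
      show "?r ?L a * ?r ?H b * ?r ?H c * ?r ?H d \<le> q a * q b * q c * q d * cell_kernel N a b c d"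
      proof (cases "a \<in> ?L \<and> b \<in> ?H \<and> c \<in> ?H \<and> d \<in> ?H")
        case True
        then have "a * N \<le> s * N" "t * t \<le> min b c * d" by (auto intro!: mult_mono)
        then have "a * N < min b c * d" using lt by linarith
        then show ?thesis using True by (simp add: cell_kernel_def)
      next
        case False
        then have z: "?r ?L a * ?r ?H b * ?r ?H c * ?r ?H d = 0" by auto
        show ?thesis unfolding z using nn cell_kernel_bounds(1) by simp
      qed
    qed
    moreover have "(\<Sum>a<N. \<Sum>b<N. \<Sum>c<N. \<Sum>d<N. ?r ?L a * ?r ?H b * ?r ?H c * ?r ?H d)
        = sum q {..s} * sum q {t..<N} * sum q {t..<N} * sum q {t..<N}"
    proof -
      have "{..<N} \<inter> {..s} = {..s}" "{..<N} \<inter> {t..<N} = {t..<N}" using sN by auto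
      moreover have "(\<Sum>j<N. if j \<in> A then q j else 0) = sum q ({..<N} \<inter> A)" for A
        by (simp add: sum.inter_restrict)
      ultimately show ?thesis unfolding sum4_factor by (simp only:)
    qed
    moreover have "\<delta> * \<delta> * \<delta> * \<delta> \<le> sum q {..s} * sum q {t..<N} * sum q {t..<N} * sum q {t..<N}"
      using s1 t1 d by (intro mult_mono) auto
    ultimately have "3 * \<delta> ^ 4 \<le> bad_mass N q" unfolding bad_mass_def by (simp add: power4_eq_xxxx)
    then show False using bad by simp
  qed
  moreover have "1 - 2 * \<delta> \<le> sum q {s..t}"
  proof -
    have "sum q {..<N} \<le> sum q ({..<s} \<union> {s..t} \<union> {Suc t..<N})"
      by (rule sum_mono2) (use q0 sN t1 in auto)
    also have "\<dots> \<le> sum q ({..<s} \<union> {s..t}) + sum q {Suc t..<N}"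
    proof (subst sum_Un)
      have "0 \<le> sum q (({..<s} \<union> {s..t}) \<inter> {Suc t..<N})" by (rule sum_nonneg) (use q0 in auto)
      then show "sum q ({..<s} \<union> {s..t}) + sum q {Suc t..<N} - sum q (({..<s} \<union> {s..t}) \<inter> {Suc t..<N})
        \<le> sum q ({..<s} \<union> {s..t}) + sum q {Suc t..<N}" by simp
    qed auto
    also have "sum q ({..<s} \<union> {s..t}) = sum q {..<s} + sum q {s..t}" by (rule sum.union_disjoint) auto
    finally show ?thesis using tot s2 t2 by linarith
  qed
  ultimately show ?thesis using t1 by blast
qed

text \<open>The window has uniform mass about 1/4, so almost all mass in it costs about ln 4. The variational bound is used with
a large tilt T; then \<delta> is chosen small in terms of T, and N large.\<close>

lemma KL_ge_ln_4:
  assumes k: "\<kappa> < ln 4"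
  shows "\<exists>\<epsilon>>0. \<forall>\<^sub>F N in sequentially. \<forall>q\<in>prob_vecs N.
    (\<exists>j<N. \<epsilon> < q j) \<or> 1 / 2 - 30 * \<epsilon> \<le> 1 / 2 - bad_mass N q \<longrightarrow> \<kappa> \<le> KL N q"
proof -
  have "((\<lambda>T::real. T - ln (1 + exp T * (1 / 4))) \<longlongrightarrow> - ln (1 / 4)) at_top" by real_asymp
  moreover have "\<kappa> < - ln (1 / 4)" using k by (simp add: ln_div)
  ultimately have "\<forall>\<^sub>F T in at_top. \<kappa> < T - ln (1 + exp T * (1 / 4))" by (rule order_tendstoD)
  with eventually_gt_at_top[of 0] have "\<forall>\<^sub>F T in at_top. 0 < T \<and> \<kappa> < T - ln (1 + exp T * (1 / 4))"
    by (rule eventually_conj)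
  then have "\<exists>T. 0 < T \<and> \<kappa> < T - ln (1 + exp T * (1 / 4))"
    by (rule eventually_happens'[OF trivial_limit_at_top_linorder])
  then obtain T where T: "0 < T" "\<kappa> < T - ln (1 + exp T * (1 / 4))" by blast
  define g where "g = T - ln (1 + exp T * (1 / 4)) - \<kappa>"
  have g: "0 < g" using T by (simp add: g_def)
  define \<delta> where "\<delta> = min (1 / 4) (g / (4 * T))"
  have d: "0 < \<delta>" "\<delta> < 1 / 2" "2 * T * \<delta> \<le> g / 2"
  proof -
    show "0 < \<delta>" using g T by (simp add: \<delta>_def)
    show "\<delta> < 1 / 2" by (simp add: \<delta>_def)
    have "2 * T * \<delta> \<le> 2 * T * (g / (4 * T))" by (rule mult_left_mono) (use T in \<open>auto simp: \<delta>_def\<close>)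
    then show "2 * T * \<delta> \<le> g / 2" using T by simp
  qed
  define \<epsilon> where "\<epsilon> = \<delta> ^ 4 / 20"
  have e: "0 < \<epsilon>" "30 * \<epsilon> < 3 * \<delta> ^ 4" using d by (auto simp: \<epsilon>_def)
  have "(\<lambda>N. ln (1 + exp T * (1 / 4 + 1 / real N))) \<longlonglongrightarrow> ln (1 + exp T * (1 / 4 + 0))"
  proof (intro tendsto_intros tendsto_one_over_nat)
    have "0 < 1 + exp T * (1 / 4 + 0)" by (intro add_pos_pos) auto
    then show "1 + exp T * (1 / 4 + 0) \<noteq> 0" by (rule less_imp_neq[symmetric])
  qed
  moreover have "ln (1 + exp T * (1 / 4 + 0)) < ln (1 + exp T * (1 / 4)) + g / 2" using g by simp
  ultimately have ev: "\<forall>\<^sub>F N in sequentially. ln (1 + exp T * (1 / 4 + 1 / real N)) < ln (1 + exp T * (1 / 4)) + g / 2"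
    by (rule order_tendstoD(2))
  have "\<forall>\<^sub>F N in sequentially. \<forall>q\<in>prob_vecs N.
    (\<exists>j<N. \<epsilon> < q j) \<or> 1 / 2 - 30 * \<epsilon> \<le> 1 / 2 - bad_mass N q \<longrightarrow> \<kappa> \<le> KL N q"
    using ev KL_large_if_concentrated[OF e(1), of \<kappa>]
  proof eventually_elim
    case (elim N)
    show ?case
    proof (intro ballI impI)
      fix q assume q: "q \<in> prob_vecs N" and or: "(\<exists>j<N. \<epsilon> < q j) \<or> 1 / 2 - 30 * \<epsilon> \<le> 1 / 2 - bad_mass N q"
      show "\<kappa> \<le> KL N q"
      proof (cases "\<exists>j<N. \<epsilon> < q j")
        case True then show ?thesis using elim(2) q by blast
      next
        case False
        then have "1 / 2 - 30 * \<epsilon> \<le> 1 / 2 - bad_mass N q" using or by blast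
        then have "bad_mass N q < 3 * \<delta> ^ 4" using e by linarith
        then obtain s t where st: "t * t \<le> s * N" "t < N" "1 - 2 * \<delta> \<le> sum q {s..t}"
          using mass_in_window[OF q d(1,2)] by blast
        have "T * sum q {s..t} - ln (1 + exp T * (1 / 4 + 1 / real N)) \<le> KL N q"
          by (rule KL_ge_mass[OF q _ card_square_window[OF prob_vecs_pos[OF q] st(1)]]) (use T st(2) in auto)
        moreover have "T - 2 * T * \<delta> \<le> T * sum q {s..t}"
          using mult_left_mono[OF st(3), of T] T by (simp add: algebra_simps)
        moreover have "\<kappa> \<le> K" if "x - A \<le> K" "T - y \<le> x" "A < B + g / 2" "y \<le> g / 2" "g = T - B - \<kappa>" for x y A B K
          using that by linarith
        ultimately show ?thesis using elim(1) d(3) g_def by blast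
      qed
    qed
  qed
  then show ?thesis by (intro exI[of _ \<epsilon>] conjI e(1))
qed

section \<open>The rate function\<close>

lemma polynomial_exp_decay:
  fixes N :: nat and c :: real
  assumes c: "0 < c"
  shows "\<forall>\<^sub>F n in sequentially. (real n + 1) ^ N * exp (- (real n * c)) \<le> 1"
proof -
  have "(\<lambda>n. (real n + 1) powr real N * exp (- (real n * c))) \<longlonglongrightarrow> 0" using c by real_asymp
  then have "\<forall>\<^sub>F n in sequentially. (real n + 1) powr real N * exp (- (real n * c)) < 1" by (rule order_tendstoD) simp
  then show ?thesis
    by eventually_elim (simp add: powr_realpow)
qed

text \<open>The hypothesis says that the upper limit is at most the lower limit.\<close>

lemma convergent_if_frequently_imp_eventually:
  fixes g :: "nat \<Rightarrow> real"
  assumes lb: "\<forall>\<^sub>F n in sequentially. 0 \<le> g n" and ub: "\<forall>\<^sub>F n in sequentially. g n \<le> B"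
    and step: "\<And>\<kappa> \<omega>. \<kappa> \<le> B + 1 \<Longrightarrow> 0 < \<omega> \<Longrightarrow> \<exists>\<^sub>F n in sequentially. g n < \<kappa> \<Longrightarrow> \<forall>\<^sub>F n in sequentially. g n \<le> \<kappa> + \<omega>"
  shows "\<exists>L. g \<longlonglongrightarrow> L"
proof -
  define A where "A = {\<kappa>. \<kappa> \<le> B + 1 \<and> (\<exists>\<^sub>F n in sequentially. g n < \<kappa>)}"
  define L where "L = Inf A"
  have "\<forall>\<^sub>F n in sequentially. g n < B + 1" using ub by eventually_elim simp
  then have BA: "B + 1 \<in> A" unfolding A_def by (simp add: eventually_frequently)
  have pos: "0 \<le> \<kappa>" if k: "\<kappa> \<in> A" for \<kappa>
  proof (rule ccontr)
    assume "\<not> 0 \<le> \<kappa>"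
    then have neg: "\<kappa> < 0" by simp
    from lb have "\<forall>\<^sub>F n in sequentially. \<not> g n < \<kappa>" by eventually_elim (use neg in simp)
    then show False using k by (simp add: A_def frequently_def)
  qed
  have bb: "bdd_below A" by (rule bdd_belowI[of _ 0]) (rule pos)
  have "g \<longlonglongrightarrow> L"
  proof (rule LIMSEQ_I)
    fix e :: real assume e: "0 < e"
    have "Inf A < L + e / 2" using e by (simp add: L_def)
    then obtain \<kappa> where k: "\<kappa> \<in> A" "\<kappa> < L + e / 2" using cInf_lessD[of A] BA by blast
    have "\<forall>\<^sub>F n in sequentially. g n \<le> \<kappa> + e / 4" using k e by (intro step) (auto simp: A_def)
    moreover have "\<forall>\<^sub>F n in sequentially. L - e / 2 \<le> g n"
    proof (cases "L - e / 2 \<le> B + 1")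
      case True
      have "L - e / 2 \<notin> A"
      proof
        assume "L - e / 2 \<in> A"
        then have "L \<le> L - e / 2" unfolding L_def using bb by (intro cInf_lower)
        then show False using e by simp
      qed
      then have "\<not> (\<exists>\<^sub>F n in sequentially. g n < L - e / 2)" using True by (simp add: A_def)
      then show ?thesis by (simp add: frequently_def not_less)
    next
      case False
      have "L \<le> B + 1" unfolding L_def by (rule cInf_lower[OF BA bb])
      then show ?thesis using False e by simp
    qed
    ultimately have "\<forall>\<^sub>F n in sequentially. norm (g n - L) < e"
    proof eventually_elim
      case (elim n)
      then show ?case using k(2) e by (simp add: abs_less_iff)
    qed
    then show "\<exists>no. \<forall>n\<ge>no. norm (g n - L) < e" by (simp add: eventually_sequentially)
  qed
  then show ?thesis by blast
qed

context pareto_sample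
begin

text \<open>One suitable N suffices; the polynomial factor is absorbed by c.\<close>

lemma tail_le_if_KL_ge:
  fixes \<epsilon> a \<kappa> c :: real
  assumes K: "\<forall>\<^sub>F N in sequentially. \<forall>q\<in>prob_vecs N. (\<exists>j<N. \<epsilon> < q j) \<or> a - 30 * \<epsilon> \<le> 1 / 2 - bad_mass N q \<longrightarrow> \<kappa> \<le> KL N q"
    and c: "0 < c"
  shows "\<forall>\<^sub>F n in sequentially. tail n a \<le> exp (- (real n * (\<kappa> - c)))"
proof -
  obtain N where N: "0 < N"
    and KN: "\<forall>q\<in>prob_vecs N. (\<exists>j<N. \<epsilon> < q j) \<or> a - 30 * \<epsilon> \<le> 1 / 2 - bad_mass N q \<longrightarrow> \<kappa> \<le> KL N q"
    using eventually_happens'[OF sequentially_bot eventually_conj[OF eventually_gt_at_top[of 0] K]] by blast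
  show ?thesis
    using polynomial_exp_decay[OF c, of N] eventually_ge_at_top[of 3]
  proof eventually_elim
    case (elim n)
    have "tail n a \<le> (real n + 1) ^ N * exp (- (real n * \<kappa>))"
      by (rule tail_le[OF N elim(2)]) (use KN in blast)
    also have "\<dots> = ((real n + 1) ^ N * exp (- (real n * c))) * exp (- (real n * (\<kappa> - c)))"
      by (simp add: exp_add[symmetric] algebra_simps)
    also have "\<dots> \<le> 1 * exp (- (real n * (\<kappa> - c)))" using elim(1) by (intro mult_right_mono) auto
    finally show ?case by simp
  qed
qed

text \<open>If the tail beyond a is infinitely often larger than exp (- n \<kappa>), then some frequency vector of entropy about \<kappa> has T \<ge> a
approximately. Its improvement has T > a + \<gamma>, and so the tail beyond a + \<gamma> is eventually at least
exp (- n (\<kappa> + \<omega>)). As \<gamma> does not depend on a, this gives both convergence and continuity.\<close>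

lemma tail_shift:
  fixes b0 \<omega> :: real
  assumes b0: "0 < b0" and w: "0 < \<omega>" "\<omega> \<le> 1"
  shows "\<exists>\<gamma>>0. \<forall>(a::real) (\<kappa>::real). a \<le> 1 / 2 - 2 * b0 \<longrightarrow> \<kappa> \<le> ln 4 + 1 \<longrightarrow> (\<exists>\<^sub>F n in sequentially. exp (- (real n * \<kappa>)) < tail n a)
    \<longrightarrow> (\<forall>\<^sub>F n in sequentially. exp (- (real n * (\<kappa> + \<omega>))) \<le> tail n (a + \<gamma>))"
proof -
  have p1: "0 \<le> ln (4::real) + 2" by simp
  have p3: "0 < \<omega> / 3" using w by simp
  obtain \<gamma>' :: real and G :: nat where g': "0 < \<gamma>'" and G: "0 < G" and
    imp: "\<And>r q. 0 < r \<Longrightarrow> q \<in> prob_vecs (G * r) \<Longrightarrow> KL (G * r) q \<le> ln 4 + 2 \<Longrightarrow> b0 \<le> bad_mass (G * r) q \<Longrightarrow>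
      \<exists>q'\<in>prob_vecs (G * r). bad_mass (G * r) q' \<le> bad_mass (G * r) q - \<gamma>'
         \<and> KL (G * r) q' \<le> KL (G * r) q + \<omega> / 3 \<and> (\<forall>j<G * r. q' j \<le> 2 * q j)"
    by (rule cheap_improvement[OF p1 b0 p3]) blast
  define m where "m = min \<gamma>' b0"
  have m: "0 < m" "m \<le> \<gamma>'" "m \<le> b0" using g' b0 by (auto simp: m_def)
  define \<epsilon> where "\<epsilon> = m / 400"
  have e: "0 < \<epsilon>" using m by (simp add: \<epsilon>_def)
  show ?thesis
  proof (intro exI[of _ "m / 2"] conjI allI impI)
    show "0 < m / 2" using m by simp
    fix a \<kappa> :: real assume a: "a \<le> 1 / 2 - 2 * b0" and k: "\<kappa> \<le> ln 4 + 1" and fr: "\<exists>\<^sub>F n in sequentially. exp (- (real n * \<kappa>)) < tail n a"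
    obtain N0 where N0: "\<And>N q. N0 \<le> N \<Longrightarrow> q \<in> prob_vecs N \<Longrightarrow> \<exists>j<N. \<epsilon> < q j \<Longrightarrow> ln 4 + 2 \<le> KL N q"
      using KL_large_if_concentrated[OF e, of "ln 4 + 2"] unfolding eventually_sequentially by blast
    \<comment> \<open>the number of cells has to be a multiple of G, and large\<close>
    define r where "r = N0 + 1"
    define N where "N = G * r"
    have r: "0 < r" by (simp add: r_def)
    have N: "0 < N" "N0 \<le> N"
    proof -
      show "0 < N" using r G by (simp add: N_def)
      have "1 * r \<le> G * r" using G by (intro mult_right_mono) auto
      then show "N0 \<le> N" by (simp add: N_def r_def)
    qed
    have "\<exists>q\<in>prob_vecs N. ((\<exists>j<N. \<epsilon> < q j) \<or> a - 30 * \<epsilon> \<le> 1 / 2 - bad_mass N q) \<and> KL N q < \<kappa> + \<omega> / 3"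
    proof (rule ccontr)
      assume no: "\<not> ?thesis"
      have "\<forall>\<^sub>F n in sequentially. \<not> exp (- (real n * \<kappa>)) < tail n a"
        using polynomial_exp_decay[OF p3, of N] eventually_ge_at_top[of 3]
      proof eventually_elim
        case (elim n)
        have "tail n a \<le> (real n + 1) ^ N * exp (- (real n * (\<kappa> + \<omega> / 3)))"
          by (rule tail_le[OF N(1) elim(2)]) (use no in force)
        also have "\<dots> = ((real n + 1) ^ N * exp (- (real n * (\<omega> / 3)))) * exp (- (real n * \<kappa>))"
          by (simp add: exp_add[symmetric] algebra_simps)
        also have "\<dots> \<le> 1 * exp (- (real n * \<kappa>))" using elim(1) by (intro mult_right_mono) auto
        finally show ?case by simp
      qed
      then show False using fr by (simp add: frequently_def)
    qed
    then obtain q where q: "q \<in> prob_vecs N" "(\<exists>j<N. \<epsilon> < q j) \<or> a - 30 * \<epsilon> \<le> 1 / 2 - bad_mass N q" "KL N q < \<kappa> + \<omega> / 3"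
      by blast
    have K2: "KL N q < ln 4 + 2" using q(3) k w by linarith
    then have nc: "\<not> (\<exists>j<N. \<epsilon> < q j)" using N0[OF N(2) q(1)] not_le by blast
    then have qe: "q j \<le> \<epsilon>" if "j < N" for j using that not_less by blast
    have T: "a - 30 * \<epsilon> \<le> 1 / 2 - bad_mass N q" using q(2) nc by blast
    have "\<exists>q'\<in>prob_vecs N. (\<forall>j<N. q' j \<le> 2 * \<epsilon>) \<and> a + m / 2 + 30 * (2 * \<epsilon>) < 1 / 2 - bad_mass N q' \<and> KL N q' \<le> \<kappa> + 2 * \<omega> / 3"
    proof (cases "b0 \<le> bad_mass N q")
      case True
      then obtain q' where q': "q' \<in> prob_vecs N" "bad_mass N q' \<le> bad_mass N q - \<gamma>'" "KL N q' \<le> KL N q + \<omega> / 3"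
        "\<forall>j<N. q' j \<le> 2 * q j"
        using imp[OF r, of q] q(1) K2 unfolding N_def[symmetric] by auto
      have "\<forall>j<N. q' j \<le> 2 * \<epsilon>" using q'(4) qe by fastforce
      moreover have "a + m / 2 + 30 * (2 * \<epsilon>) < 1 / 2 - bad_mass N q'"
        using q'(2) T m unfolding \<epsilon>_def by linarith
      ultimately show ?thesis using q' q(3) by (intro bexI[of _ q']) auto
    next
      case False
      have "\<forall>j<N. q j \<le> 2 * \<epsilon>" using qe e by fastforce
      moreover have "a + m / 2 + 30 * (2 * \<epsilon>) < 1 / 2 - bad_mass N q"
        using False a m unfolding \<epsilon>_def by linarith
      ultimately show ?thesis using q w by (intro bexI[of _ q]) auto
    qed
    then obtain q' where q': "q' \<in> prob_vecs N" "\<And>j. j < N \<Longrightarrow> q' j \<le> 2 * \<epsilon>"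
      "(a + m / 2) + 30 * (2 * \<epsilon>) < 1 / 2 - bad_mass N q'" "KL N q' \<le> \<kappa> + 2 * \<omega> / 3" by blast
    have "\<forall>\<^sub>F n in sequentially. exp (- (real n * (KL N q' + \<omega> / 3))) \<le> tail n (a + m / 2)"
      by (rule tail_ge[OF q'(1-3)]) (use w in auto)
    then show "\<forall>\<^sub>F n in sequentially. exp (- (real n * (\<kappa> + \<omega>))) \<le> tail n (a + m / 2)"
    proof eventually_elim
      case (elim n)
      have "real n * (KL N q' + \<omega> / 3) \<le> n * (\<kappa> + \<omega>)" using q'(4) by (intro mult_left_mono) auto
      then have "exp (- (real n * (\<kappa> + \<omega>))) \<le> exp (- (real n * (KL N q' + \<omega> / 3)))" by simp
      then show ?case using elim by linarith
    qed
  qed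
qed

definition decay :: "real \<Rightarrow> nat \<Rightarrow> real" where
  "decay a n = - ln (tail n a) / n"

lemma tail_pos: "3 \<le> n \<Longrightarrow> a \<le> 1 / 2 \<Longrightarrow> 0 < tail n a"
  using tail_ge_quarter_power[of n a] by (smt (verit) zero_less_power zero_less_divide_1_iff)

lemma decay_less_iff:
  assumes "3 \<le> n" "a \<le> 1 / 2"
  shows "decay a n < \<kappa> \<longleftrightarrow> exp (- (real n * \<kappa>)) < tail n a" and "decay a n \<le> \<kappa> \<longleftrightarrow> exp (- (real n * \<kappa>)) \<le> tail n a"
    and "\<kappa> \<le> decay a n \<longleftrightarrow> tail n a \<le> exp (- (real n * \<kappa>))"
proof -
  have n: "0 < real n" using assms by simp
  have t: "0 < tail n a" by (rule tail_pos[OF assms])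
  have "decay a n < \<kappa> \<longleftrightarrow> - (n * \<kappa>) < ln (tail n a)"
    unfolding decay_def pos_divide_less_eq[OF n] by (metis minus_less_iff mult.commute)
  also have "\<dots> \<longleftrightarrow> exp (- (real n * \<kappa>)) < tail n a" using t by (metis exp_less_cancel_iff exp_ln)
  finally show 1: "decay a n < \<kappa> \<longleftrightarrow> exp (- (real n * \<kappa>)) < tail n a" .
  then show "\<kappa> \<le> decay a n \<longleftrightarrow> tail n a \<le> exp (- (real n * \<kappa>))" by (simp add: not_less[symmetric])
  have "decay a n \<le> \<kappa> \<longleftrightarrow> - (n * \<kappa>) \<le> ln (tail n a)"
    unfolding decay_def pos_divide_le_eq[OF n] by (metis minus_le_iff mult.commute)
  also have "\<dots> \<longleftrightarrow> exp (- (real n * \<kappa>)) \<le> tail n a" using t by (metis exp_le_cancel_iff exp_ln)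
  finally show "decay a n \<le> \<kappa> \<longleftrightarrow> exp (- (real n * \<kappa>)) \<le> tail n a" .
qed

lemma decay_bounds: "3 \<le> n \<Longrightarrow> a \<le> 1 / 2 \<Longrightarrow> 0 \<le> decay a n" "3 \<le> n \<Longrightarrow> a \<le> 1 / 2 \<Longrightarrow> decay a n \<le> ln 4"
proof -
  assume n: "3 \<le> n" and a: "a \<le> 1 / 2"
  show "0 \<le> decay a n" using tail_le_1[of n a] by (simp add: decay_less_iff(3)[OF n a])
  have "exp (- (real n * ln 4)) = (1 / 4) ^ n"
  proof -
    have "exp (- (real n * ln 4)) = exp (- ln 4 :: real) ^ n" by (simp add: exp_of_nat_mult[symmetric])
    then show ?thesis by (simp add: exp_minus inverse_eq_divide)
  qed
  then show "decay a n \<le> ln 4" using tail_ge_quarter_power[OF n a] by (simp add: decay_less_iff(2)[OF n a])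
qed

lemma decay_shift:
  fixes b0 \<omega> :: real
  assumes b0: "0 < b0" and w: "0 < \<omega>" "\<omega> \<le> 1"
  shows "\<exists>\<gamma>>0. \<forall>a b \<kappa>. a \<le> 1 / 2 - 2 * b0 \<longrightarrow> b \<le> a + \<gamma> \<longrightarrow> b \<le> 1 / 2 \<longrightarrow> \<kappa> \<le> ln 4 + 1 \<longrightarrow>
    (\<exists>\<^sub>F n in sequentially. decay a n < \<kappa>) \<longrightarrow> (\<forall>\<^sub>F n in sequentially. decay b n \<le> \<kappa> + \<omega>)"
proof -
  obtain \<gamma> where g: "0 < \<gamma>" and sh: "\<And>a \<kappa>. a \<le> 1 / 2 - 2 * b0 \<Longrightarrow> \<kappa> \<le> ln 4 + 1 \<Longrightarrow>
      \<exists>\<^sub>F n in sequentially. exp (- (real n * \<kappa>)) < tail n a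
    \<Longrightarrow> \<forall>\<^sub>F n in sequentially. exp (- (real n * (\<kappa> + \<omega>))) \<le> tail n (a + \<gamma>)"
    using tail_shift[OF assms] by blast
  show ?thesis
  proof (intro exI[of _ \<gamma>] conjI allI impI g)
    fix a b \<kappa> assume a: "a \<le> 1 / 2 - 2 * b0" and b: "b \<le> a + \<gamma>" "b \<le> 1 / 2" and k: "\<kappa> \<le> ln 4 + 1"
      and fr: "\<exists>\<^sub>F n in sequentially. decay a n < \<kappa>"
    have a2: "a \<le> 1 / 2" using a b0 by linarith
    have "\<exists>\<^sub>F n in sequentially. exp (- (real n * \<kappa>)) < tail n a"
      using frequently_eventually_frequently[OF fr eventually_ge_at_top[of 3]]
      by (rule frequently_elim1) (use decay_less_iff(1)[OF _ a2] in blast)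
    from sh[OF a k this] show "\<forall>\<^sub>F n in sequentially. decay b n \<le> \<kappa> + \<omega>"
      using eventually_ge_at_top[of 3]
    proof eventually_elim
      case (elim n)
      then show ?case using tail_antimono[OF b(1), of n] by (simp add: decay_less_iff(2)[OF elim(2) b(2)])
    qed
  qed
qed

lemma decay_convergent:
  assumes a: "a < 1 / 2"
  shows "\<exists>L. decay a \<longlonglongrightarrow> L"
proof (rule convergent_if_frequently_imp_eventually)
  show "\<forall>\<^sub>F n in sequentially. 0 \<le> decay a n" "\<forall>\<^sub>F n in sequentially. decay a n \<le> ln 4"
    using eventually_ge_at_top[of 3] by (eventually_elim, use decay_bounds a in force)+
  fix \<kappa> \<omega> :: real assume k: "\<kappa> \<le> ln 4 + 1" and w: "0 < \<omega>" and fr: "\<exists>\<^sub>F n in sequentially. decay a n < \<kappa>"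
  have "0 < (1 / 2 - a) / 2" "0 < min \<omega> 1" "min \<omega> 1 \<le> 1" using a w by auto
  from decay_shift[OF this] obtain \<gamma> where "0 < \<gamma>" and
    sh: "\<And>b. b \<le> a + \<gamma> \<Longrightarrow> b \<le> 1 / 2 \<Longrightarrow> \<forall>\<^sub>F n in sequentially. decay b n \<le> \<kappa> + min \<omega> 1"
    using k fr by (auto simp: field_simps)
  have "\<forall>\<^sub>F n in sequentially. decay a n \<le> \<kappa> + min \<omega> 1" by (rule sh) (use \<open>0 < \<gamma>\<close> a in auto)
  then show "\<forall>\<^sub>F n in sequentially. decay a n \<le> \<kappa> + \<omega>" by eventually_elim linarith
qed

text \<open>One inequality comes from samples in [1/4, 1/2), the other from the entropy bound ln 4.\<close>

lemma decay_half: "decay (1 / 2) \<longlonglongrightarrow> ln 4"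
proof (rule order_tendstoI)
  fix y :: real assume y: "ln 4 < y"
  show "\<forall>\<^sub>F n in sequentially. decay (1 / 2) n < y"
    using eventually_ge_at_top[of 3] by eventually_elim (use decay_bounds(2)[of _ "1 / 2"] y in force)
next
  fix y :: real assume y: "y < ln 4"
  define c where "c = (ln 4 - y) / 3"
  have c: "0 < c" "ln 4 - c < ln 4" "y < ln 4 - c - c" using y by (auto simp: c_def field_simps)
  obtain \<epsilon> where "\<forall>\<^sub>F N in sequentially. \<forall>q\<in>prob_vecs N.
    (\<exists>j<N. \<epsilon> < q j) \<or> 1 / 2 - 30 * \<epsilon> \<le> 1 / 2 - bad_mass N q \<longrightarrow> ln 4 - c \<le> KL N q"
    using KL_ge_ln_4[OF c(2)] by blast
  from tail_le_if_KL_ge[OF this c(1)] show "\<forall>\<^sub>F n in sequentially. y < decay (1 / 2) n"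
    using eventually_ge_at_top[of 3]
  proof eventually_elim
    case (elim n)
    then have "ln 4 - c - c \<le> decay (1 / 2) n" by (simp add: decay_less_iff(3))
    then show ?case using c by linarith
  qed
qed

definition rate :: "real \<Rightarrow> real" where "rate a = lim (decay a)"

lemma decay_tendsto: "a \<le> 1 / 2 \<Longrightarrow> decay a \<longlonglongrightarrow> rate a"
proof -
  assume a: "a \<le> 1 / 2"
  have "convergent (decay a)"
  proof (cases "a = 1 / 2")
    case True
    show ?thesis unfolding True convergent_def using decay_half by blast
  next
    case False
    then show ?thesis using decay_convergent[of a] a by (simp add: convergent_def)
  qed
  then show ?thesis unfolding rate_def by (simp add: convergent_LIMSEQ_iff)
qed

lemma rate_mono:
  assumes "a \<le> b" "b \<le> 1 / 2" shows "rate a \<le> rate b"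
proof (rule tendsto_le[OF sequentially_bot decay_tendsto decay_tendsto])
  show "\<forall>\<^sub>F n in sequentially. decay a n \<le> decay b n"
    using eventually_ge_at_top[of 3]
  proof eventually_elim
    case (elim n)
    have "0 < tail n b" "tail n b \<le> tail n a" using tail_pos[OF elim assms(2)] tail_antimono[OF assms(1)] by auto
    then show ?case unfolding decay_def by (simp add: divide_right_mono)
  qed
qed (use assms in auto)

lemma rate_le_ln_4: "a \<le> 1 / 2 \<Longrightarrow> rate a \<le> ln 4"
  using rate_mono[of a "1 / 2"] LIMSEQ_unique[OF decay_half decay_tendsto[of "1 / 2"]] by simp

lemma rate_uniformly_continuous:
  assumes b0: "0 < b0" and w: "0 < \<omega>"
  shows "\<exists>\<gamma>>0. \<forall>a b. a \<le> 1 / 2 - 2 * b0 \<longrightarrow> b \<le> a + \<gamma> \<longrightarrow> b \<le> 1 / 2 \<longrightarrow> rate b \<le> rate a + \<omega>"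
proof -
  define \<omega>' where "\<omega>' = min (\<omega> / 2) 1"
  have w': "0 < \<omega>'" "\<omega>' \<le> 1" "\<omega>' \<le> \<omega> / 2" using w by (auto simp: \<omega>'_def)
  obtain \<gamma> where g: "0 < \<gamma>" and sh: "\<And>a b \<kappa>. a \<le> 1 / 2 - 2 * b0 \<Longrightarrow> b \<le> a + \<gamma> \<Longrightarrow> b \<le> 1 / 2 \<Longrightarrow> \<kappa> \<le> ln 4 + 1 \<Longrightarrow>
    \<exists>\<^sub>F n in sequentially. decay a n < \<kappa> \<Longrightarrow> \<forall>\<^sub>F n in sequentially. decay b n \<le> \<kappa> + \<omega>'"
    using decay_shift[OF b0 w'(1,2)] by blast
  show ?thesis
  proof (intro exI[of _ \<gamma>] conjI allI impI g)
    fix a b assume a: "a \<le> 1 / 2 - 2 * b0" and b: "b \<le> a + \<gamma>" "b \<le> 1 / 2"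
    have a2: "a \<le> 1 / 2" using a b0 by linarith
    define \<kappa> where "\<kappa> = rate a + \<omega>'"
    have "rate a < \<kappa>" using w' by (simp add: \<kappa>_def)
    then have "\<forall>\<^sub>F n in sequentially. decay a n < \<kappa>" by (rule order_tendstoD(2)[OF decay_tendsto[OF a2]])
    then have fr: "\<exists>\<^sub>F n in sequentially. decay a n < \<kappa>" by (simp add: eventually_frequently)
    have k: "\<kappa> \<le> ln 4 + 1" using rate_le_ln_4[OF a2] w' by (simp add: \<kappa>_def)
    have "rate b \<le> \<kappa> + \<omega>'"
      by (rule tendsto_upperbound[OF decay_tendsto[OF b(2)] sh[OF a b k fr] sequentially_bot])
    then show "rate b \<le> rate a + \<omega>" using w' by (simp add: \<kappa>_def)
  qed
qed

lemma continuous_rate: "continuous_on {0<..<1 / 2} rate"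
proof (rule continuous_at_imp_continuous_on, rule ballI)
  fix x :: real assume "x \<in> {0<..<1 / 2}"
  then have x: "x < 1 / 2" by simp
  \<comment> \<open>room on both sides of x in which the shift is uniform\<close>
  define b0 where "b0 = (1 / 2 - x) / 4"
  have b0: "0 < b0" "x + 3 * b0 < 1 / 2" using x by (auto simp: b0_def field_simps)
  show "isCont rate x"
    unfolding isCont_def
  proof (rule LIM_I)
    fix e :: real assume e: "0 < e"
    obtain \<gamma> where g: "0 < \<gamma>" and c: "\<And>a b. a \<le> 1 / 2 - 2 * b0 \<Longrightarrow> b \<le> a + \<gamma> \<Longrightarrow> b \<le> 1 / 2 \<Longrightarrow> rate b \<le> rate a + e / 2"
      using rate_uniformly_continuous[OF b0(1), of "e / 2"] e by auto
    show "\<exists>s>0. \<forall>y. y \<noteq> x \<and> norm (y - x) < s \<longrightarrow> norm (rate y - rate x) < e"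
    proof (intro exI[of _ "min \<gamma> b0"] conjI allI impI)
      show "0 < min \<gamma> b0" using g b0 by simp
      fix y assume "y \<noteq> x \<and> norm (y - x) < min \<gamma> b0"
      then have y: "y \<le> x + \<gamma>" "x \<le> y + \<gamma>" "y \<le> x + b0" by (auto simp: abs_less_iff)
      have "rate y \<le> rate x + e / 2" by (rule c) (use y b0 in auto)
      moreover have "rate x \<le> rate y + e / 2" by (rule c) (use y b0 x in auto)
      ultimately show "norm (rate y - rate x) < e" using e by (simp add: abs_less_iff)
    qed
  qed
qed

lemma rate_ge:
  assumes a: "0 < a" "a \<le> 1 / 200"
  defines "\<theta> \<equiv> 480 / 11 * a"
  shows "(\<theta> * a / 8 - 64 * \<theta> ^ 3) / (1 + 54 * \<theta>) \<le> rate a"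
proof (rule field_le_epsilon)
  fix e :: real assume e: "0 < e"
  have th: "0 < 1 + 54 * \<theta>" using a by (simp add: \<theta>_def)
  define \<kappa> where "\<kappa> = (\<theta> * a / 8 - 64 * \<theta> ^ 3) / (1 + 54 * \<theta>) - e / 2"
  have "\<kappa> < (\<theta> * a / 8 - 64 * \<theta> ^ 3) / (1 + 54 * \<theta>)" using e by (simp add: \<kappa>_def)
  then have k: "\<kappa> * (1 + 54 * \<theta>) < \<theta> * a / 8 - 64 * \<theta> ^ 3" using th by (simp add: pos_less_divide_eq)
  obtain \<epsilon> where K: "\<forall>\<^sub>F N in sequentially. \<forall>q\<in>prob_vecs N.
    (\<exists>j<N. \<epsilon> < q j) \<or> a - 30 * \<epsilon> \<le> 1 / 2 - bad_mass N q \<longrightarrow> \<kappa> \<le> KL N q"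
    using KL_ge_quadratic[OF a k[unfolded \<theta>_def]] by blast
  have e2: "0 < e / 2" using e by simp
  have "\<forall>\<^sub>F n in sequentially. \<kappa> - e / 2 \<le> decay a n"
    using tail_le_if_KL_ge[OF K e2] eventually_ge_at_top[of 3]
  proof eventually_elim
    case (elim n)
    then show ?case using a by (simp add: decay_less_iff(3))
  qed
  then have "\<kappa> - e / 2 \<le> rate a"
    by (rule tendsto_lowerbound[OF decay_tendsto _ sequentially_bot, rotated]) (use a in auto)
  then show "(\<theta> * a / 8 - 64 * \<theta> ^ 3) / (1 + 54 * \<theta>) \<le> rate a + e" by (simp add: \<kappa>_def)
qed

text \<open>The quadratic term of h, with its large coefficient, compensates the error 3456 h^2 of the expansion.\<close>

lemma rate_le:
  assumes a: "0 < a" "a \<le> 1 / 400000000"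
  defines "h \<equiv> 480 / 11 * a + 400000000 * a\<^sup>2"
  shows "rate a \<le> h\<^sup>2 * (11 / 1920) / 2 + 512 * h ^ 3"
proof (rule field_le_epsilon)
  fix e :: real assume e: "0 < e"
  have "400000000 * a * a \<le> 1 * a" using a by (intro mult_right_mono) auto
  then have aa: "400000000 * a\<^sup>2 \<le> a" by (simp add: power2_eq_square)
  have h: "0 < h" "h \<le> 45 * a"
  proof -
    show "0 < h" unfolding h_def using a by (intro add_pos_pos) auto
    show "h \<le> 45 * a" unfolding h_def using aa a by linarith
  qed
  have h16: "h \<le> 1 / 16" using h a by linarith
  have "h\<^sup>2 \<le> (45 * a)\<^sup>2" using h by (intro power_mono) auto
  then have "3456 * h\<^sup>2 \<le> 6998400 * a\<^sup>2" by (simp add: power_mult_distrib)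
  moreover have "0 < a\<^sup>2" using a by simp
  moreover have "4 * h * (11 / 1920) = a + 17600000000 / 1920 * a\<^sup>2" by (simp add: h_def)
  ultimately have ah: "a < 4 * h * (11 / 1920) - 3456 * h\<^sup>2" by linarith
  have "h\<^sup>2 * (11 / 1920) / 2 + 512 * h ^ 3 < h\<^sup>2 * (11 / 1920) / 2 + 512 * h ^ 3 + e / 2" using e by simp
  from ex_cheap_prob_vec[OF h(1) h16 ah this] obtain N q m where q: "q \<in> prob_vecs N" "\<And>j. j < N \<Longrightarrow> q j \<le> m"
    "a + 30 * m < 1 / 2 - bad_mass N q" "KL N q < h\<^sup>2 * (11 / 1920) / 2 + 512 * h ^ 3 + e / 2" by blast
  have e2: "0 < e / 2" using e by simp
  have "\<forall>\<^sub>F n in sequentially. exp (- (real n * (KL N q + e / 2))) \<le> tail n a"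
    by (rule tail_ge[OF q(1) _ q(3) e2]) (rule q(2))
  then have "\<forall>\<^sub>F n in sequentially. decay a n \<le> KL N q + e / 2"
    using eventually_ge_at_top[of 3]
  proof eventually_elim
    case (elim n)
    then show ?case using a by (simp add: decay_less_iff(2))
  qed
  then have "rate a \<le> KL N q + e / 2"
    by (rule tendsto_upperbound[OF decay_tendsto _ sequentially_bot, rotated]) (use a in auto)
  then show "rate a \<le> h\<^sup>2 * (11 / 1920) / 2 + 512 * h ^ 3 + e" using q(4) by linarith
qed

lemma rate_asymp: "rate \<sim>[at_right 0] (\<lambda>a. a\<^sup>2 / (32 * (11 / 1920)))"
proof (rule asymp_equivI')
  let ?lo = "\<lambda>a::real. ((480 / 11 * a) * a / 8 - 64 * (480 / 11 * a) ^ 3) / (1 + 54 * (480 / 11 * a)) / (a\<^sup>2 / (32 * (11 / 1920)))"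
  let ?hi = "\<lambda>a::real. ((480 / 11 * a + 400000000 * a\<^sup>2)\<^sup>2 * (11 / 1920) / 2 + 512 * (480 / 11 * a + 400000000 * a\<^sup>2) ^ 3) / (a\<^sup>2 / (32 * (11 / 1920)))"
  have small: "\<forall>\<^sub>F a in at_right (0::real). a \<in> {0<..<1 / 400000000}" by (rule eventually_at_right_real) simp
  show "((\<lambda>a. rate a / (a\<^sup>2 / (32 * (11 / 1920)))) \<longlongrightarrow> 1) (at_right 0)"
  proof (rule tendsto_sandwich[of ?lo _ _ ?hi])
    show "\<forall>\<^sub>F a in at_right 0. ?lo a \<le> rate a / (a\<^sup>2 / (32 * (11 / 1920)))"
      using small by eventually_elim (intro divide_right_mono rate_ge, auto)
    show "\<forall>\<^sub>F a in at_right 0. rate a / (a\<^sup>2 / (32 * (11 / 1920))) \<le> ?hi a"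
      using small by eventually_elim (intro divide_right_mono rate_le, auto)
    show "(?lo \<longlongrightarrow> 1) (at_right 0)" by real_asymp
    show "(?hi \<longlongrightarrow> 1) (at_right 0)" by real_asymp (simp add: power2_eq_square)
  qed
qed

text \<open>Here T(q) \<le> 1/2 < a, so only concentrated frequency vectors are left, and their entropy is unbounded in N.\<close>

lemma tail_superexponential:
  assumes a: "1 / 2 < a"
  shows "\<forall>\<^sub>F n in sequentially. tail n a \<le> exp (- (real n * \<kappa>))"
proof -
  define \<epsilon> where "\<epsilon> = (a - 1 / 2) / 60"
  have e: "0 < \<epsilon>" "1 / 2 < a - 30 * \<epsilon>" using a by (auto simp: \<epsilon>_def field_simps)
  have "\<forall>\<^sub>F N in sequentially. \<forall>q\<in>prob_vecs N. (\<exists>j<N. \<epsilon> < q j) \<or> a - 30 * \<epsilon> \<le> 1 / 2 - bad_mass N q \<longrightarrow> \<kappa> + 1 \<le> KL N q"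
    using KL_large_if_concentrated[OF e(1), of "\<kappa> + 1"]
  proof eventually_elim
    case (elim N)
    have "\<not> a - 30 * \<epsilon> \<le> 1 / 2 - bad_mass N q" if "q \<in> prob_vecs N" for q
      using bad_mass_nonneg[OF that] e by linarith
    then show ?case using elim by blast
  qed
  from tail_le_if_KL_ge[OF this, of 1] show ?thesis by simp
qed

text \<open>Beyond the supremum 1/2 of T the rate is infinite.\<close>

definition extended_rate :: "real \<Rightarrow> ereal" where
  "extended_rate a = (if a \<le> 1 / 2 then ereal (rate a) else \<infinity>)"

lemma ln_prob_tail_tendsto:
  "(\<lambda>n. ln_prob (tail n a) / ereal (real n)) \<longlonglongrightarrow> - extended_rate a"
proof (cases "a \<le> 1 / 2")
  case True
  have "(\<lambda>n. ereal (- decay a n)) \<longlonglongrightarrow> ereal (- rate a)"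
    by (intro tendsto_ereal tendsto_minus decay_tendsto[OF True])
  moreover have "\<forall>\<^sub>F n in sequentially. ereal (- decay a n) = ln_prob (tail n a) / ereal (real n)"
    using eventually_ge_at_top[of 3]
  proof eventually_elim
    case (elim n)
    then show ?case using tail_pos[OF elim True] by (simp add: ln_prob_def decay_def)
  qed
  ultimately have "(\<lambda>n. ln_prob (tail n a) / ereal (real n)) \<longlonglongrightarrow> ereal (- rate a)"
    by (rule Lim_transform_eventually)
  then show ?thesis using True by (simp add: extended_rate_def)
next
  case False
  have "(\<lambda>n. ln_prob (tail n a) / ereal (real n)) \<longlonglongrightarrow> - \<infinity>"
    unfolding tendsto_MInfty
  proof
    fix r :: real
    have "1 / 2 < a" using False by simp
    from tail_superexponential[OF this, of "1 - r"] eventually_gt_at_top[of 0]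
    show "\<forall>\<^sub>F n in sequentially. ln_prob (tail n a) / ereal (real n) < ereal r"
    proof eventually_elim
      case (elim n)
      show ?case
      proof (cases "tail n a = 0")
        case True
        then show ?thesis using elim by (simp add: ln_prob_def)
      next
        case False
        then have t: "0 < tail n a" using tail_nonneg[of n a] by simp
        have "ln (tail n a) \<le> - (n * (1 - r))" using elim(1) t by (metis ln_exp ln_le_cancel_iff exp_gt_zero)
        moreover have np: "0 < real n" using elim by simp
        ultimately have "ln (tail n a) / n \<le> - (1 - r)"
          unfolding pos_divide_le_eq[OF np] by (simp add: algebra_simps)
        then show ?thesis using False elim by (simp add: ln_prob_def)
      qed
    qed
  qed
  then show ?thesis using False by (simp add: extended_rate_def)
qed

end

theorem theorem3:
  fixes M :: "'a measure" and X :: "nat \<Rightarrow> 'a \<Rightarrow> real" and l :: real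
  assumes "prob_space M"
    and "prob_space.indep_vars M (\<lambda>_. borel) X UNIV"
    and "l > 0"
    and "\<And>i. cdf (distr M borel (X i)) = pareto_cdf l"
  shows "(\<exists>f :: real \<Rightarrow> ereal.
            (\<forall>a>0. (\<lambda>n. ln_prob (measure M {\<omega> \<in> space M. I_stat (\<lambda>i. X i \<omega>) n > a}) / ereal (real n))
                     \<longlonglongrightarrow> - f a)
          \<and> (\<exists>\<delta>>0. (\<forall>a\<in>{0<..<\<delta>}. \<bar>f a\<bar> \<noteq> \<infinity>) \<and> continuous_on {0<..<\<delta>} f)
          \<and> (\<lambda>a. real_of_ereal (f a)) \<sim>[at_right 0] (\<lambda>a. a\<^sup>2 / (32 * Delta3_sq)))
       \<and> Delta3_sq = 11 / 1920
       \<and> \<bar>1 / (32 * Delta3_sq) - 5.455\<bar> \<le> 0.0005"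
proof -
  interpret pareto_sample M X l
    by (intro pareto_sample.intro pareto_sample_axioms.intro assms)
  have lim: "\<forall>a>0. (\<lambda>n. ln_prob (measure M {\<omega> \<in> space M. I_stat (\<lambda>i. X i \<omega>) n > a}) / ereal (real n)) \<longlonglongrightarrow> - extended_rate a"
    using ln_prob_tail_tendsto unfolding tail_def by blast
  have fin: "\<forall>a\<in>{0<..<1 / 2}. \<bar>extended_rate a\<bar> \<noteq> \<infinity>" by (auto simp: extended_rate_def)
  have "continuous_on {0<..<1 / 2} (\<lambda>a. ereal (rate a))" using continuous_rate by (rule continuous_on_ereal)
  then have cont: "continuous_on {0<..<1 / 2} extended_rate"
    by (rule continuous_on_eq) (auto simp: extended_rate_def)
  have "\<forall>\<^sub>F a in at_right (0::real). a \<in> {0<..<1 / 2}" by (rule eventually_at_right_real) simp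
  then have "\<forall>\<^sub>F a in at_right 0. real_of_ereal (extended_rate a) = rate a"
    by eventually_elim (auto simp: extended_rate_def)
  then have asy: "(\<lambda>a. real_of_ereal (extended_rate a)) \<sim>[at_right 0] (\<lambda>a. a\<^sup>2 / (32 * Delta3_sq))"
    unfolding Delta3_sq_value using rate_asymp by (subst asymp_equiv_cong) auto
  show ?thesis
  proof (intro conjI)
    show "Delta3_sq = 11 / 1920" by (rule Delta3_sq_value)
    show "\<bar>1 / (32 * Delta3_sq) - 5.455\<bar> \<le> 0.0005" unfolding Delta3_sq_value by simp
    show "\<exists>f :: real \<Rightarrow> ereal.
            (\<forall>a>0. (\<lambda>n. ln_prob (measure M {\<omega> \<in> space M. I_stat (\<lambda>i. X i \<omega>) n > a}) / ereal (real n))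
                     \<longlonglongrightarrow> - f a)
          \<and> (\<exists>\<delta>>0. (\<forall>a\<in>{0<..<\<delta>}. \<bar>f a\<bar> \<noteq> \<infinity>) \<and> continuous_on {0<..<\<delta>} f)
          \<and> (\<lambda>a. real_of_ereal (f a)) \<sim>[at_right 0] (\<lambda>a. a\<^sup>2 / (32 * Delta3_sq))"
      using lim fin cont asy by (intro exI[of _ extended_rate] conjI exI[of _ "1 / 2"]) auto
  qed
qed

end
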